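(* Let $A=\{A_\alpha\}_{\alpha\in\pi}$ be a Hopf $\pi$-coalgebra and let $R$ be a right ideal of $A_1$ contained in $\ker\varepsilon$. For each $\alpha\in\pi$ put $N_\alpha=t_\alpha^{-1}(R\otimes A_\alpha)$. Then $N=\{N_\alpha\}_{\alpha\in\pi}$ is a sub-bimodule of $A^2=\{A^2_\alpha\}_{\alpha\in\pi}$. Moreover, let $\Gamma=\{\Gamma_\alpha\}_{\alpha\in\pi}$ with $\Gamma_\alpha=A_\alpha^2/N_\alpha$, let $\Pi_\alpha:A_\alpha^2\to A_\alpha^2/N_\alpha$ be the canonical epimorphisms, and let $d=\{d_\alpha\}_{\alpha\in\pi}$ with $d_\alpha=\Pi_\alpha\circ D_\alpha$. Then the first order differential calculus $\Gamma=(\{\Gamma_\alpha\}_{\alpha\in\pi},d)$ is right covariant. Any right covariant first order differential calculus on $A$ can be obtained in this way.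
   Context: Let $k$ be a field and $\pi$ a group with identity $1$; $\otimes=\otimes_k$. A Hopf $\pi$-coalgebra (Hopf group coalgebra) is a family $A=\{A_\alpha\}_{\alpha\in\pi}$ of unital associative $k$-algebras (multiplication $m_\alpha$, unit $1_\alpha$) with algebra maps $\Delta_{\alpha,\beta}:A_{\alpha\beta}\to A_\alpha\otimes A_\beta$, $\varepsilon:A_1\to k$ and linear maps $S_\alpha:A_\alpha\to A_{\alpha^{-1}}$ such that $(\Delta_{\alpha,\beta}\otimes id)\Delta_{\alpha\beta,\gamma}=(id\otimes\Delta_{\beta,\gamma})\Delta_{\alpha,\beta\gamma}$, $(id\otimes\varepsilon)\Delta_{\alpha,1}=id=(\varepsilon\otimes id)\Delta_{1,\alpha}$, and $m_\alpha(S_{\alpha^{-1}}\otimes id)\Delta_{\alpha^{-1},\alpha}=\varepsilon(\cdot)1_\alpha=m_\alpha(id\otimes S_{\alpha^{-1}})\Delta_{\alpha,\alpha^{-1}}$. A $\pi$-graded bimodule over $A$ is a family $\Gamma=\{\Gamma_\alpha\}$ with $\Gamma_\alpha$ an $A_\alpha$-bimodule; a sub-bimodule is a family of $A_\alpha$-sub-bimodules. A ($\pi$-graded) first order differential calculus over $A$ is a $\pi$-graded bimodule $\Gamma$ with linear maps $d_\alpha:A_\alpha\to\Gamma_\alpha$ such that $d_\alpha(ab)=d_\alpha(a)b+a\,d_\alpha(b)$ for $a,b\in A_\alpha$ and every element of $\Gamma_\alpha$ is a finite sum $\sum_k a_k d_\alpha b_k$ with $a_k,b_k\in A_\alpha$.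 Calculi $(\Gamma,d)$ and $(\Gamma',d')$ are isomorphic if there are bimodule isomorphisms $i_\alpha:\Gamma_\alpha\to\Gamma'_\alpha$ with $i_\alpha(d_\alpha a)=d'_\alpha a$ for all $a\in A_\alpha$, $\alpha\in\pi$; "obtained in this way" is meant up to this identification. The calculus is right covariant if for all $\alpha,\beta\in\pi$ and $a_k,b_k\in A_{\alpha\beta}$, $\sum_k a_k d_{\alpha\beta}b_k=0$ implies $\sum_k\Delta_{\alpha,\beta}(a_k)(d_\alpha\otimes id)\Delta_{\alpha,\beta}(b_k)=0$. $A^2_\alpha=\{q\in A_\alpha\otimes A_\alpha: m_\alpha(q)=0\}$ is an $A_\alpha$-bimodule via $c(a\otimes b)=ca\otimes b$, $(a\otimes b)c=a\otimes bc$, and $D_\alpha:A_\alpha\to A_\alpha^2$ is $D_\alpha(b)=1_\alpha\otimes b-b\otimes 1_\alpha$. The map $t_\alpha:A_\alpha\otimes A_\alpha\to A_1\otimes A_\alpha$ is $t_\alpha(a\otimes b)=(1_1\otimes a)\Delta_{1,\alpha}(b)$; it is asserted to be a bijection for each $\alpha$, with $t_\alpha(A_\alpha^2)=\ker\varepsilon\otimes A_\alpha$, and $t_\alpha^{-1}$ denotes its inverse. *)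

theory Defs
  imports "HOL-Algebra.AbelCoset" "HOL-Algebra.Module"
begin

section \<open>Linear algebra over a field\<close>

text \<open>
  Vector spaces, algebras and bimodules over the field \<open>K\<close> are records with carriers, and families
  \<open>(A\<^sub>\<alpha>)\<close> are functions from the index group into such records.  All members of a family live in
  one element type; this is no restriction, since a family of sets embeds into its disjoint union.
  The \<open>module\<close> record always contains the fields \<open>mult\<close> and \<open>one\<close>; they are
  \<^const>\<open>undefined\<close> for plain vector spaces and hold the algebra structure for algebras.
\<close>

definition linear_map ::
  "('k, 'n) ring_scheme \<Rightarrow> ('k, 'v, 'm1) module_scheme \<Rightarrow> ('k, 'w, 'm2) module_scheme
    \<Rightarrow> ('v \<Rightarrow> 'w) \<Rightarrow> bool"
  where "linear_map K V W f \<longleftrightarrow>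
    f \<in> carrier V \<rightarrow> carrier W \<and>
    (\<forall>x\<in>carrier V. \<forall>y\<in>carrier V. f (x \<oplus>\<^bsub>V\<^esub> y) = f x \<oplus>\<^bsub>W\<^esub> f y) \<and>
    (\<forall>c\<in>carrier K. \<forall>x\<in>carrier V. f (c \<odot>\<^bsub>V\<^esub> x) = c \<odot>\<^bsub>W\<^esub> f x)"

definition bilinear_map ::
  "('k, 'n) ring_scheme \<Rightarrow> ('k, 'u, 'm1) module_scheme \<Rightarrow> ('k, 'v, 'm2) module_scheme
    \<Rightarrow> ('k, 'w, 'm3) module_scheme \<Rightarrow> ('u \<Rightarrow> 'v \<Rightarrow> 'w) \<Rightarrow> bool"
  where "bilinear_map K U V W f \<longleftrightarrow>
    (\<forall>u\<in>carrier U. linear_map K V W (f u)) \<and>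
    (\<forall>v\<in>carrier V. linear_map K U W (\<lambda>u. f u v))"

definition lin_span ::
  "('k, 'n) ring_scheme \<Rightarrow> ('k, 'v, 'm) module_scheme \<Rightarrow> 'v set \<Rightarrow> 'v set"
  where "lin_span K V X = \<Inter> {N. submodule N K V \<and> X \<subseteq> N}"

definition quot_module ::
  "('k, 'v, 'm) module_scheme \<Rightarrow> 'v set \<Rightarrow> ('k, 'v set) module"
  where "quot_module V N =
    \<lparr>carrier = a_rcosets\<^bsub>V\<^esub> N, monoid.mult = undefined, one = undefined,
     ring.zero = N, add = set_add V,
     smult = (\<lambda>c X. \<Union>x\<in>X. N +>\<^bsub>V\<^esub> (c \<odot>\<^bsub>V\<^esub> x))\<rparr>"

text \<open>Associative unital, not necessarily commutative algebras (unlike the library's \<open>algebra\<close>).\<close>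

definition k_algebra :: "('k, 'n) ring_scheme \<Rightarrow> ('k, 'a, 'm) module_scheme \<Rightarrow> bool"
  where "k_algebra K B \<longleftrightarrow>
    module K B \<and> ring B \<and> bilinear_map K B B B (\<lambda>a b. a \<otimes>\<^bsub>B\<^esub> b)"

definition alg_hom ::
  "('k, 'n) ring_scheme \<Rightarrow> ('k, 'a, 'm1) module_scheme \<Rightarrow> ('k, 'b, 'm2) module_scheme
    \<Rightarrow> ('a \<Rightarrow> 'b) \<Rightarrow> bool"
  where "alg_hom K B C f \<longleftrightarrow> linear_map K B C f \<and> f \<in> ring_hom B C"

definition right_ideal :: "'a set \<Rightarrow> ('a, 'm) ring_scheme \<Rightarrow> bool"
  where "right_ideal R B \<longleftrightarrow>
    additive_subgroup R B \<and> (\<forall>r\<in>R. \<forall>a\<in>carrier B. r \<otimes>\<^bsub>B\<^esub> a \<in> R)"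


section \<open>Tensor products\<close>

text \<open>\<open>V \<otimes> W\<close> is the free vector space on \<open>V \<times> W\<close> modulo the bilinearity relations.\<close>

definition free_module :: "('k, 'n) ring_scheme \<Rightarrow> 'x set \<Rightarrow> ('k, 'x \<Rightarrow> 'k) module"
  where "free_module K X =
    \<lparr>carrier = {\<phi>. (\<forall>x. \<phi> x \<in> carrier K) \<and> {x. \<phi> x \<noteq> \<zero>\<^bsub>K\<^esub>} \<subseteq> X \<and> finite {x. \<phi> x \<noteq> \<zero>\<^bsub>K\<^esub>}},
     monoid.mult = undefined, one = undefined,
     ring.zero = (\<lambda>x. \<zero>\<^bsub>K\<^esub>), add = (\<lambda>\<phi> \<psi> x. \<phi> x \<oplus>\<^bsub>K\<^esub> \<psi> x), smult = (\<lambda>c \<phi> x. c \<otimes>\<^bsub>K\<^esub> \<phi> x)\<rparr>"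

definition free_gen :: "('k, 'n) ring_scheme \<Rightarrow> 'x \<Rightarrow> 'x \<Rightarrow> 'k"
  where "free_gen K x = (\<lambda>y. if y = x then \<one>\<^bsub>K\<^esub> else \<zero>\<^bsub>K\<^esub>)"

definition tensor_rels ::
  "('k, 'n) ring_scheme \<Rightarrow> ('k, 'v, 'm1) module_scheme \<Rightarrow> ('k, 'w, 'm2) module_scheme
    \<Rightarrow> ('v \<times> 'w \<Rightarrow> 'k) set"
  where "tensor_rels K V W =
    (let F = free_module K (carrier V \<times> carrier W); e = free_gen K in
      {e (v \<oplus>\<^bsub>V\<^esub> v', w) \<ominus>\<^bsub>F\<^esub> (e (v, w) \<oplus>\<^bsub>F\<^esub> e (v', w)) | v v' w.
         v \<in> carrier V \<and> v' \<in> carrier V \<and> w \<in> carrier W}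
    \<union> {e (v, w \<oplus>\<^bsub>W\<^esub> w') \<ominus>\<^bsub>F\<^esub> (e (v, w) \<oplus>\<^bsub>F\<^esub> e (v, w')) | v w w'.
         v \<in> carrier V \<and> w \<in> carrier W \<and> w' \<in> carrier W}
    \<union> {e (c \<odot>\<^bsub>V\<^esub> v, w) \<ominus>\<^bsub>F\<^esub> (c \<odot>\<^bsub>F\<^esub> e (v, w)) | c v w.
         c \<in> carrier K \<and> v \<in> carrier V \<and> w \<in> carrier W}
    \<union> {e (v, c \<odot>\<^bsub>W\<^esub> w) \<ominus>\<^bsub>F\<^esub> (c \<odot>\<^bsub>F\<^esub> e (v, w)) | c v w.
         c \<in> carrier K \<and> v \<in> carrier V \<and> w \<in> carrier W})"

definition tensor_null ::
  "('k, 'n) ring_scheme \<Rightarrow> ('k, 'v, 'm1) module_scheme \<Rightarrow> ('k, 'w, 'm2) module_scheme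
    \<Rightarrow> ('v \<times> 'w \<Rightarrow> 'k) set"
  where "tensor_null K V W =
    lin_span K (free_module K (carrier V \<times> carrier W)) (tensor_rels K V W)"

definition tensor ::
  "('k, 'n) ring_scheme \<Rightarrow> ('k, 'v, 'm1) module_scheme \<Rightarrow> ('k, 'w, 'm2) module_scheme
    \<Rightarrow> ('k, ('v \<times> 'w \<Rightarrow> 'k) set) module"
  where "tensor K V W =
    quot_module (free_module K (carrier V \<times> carrier W)) (tensor_null K V W)"

definition tens ::
  "('k, 'n) ring_scheme \<Rightarrow> ('k, 'v, 'm1) module_scheme \<Rightarrow> ('k, 'w, 'm2) module_scheme
    \<Rightarrow> 'v \<Rightarrow> 'w \<Rightarrow> ('v \<times> 'w \<Rightarrow> 'k) set"
  where "tens K V W v w =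
    tensor_null K V W +>\<^bsub>free_module K (carrier V \<times> carrier W)\<^esub> free_gen K (v, w)"

text \<open>
  The linear map \<open>V \<otimes> W \<rightarrow> U\<close> induced by a bilinear map \<open>f\<close>, evaluated on a representative
  \<open>\<phi>\<close> of the class as \<open>\<Sum> \<phi>(v,w) f(v,w)\<close>.  For bilinear \<open>f\<close> (the only use made of it) the
  choice of representative is immaterial.
\<close>

definition tensor_lift ::
  "('k, 'n) ring_scheme \<Rightarrow> ('k, 'u, 'm) module_scheme \<Rightarrow> ('v \<Rightarrow> 'w \<Rightarrow> 'u)
    \<Rightarrow> ('v \<times> 'w \<Rightarrow> 'k) set \<Rightarrow> 'u"
  where "tensor_lift K U f X =
    (let \<phi> = (SOME \<phi>. \<phi> \<in> X) in
      \<Oplus>\<^bsub>U\<^esub> p \<in> {p. \<phi> p \<noteq> \<zero>\<^bsub>K\<^esub>}. \<phi> p \<odot>\<^bsub>U\<^esub> f (fst p) (snd p))"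

text \<open>\<open>f \<otimes> g\<close>, where \<open>V'\<close> and \<open>W'\<close> are the codomains of \<open>f\<close> and \<open>g\<close>.\<close>

definition tensor_map ::
  "('k, 'n) ring_scheme \<Rightarrow> ('k, 'v2, 'm1) module_scheme \<Rightarrow> ('k, 'w2, 'm2) module_scheme
    \<Rightarrow> ('v \<Rightarrow> 'v2) \<Rightarrow> ('w \<Rightarrow> 'w2) \<Rightarrow> ('v \<times> 'w \<Rightarrow> 'k) set \<Rightarrow> ('v2 \<times> 'w2 \<Rightarrow> 'k) set"
  where "tensor_map K V' W' f g =
    tensor_lift K (tensor K V' W') (\<lambda>v w. tens K V' W' (f v) (g w))"

text \<open>\<open>(U \<otimes> V) \<otimes> W \<rightarrow> U \<otimes> (V \<otimes> W)\<close>\<close>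

definition tensor_assoc ::
  "('k, 'n) ring_scheme \<Rightarrow> ('k, 'u, 'm1) module_scheme \<Rightarrow> ('k, 'v, 'm2) module_scheme
    \<Rightarrow> ('k, 'w, 'm3) module_scheme
    \<Rightarrow> (('u \<times> 'v \<Rightarrow> 'k) set \<times> 'w \<Rightarrow> 'k) set \<Rightarrow> ('u \<times> ('v \<times> 'w \<Rightarrow> 'k) set \<Rightarrow> 'k) set"
  where "tensor_assoc K U V W =
    (let VW = tensor K V W; T = tensor K U VW in
      tensor_lift K T (\<lambda>x w. tensor_lift K T (\<lambda>u v. tens K U VW u (tens K V W v w)) x))"

text \<open>The algebra \<open>B \<otimes> C\<close>, with \<open>(a \<otimes> b) (a' \<otimes> b') = a a' \<otimes> b b'\<close>.\<close>

definition tensor_alg ::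
  "('k, 'n) ring_scheme \<Rightarrow> ('k, 'b, 'm1) module_scheme \<Rightarrow> ('k, 'c, 'm2) module_scheme
    \<Rightarrow> ('k, ('b \<times> 'c \<Rightarrow> 'k) set) module"
  where "tensor_alg K B C =
    (let T = tensor K B C in
      T\<lparr>monoid.mult := \<lambda>X Y. tensor_lift K T
           (\<lambda>a b. tensor_lift K T (\<lambda>a' b'. tens K B C (a \<otimes>\<^bsub>B\<^esub> a') (b \<otimes>\<^bsub>C\<^esub> b')) Y) X,
        one := tens K B C \<one>\<^bsub>B\<^esub> \<one>\<^bsub>C\<^esub>\<rparr>)"

text \<open>The image of \<open>X \<otimes> W\<close> in \<open>V \<otimes> W\<close> for a subspace \<open>X\<close> of \<open>V\<close>.\<close>

definition tensor_sub ::
  "('k, 'n) ring_scheme \<Rightarrow> ('k, 'v, 'm1) module_scheme \<Rightarrow> ('k, 'w, 'm2) module_scheme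
    \<Rightarrow> 'v set \<Rightarrow> ('v \<times> 'w \<Rightarrow> 'k) set set"
  where "tensor_sub K V W X =
    lin_span K (tensor K V W) {tens K V W x w | x w. x \<in> X \<and> w \<in> carrier W}"


section \<open>Bimodules\<close>

record ('k, 'a, 'g) bimod = "('k, 'g) module" +
  lact :: "'a \<Rightarrow> 'g \<Rightarrow> 'g"
  ract :: "'g \<Rightarrow> 'a \<Rightarrow> 'g"

text \<open>
  Bimodules over a \<open>K\<close>-algebra: both actions are \<open>K\<close>-bilinear, i.e. they induce the same
  \<open>K\<close>-vector space structure.
\<close>

definition bimodule ::
  "('k, 'n) ring_scheme \<Rightarrow> ('k, 'a, 'm1) module_scheme \<Rightarrow> ('k, 'a, 'g, 'm2) bimod_scheme \<Rightarrow> bool"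
  where "bimodule K B M \<longleftrightarrow>
    module K M \<and>
    bilinear_map K B M M (lact M) \<and>
    bilinear_map K M B M (ract M) \<and>
    (\<forall>x\<in>carrier M. lact M \<one>\<^bsub>B\<^esub> x = x \<and> ract M x \<one>\<^bsub>B\<^esub> = x) \<and>
    (\<forall>a\<in>carrier B. \<forall>b\<in>carrier B. \<forall>x\<in>carrier M.
       lact M (a \<otimes>\<^bsub>B\<^esub> b) x = lact M a (lact M b x) \<and>
       ract M x (a \<otimes>\<^bsub>B\<^esub> b) = ract M (ract M x a) b \<and>
       ract M (lact M a x) b = lact M a (ract M x b))"

definition sub_bimodule ::
  "('k, 'n) ring_scheme \<Rightarrow> ('k, 'a, 'm1) module_scheme \<Rightarrow> ('k, 'a, 'g, 'm2) bimod_scheme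
    \<Rightarrow> 'g set \<Rightarrow> bool"
  where "sub_bimodule K B M N \<longleftrightarrow>
    submodule N K M \<and>
    (\<forall>a\<in>carrier B. \<forall>x\<in>N. lact M a x \<in> N \<and> ract M x a \<in> N)"

definition quot_bimod ::
  "('k, 'a, 'g, 'm) bimod_scheme \<Rightarrow> 'g set \<Rightarrow> ('k, 'a, 'g set) bimod"
  where "quot_bimod M N =
    \<lparr>carrier = a_rcosets\<^bsub>M\<^esub> N, monoid.mult = undefined, one = undefined,
     ring.zero = N, add = set_add M,
     smult = (\<lambda>c X. \<Union>x\<in>X. N +>\<^bsub>M\<^esub> (c \<odot>\<^bsub>M\<^esub> x)),
     lact = (\<lambda>a X. \<Union>x\<in>X. N +>\<^bsub>M\<^esub> lact M a x),
     ract = (\<lambda>X a. \<Union>x\<in>X. N +>\<^bsub>M\<^esub> ract M x a)\<rparr>"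

text \<open>
  The left action of \<open>B \<otimes> C\<close> on \<open>M \<otimes> C\<close> for a \<open>B\<close>-bimodule \<open>M\<close>:
  \<open>(a \<otimes> b) (x \<otimes> b') = a x \<otimes> b b'\<close>.
\<close>

definition tensor_lact ::
  "('k, 'n) ring_scheme \<Rightarrow> ('k, 'a, 'g, 'm1) bimod_scheme \<Rightarrow> ('k, 'c, 'm2) module_scheme
    \<Rightarrow> ('a \<times> 'c \<Rightarrow> 'k) set \<Rightarrow> ('g \<times> 'c \<Rightarrow> 'k) set \<Rightarrow> ('g \<times> 'c \<Rightarrow> 'k) set"
  where "tensor_lact K M C X Y =
    (let T = tensor K M C in
      tensor_lift K T
        (\<lambda>a b. tensor_lift K T (\<lambda>x b'. tens K M C (lact M a x) (b \<otimes>\<^bsub>C\<^esub> b')) Y) X)"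


section \<open>Hopf group coalgebras\<close>

text \<open>
  In the counit axioms \<open>V \<otimes> K\<close> and \<open>K \<otimes> V\<close> are identified with \<open>V\<close> via scalar
  multiplication.
\<close>

locale hopf_group_coalgebra =
  K: field K + P: group P
  for K :: "('k, 'n) ring_scheme" and P :: "('p, 'q) monoid_scheme"
  and A :: "'p \<Rightarrow> ('k, 'a, 'm) module_scheme"
  and \<Delta> :: "'p \<Rightarrow> 'p \<Rightarrow> 'a \<Rightarrow> ('a \<times> 'a \<Rightarrow> 'k) set"
  and \<epsilon> :: "'a \<Rightarrow> 'k"
  and S :: "'p \<Rightarrow> 'a \<Rightarrow> 'a" +
  assumes algebra:
      "\<alpha> \<in> carrier P \<Longrightarrow> k_algebra K (A \<alpha>)"
    and comult_hom:
      "\<lbrakk>\<alpha> \<in> carrier P; \<beta> \<in> carrier P\<rbrakk>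
        \<Longrightarrow> alg_hom K (A (\<alpha> \<otimes>\<^bsub>P\<^esub> \<beta>)) (tensor_alg K (A \<alpha>) (A \<beta>)) (\<Delta> \<alpha> \<beta>)"
    and counit_hom:
      "\<epsilon> \<in> ring_hom (A \<one>\<^bsub>P\<^esub>) K"
    and counit_smult:
      "\<lbrakk>c \<in> carrier K; x \<in> carrier (A \<one>\<^bsub>P\<^esub>)\<rbrakk> \<Longrightarrow> \<epsilon> (c \<odot>\<^bsub>A \<one>\<^bsub>P\<^esub>\<^esub> x) = c \<otimes>\<^bsub>K\<^esub> \<epsilon> x"
    and antipode_linear:
      "\<alpha> \<in> carrier P \<Longrightarrow> linear_map K (A \<alpha>) (A (inv\<^bsub>P\<^esub> \<alpha>)) (S \<alpha>)"
    and coassoc: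
      "\<lbrakk>\<alpha> \<in> carrier P; \<beta> \<in> carrier P; \<gamma> \<in> carrier P;
        x \<in> carrier (A (\<alpha> \<otimes>\<^bsub>P\<^esub> \<beta> \<otimes>\<^bsub>P\<^esub> \<gamma>))\<rbrakk>
        \<Longrightarrow> tensor_assoc K (A \<alpha>) (A \<beta>) (A \<gamma>)
              (tensor_map K (tensor K (A \<alpha>) (A \<beta>)) (A \<gamma>) (\<Delta> \<alpha> \<beta>) (\<lambda>y. y)
                (\<Delta> (\<alpha> \<otimes>\<^bsub>P\<^esub> \<beta>) \<gamma> x))
            = tensor_map K (A \<alpha>) (tensor K (A \<beta>) (A \<gamma>)) (\<lambda>y. y) (\<Delta> \<beta> \<gamma>)
                (\<Delta> \<alpha> (\<beta> \<otimes>\<^bsub>P\<^esub> \<gamma>) x)"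
    and counit_right:
      "\<lbrakk>\<alpha> \<in> carrier P; x \<in> carrier (A \<alpha>)\<rbrakk>
        \<Longrightarrow> tensor_lift K (A \<alpha>) (\<lambda>a b. \<epsilon> b \<odot>\<^bsub>A \<alpha>\<^esub> a) (\<Delta> \<alpha> \<one>\<^bsub>P\<^esub> x) = x"
    and counit_left:
      "\<lbrakk>\<alpha> \<in> carrier P; x \<in> carrier (A \<alpha>)\<rbrakk>
        \<Longrightarrow> tensor_lift K (A \<alpha>) (\<lambda>a b. \<epsilon> a \<odot>\<^bsub>A \<alpha>\<^esub> b) (\<Delta> \<one>\<^bsub>P\<^esub> \<alpha> x) = x"
    and antipode_left:
      "\<lbrakk>\<alpha> \<in> carrier P; x \<in> carrier (A \<one>\<^bsub>P\<^esub>)\<rbrakk>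
        \<Longrightarrow> tensor_lift K (A \<alpha>) (\<lambda>a b. S (inv\<^bsub>P\<^esub> \<alpha>) a \<otimes>\<^bsub>A \<alpha>\<^esub> b) (\<Delta> (inv\<^bsub>P\<^esub> \<alpha>) \<alpha> x)
            = \<epsilon> x \<odot>\<^bsub>A \<alpha>\<^esub> \<one>\<^bsub>A \<alpha>\<^esub>"
    and antipode_right:
      "\<lbrakk>\<alpha> \<in> carrier P; x \<in> carrier (A \<one>\<^bsub>P\<^esub>)\<rbrakk>
        \<Longrightarrow> tensor_lift K (A \<alpha>) (\<lambda>a b. a \<otimes>\<^bsub>A \<alpha>\<^esub> S (inv\<^bsub>P\<^esub> \<alpha>) b) (\<Delta> \<alpha> (inv\<^bsub>P\<^esub> \<alpha>) x)
            = \<epsilon> x \<odot>\<^bsub>A \<alpha>\<^esub> \<one>\<^bsub>A \<alpha>\<^esub>"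


section \<open>First order differential calculi\<close>

definition fodc ::
  "('k, 'n) ring_scheme \<Rightarrow> ('p, 'q) monoid_scheme \<Rightarrow> ('p \<Rightarrow> ('k, 'a, 'm1) module_scheme)
    \<Rightarrow> ('p \<Rightarrow> ('k, 'a, 'g, 'm2) bimod_scheme) \<Rightarrow> ('p \<Rightarrow> 'a \<Rightarrow> 'g) \<Rightarrow> bool"
  where "fodc K P A \<Gamma> d \<longleftrightarrow>
    (\<forall>\<alpha>\<in>carrier P.
      bimodule K (A \<alpha>) (\<Gamma> \<alpha>) \<and>
      linear_map K (A \<alpha>) (\<Gamma> \<alpha>) (d \<alpha>) \<and>
      (\<forall>a\<in>carrier (A \<alpha>). \<forall>b\<in>carrier (A \<alpha>).
        d \<alpha> (a \<otimes>\<^bsub>A \<alpha>\<^esub> b) = ract (\<Gamma> \<alpha>) (d \<alpha> a) b \<oplus>\<^bsub>\<Gamma> \<alpha>\<^esub> lact (\<Gamma> \<alpha>) a (d \<alpha> b)) \<and>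
      (\<forall>x\<in>carrier (\<Gamma> \<alpha>). \<exists>(n::nat) a b.
        a \<in> {..<n} \<rightarrow> carrier (A \<alpha>) \<and> b \<in> {..<n} \<rightarrow> carrier (A \<alpha>) \<and>
        x = (\<Oplus>\<^bsub>\<Gamma> \<alpha>\<^esub> k \<in> {..<n}. lact (\<Gamma> \<alpha>) (a k) (d \<alpha> (b k)))))"

definition fodc_iso ::
  "('k, 'n) ring_scheme \<Rightarrow> ('p, 'q) monoid_scheme \<Rightarrow> ('p \<Rightarrow> ('k, 'a, 'm1) module_scheme)
    \<Rightarrow> ('p \<Rightarrow> ('k, 'a, 'g, 'm2) bimod_scheme) \<Rightarrow> ('p \<Rightarrow> 'a \<Rightarrow> 'g)
    \<Rightarrow> ('p \<Rightarrow> ('k, 'a, 'h, 'm3) bimod_scheme) \<Rightarrow> ('p \<Rightarrow> 'a \<Rightarrow> 'h) \<Rightarrow> bool"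
  where "fodc_iso K P A \<Gamma> d \<Gamma>' d' \<longleftrightarrow>
    (\<exists>i. \<forall>\<alpha>\<in>carrier P.
      bij_betw (i \<alpha>) (carrier (\<Gamma> \<alpha>)) (carrier (\<Gamma>' \<alpha>)) \<and>
      linear_map K (\<Gamma> \<alpha>) (\<Gamma>' \<alpha>) (i \<alpha>) \<and>
      (\<forall>a\<in>carrier (A \<alpha>). \<forall>x\<in>carrier (\<Gamma> \<alpha>).
        i \<alpha> (lact (\<Gamma> \<alpha>) a x) = lact (\<Gamma>' \<alpha>) a (i \<alpha> x) \<and>
        i \<alpha> (ract (\<Gamma> \<alpha>) x a) = ract (\<Gamma>' \<alpha>) (i \<alpha> x) a) \<and>
      (\<forall>a\<in>carrier (A \<alpha>). i \<alpha> (d \<alpha> a) = d' \<alpha> a))"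

definition right_covariant ::
  "('k, 'n) ring_scheme \<Rightarrow> ('p, 'q) monoid_scheme \<Rightarrow> ('p \<Rightarrow> ('k, 'a, 'm1) module_scheme)
    \<Rightarrow> ('p \<Rightarrow> 'p \<Rightarrow> 'a \<Rightarrow> ('a \<times> 'a \<Rightarrow> 'k) set)
    \<Rightarrow> ('p \<Rightarrow> ('k, 'a, 'g, 'm2) bimod_scheme) \<Rightarrow> ('p \<Rightarrow> 'a \<Rightarrow> 'g) \<Rightarrow> bool"
  where "right_covariant K P A \<Delta> \<Gamma> d \<longleftrightarrow>
    (\<forall>\<alpha>\<in>carrier P. \<forall>\<beta>\<in>carrier P. \<forall>(n::nat) a b.
      a \<in> {..<n} \<rightarrow> carrier (A (\<alpha> \<otimes>\<^bsub>P\<^esub> \<beta>)) \<longrightarrow> b \<in> {..<n} \<rightarrow> carrier (A (\<alpha> \<otimes>\<^bsub>P\<^esub> \<beta>)) \<longrightarrow>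
      (\<Oplus>\<^bsub>\<Gamma> (\<alpha> \<otimes>\<^bsub>P\<^esub> \<beta>)\<^esub> k \<in> {..<n}. lact (\<Gamma> (\<alpha> \<otimes>\<^bsub>P\<^esub> \<beta>)) (a k) (d (\<alpha> \<otimes>\<^bsub>P\<^esub> \<beta>) (b k)))
        = \<zero>\<^bsub>\<Gamma> (\<alpha> \<otimes>\<^bsub>P\<^esub> \<beta>)\<^esub> \<longrightarrow>
      (\<Oplus>\<^bsub>tensor K (\<Gamma> \<alpha>) (A \<beta>)\<^esub> k \<in> {..<n}.
         tensor_lact K (\<Gamma> \<alpha>) (A \<beta>) (\<Delta> \<alpha> \<beta> (a k))
           (tensor_map K (\<Gamma> \<alpha>) (A \<beta>) (d \<alpha>) (\<lambda>y. y) (\<Delta> \<alpha> \<beta> (b k))))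
        = \<zero>\<^bsub>tensor K (\<Gamma> \<alpha>) (A \<beta>)\<^esub>)"


section \<open>The calculus determined by a right ideal\<close>

text \<open>\<open>B\<^sup>2 = {q \<in> B \<otimes> B. m(q) = 0}\<close>\<close>

definition univ_bimod ::
  "('k, 'n) ring_scheme \<Rightarrow> ('k, 'a, 'm) module_scheme \<Rightarrow> ('k, 'a, ('a \<times> 'a \<Rightarrow> 'k) set) bimod"
  where "univ_bimod K B =
    (let T = tensor K B B in
      \<lparr>carrier = {q \<in> carrier T. tensor_lift K B (\<lambda>a b. a \<otimes>\<^bsub>B\<^esub> b) q = \<zero>\<^bsub>B\<^esub>},
       monoid.mult = undefined, one = undefined,
       ring.zero = \<zero>\<^bsub>T\<^esub>, add = (\<lambda>X Y. X \<oplus>\<^bsub>T\<^esub> Y), smult = (\<lambda>c X. c \<odot>\<^bsub>T\<^esub> X),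
       lact = (\<lambda>c. tensor_lift K T (\<lambda>a b. tens K B B (c \<otimes>\<^bsub>B\<^esub> a) b)),
       ract = (\<lambda>q c. tensor_lift K T (\<lambda>a b. tens K B B a (b \<otimes>\<^bsub>B\<^esub> c)) q)\<rparr>)"

definition univ_d ::
  "('k, 'n) ring_scheme \<Rightarrow> ('k, 'a, 'm) module_scheme \<Rightarrow> 'a \<Rightarrow> ('a \<times> 'a \<Rightarrow> 'k) set"
  where "univ_d K B b = tens K B B \<one>\<^bsub>B\<^esub> b \<ominus>\<^bsub>tensor K B B\<^esub> tens K B B b \<one>\<^bsub>B\<^esub>"

text \<open>
  \<open>t\<^sub>\<alpha>(a \<otimes> b) = (1 \<otimes> a) \<Delta>\<^sub>1\<^sub>,\<^sub>\<alpha>(b)\<close>.  Bijectivity does not follow from the axioms of a Hopf group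
  coalgebra: for the trivial group it is equivalent to bijectivity of the antipode.
\<close>

definition t_map ::
  "('k, 'n) ring_scheme \<Rightarrow> ('p, 'q) monoid_scheme \<Rightarrow> ('p \<Rightarrow> ('k, 'a, 'm) module_scheme)
    \<Rightarrow> ('p \<Rightarrow> 'p \<Rightarrow> 'a \<Rightarrow> ('a \<times> 'a \<Rightarrow> 'k) set)
    \<Rightarrow> 'p \<Rightarrow> ('a \<times> 'a \<Rightarrow> 'k) set \<Rightarrow> ('a \<times> 'a \<Rightarrow> 'k) set"
  where "t_map K P A \<Delta> \<alpha> =
    (let T = tensor_alg K (A \<one>\<^bsub>P\<^esub>) (A \<alpha>) in
      tensor_lift K T
        (\<lambda>a b. tens K (A \<one>\<^bsub>P\<^esub>) (A \<alpha>) \<one>\<^bsub>A \<one>\<^bsub>P\<^esub>\<^esub> a \<otimes>\<^bsub>T\<^esub> \<Delta> \<one>\<^bsub>P\<^esub> \<alpha> b))"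

text \<open>\<open>N\<^sub>\<alpha> = t\<^sub>\<alpha>\<^sup>-\<^sup>1(R \<otimes> A\<^sub>\<alpha>)\<close>; meaningful when \<open>t\<^sub>\<alpha>\<close> is bijective.\<close>

definition N_sub ::
  "('k, 'n) ring_scheme \<Rightarrow> ('p, 'q) monoid_scheme \<Rightarrow> ('p \<Rightarrow> ('k, 'a, 'm) module_scheme)
    \<Rightarrow> ('p \<Rightarrow> 'p \<Rightarrow> 'a \<Rightarrow> ('a \<times> 'a \<Rightarrow> 'k) set) \<Rightarrow> 'a set
    \<Rightarrow> 'p \<Rightarrow> ('a \<times> 'a \<Rightarrow> 'k) set set"
  where "N_sub K P A \<Delta> R \<alpha> =
    inv_into (carrier (tensor K (A \<alpha>) (A \<alpha>))) (t_map K P A \<Delta> \<alpha>)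
      ` tensor_sub K (A \<one>\<^bsub>P\<^esub>) (A \<alpha>) R"

definition ideal_calculus ::
  "('k, 'n) ring_scheme \<Rightarrow> ('p, 'q) monoid_scheme \<Rightarrow> ('p \<Rightarrow> ('k, 'a, 'm) module_scheme)
    \<Rightarrow> ('p \<Rightarrow> 'p \<Rightarrow> 'a \<Rightarrow> ('a \<times> 'a \<Rightarrow> 'k) set) \<Rightarrow> 'a set
    \<Rightarrow> 'p \<Rightarrow> ('k, 'a, ('a \<times> 'a \<Rightarrow> 'k) set set) bimod"
  where "ideal_calculus K P A \<Delta> R \<alpha> = quot_bimod (univ_bimod K (A \<alpha>)) (N_sub K P A \<Delta> R \<alpha>)"

definition ideal_d ::
  "('k, 'n) ring_scheme \<Rightarrow> ('p, 'q) monoid_scheme \<Rightarrow> ('p \<Rightarrow> ('k, 'a, 'm) module_scheme)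
    \<Rightarrow> ('p \<Rightarrow> 'p \<Rightarrow> 'a \<Rightarrow> ('a \<times> 'a \<Rightarrow> 'k) set) \<Rightarrow> 'a set
    \<Rightarrow> 'p \<Rightarrow> 'a \<Rightarrow> ('a \<times> 'a \<Rightarrow> 'k) set set"
  where "ideal_d K P A \<Delta> R \<alpha> b =
    N_sub K P A \<Delta> R \<alpha> +>\<^bsub>univ_bimod K (A \<alpha>)\<^esub> univ_d K (A \<alpha>) b"

end

theory Submission
  imports Defs
begin

text \<open>
  Write \<open>\<omega>(a \<otimes> b) = a d(b)\<close> for a calculus and \<open>\<eta>(r) = \<omega>(t\<^sup>-\<^sup>1(r \<otimes> 1))\<close>.  Coassociativity
  gives \<open>\<Delta>(a) (d \<otimes> id) \<Delta>(b) = \<Psi>(t(a \<otimes> b))\<close> with \<open>\<Psi>(r \<otimes> x) = \<Delta>(x) (\<eta>(r) \<otimes> 1)\<close>, so a calculus is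
  right covariant iff \<open>\<Psi> \<circ> t\<close> vanishes on the kernel of \<open>\<omega>\<close>.  For the calculus of an ideal \<open>R\<close> this
  holds because \<open>\<eta>\<close> vanishes on \<open>R\<close>.  Conversely, take \<open>R = ker \<epsilon> \<inter> ker \<eta>\<close> in degree \<open>1\<close>.
  The map \<open>\<gamma> \<otimes> x \<mapsto> \<Delta>(x) (\<gamma> \<otimes> 1)\<close> is injective, because bijectivity of \<open>t\<^sub>1\<close> yields an inverse
  of the antipode; hence covariance for \<open>(1, \<alpha>)\<close> gives \<open>t(ker \<omega> \<inter> A\<^sup>2\<^sub>\<alpha>) \<subseteq> R \<otimes> A\<^sub>\<alpha>\<close>.  The other
  inclusion is covariance for \<open>(\<alpha>, \<alpha>\<^sup>-\<^sup>1)\<close> applied to \<open>r \<otimes> 1\<close>.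
\<close>

section \<open>Linear maps\<close>

text \<open>The converse uses the field through two facts, both obtained from complements of
  subspaces: the kernel of \<open>f \<otimes> id\<close> on \<open>V \<otimes> W\<close> is
  \<open>ker f \<otimes> W\<close>, and \<open>v \<otimes> w = 0\<close> with
  \<open>w \<noteq> 0\<close> forces \<open>v = 0\<close>. By the former, once injectivity has
  reduced covariance to \<open>(\<eta> \<otimes> id)(t q) = 0\<close>, the element
  \<open>t q\<close> is located in \<open>ker \<eta> \<otimes> A \<alpha>\<close>. The latter strips
  the unit off \<open>\<eta>(r) \<otimes> 1\<close>; where that unit is zero, the antipode axiom
  makes the unit of the inverse degree zero as well. The intersection with
  \<open>ker \<epsilon>\<close> is forced because \<open>\<eta>(1) = 0\<close>, so that
  \<open>ker \<eta>\<close> also contains the multiples of 1. Tensors are cosets of functions, and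
  lifts are evaluated at a chosen representative. What is usually written with legs
  \<open>x1 \<otimes> x2\<close> of \<open>\<Delta> x\<close> becomes a nested
  \<open>tensor_lift\<close> of multilinear maps, and identities are compared on pure tensors. Hence
  the many linearity side conditions, and the form of coassociativity as an exchange of two nested
  lifts of a trilinear map.\<close>

lemma (in abelian_group) minus_eq_zero_iff:
  "\<lbrakk>a \<in> carrier G; b \<in> carrier G\<rbrakk> \<Longrightarrow> a \<ominus> b = \<zero> \<longleftrightarrow> a = b"
  by (metis a_inv_closed minus_equality minus_minus r_neg a_minus_def)

lemma linear_mapI:
  assumes "\<And>x. x \<in> carrier V \<Longrightarrow> f x \<in> carrier W"
    and "\<And>x y. \<lbrakk>x \<in> carrier V; y \<in> carrier V\<rbrakk> \<Longrightarrow> f (x \<oplus>\<^bsub>V\<^esub> y) = f x \<oplus>\<^bsub>W\<^esub> f y"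
    and "\<And>c x. \<lbrakk>c \<in> carrier K; x \<in> carrier V\<rbrakk> \<Longrightarrow> f (c \<odot>\<^bsub>V\<^esub> x) = c \<odot>\<^bsub>W\<^esub> f x"
  shows "linear_map K V W f"
  using assms by (auto simp: linear_map_def)

lemma
  assumes "linear_map K V W f"
  shows linear_map_closed: "x \<in> carrier V \<Longrightarrow> f x \<in> carrier W"
    and linear_map_add: "\<lbrakk>x \<in> carrier V; y \<in> carrier V\<rbrakk> \<Longrightarrow> f (x \<oplus>\<^bsub>V\<^esub> y) = f x \<oplus>\<^bsub>W\<^esub> f y"
    and linear_map_smult: "\<lbrakk>c \<in> carrier K; x \<in> carrier V\<rbrakk> \<Longrightarrow> f (c \<odot>\<^bsub>V\<^esub> x) = c \<odot>\<^bsub>W\<^esub> f x"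
  using assms by (auto simp: linear_map_def)

lemma linear_map_zero:
  assumes "module K V" "module K W" "linear_map K V W f"
  shows "f \<zero>\<^bsub>V\<^esub> = \<zero>\<^bsub>W\<^esub>"
proof -
  interpret V: module K V by fact
  interpret W: module K W by fact
  have "f (\<zero>\<^bsub>K\<^esub> \<odot>\<^bsub>V\<^esub> \<zero>\<^bsub>V\<^esub>) = \<zero>\<^bsub>K\<^esub> \<odot>\<^bsub>W\<^esub> f \<zero>\<^bsub>V\<^esub>"
    by (rule linear_map_smult[OF assms(3)]) auto
  then show ?thesis
    using linear_map_closed[OF assms(3)] by simp
qed

lemma linear_map_uminus:
  assumes "module K V" "module K W" "linear_map K V W f" "x \<in> carrier V"
  shows "f (\<ominus>\<^bsub>V\<^esub> x) = \<ominus>\<^bsub>W\<^esub> f x"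
proof -
  interpret V: module K V by fact
  interpret W: module K W by fact
  have "f x \<oplus>\<^bsub>W\<^esub> f (\<ominus>\<^bsub>V\<^esub> x) = \<zero>\<^bsub>W\<^esub>"
    using linear_map_add[OF assms(3), of x "\<ominus>\<^bsub>V\<^esub> x"] assms(4) linear_map_zero[OF assms(1-3)]
    by (simp add: V.M.r_neg)
  then show ?thesis
    using linear_map_closed[OF assms(3)] assms(4)
    by (metis V.M.a_inv_closed W.M.add.inv_equality W.M.add.m_comm)
qed

lemma linear_map_diff:
  assumes "module K V" "module K W" "linear_map K V W f" "x \<in> carrier V" "y \<in> carrier V"
  shows "f (x \<ominus>\<^bsub>V\<^esub> y) = f x \<ominus>\<^bsub>W\<^esub> f y"
proof -
  interpret V: module K V by fact
  show ?thesis
    using assms linear_map_uminus[OF assms(1-3)] linear_map_add[OF assms(3)]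
    by (simp add: a_minus_def)
qed

lemma linear_map_finsum:
  assumes "module K V" "module K W" "linear_map K V W f"
    and "finite I" "x \<in> I \<rightarrow> carrier V"
  shows "f (\<Oplus>\<^bsub>V\<^esub> i\<in>I. x i) = (\<Oplus>\<^bsub>W\<^esub> i\<in>I. f (x i))"
proof -
  interpret V: module K V by fact
  interpret W: module K W by fact
  show ?thesis using assms(4,5)
  proof (induction I rule: finite_induct)
    case empty
    then show ?case using linear_map_zero[OF assms(1-3)] by simp
  next
    case (insert j I)
    have x: "x \<in> I \<rightarrow> carrier V" "x j \<in> carrier V" using insert.prems by auto
    have fx: "(\<lambda>i. f (x i)) \<in> I \<rightarrow> carrier W" "f (x j) \<in> carrier W"
      using x linear_map_closed[OF assms(3)] by (auto simp: Pi_def)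
    show ?case
      using insert.hyps x fx insert.IH[OF x(1)] linear_map_add[OF assms(3)] V.M.finsum_closed[OF x(1)]
      by (simp add: V.M.finsum_insert W.M.finsum_insert)
  qed
qed

lemma linear_map_comp:
  assumes "linear_map K V W f" "linear_map K U V g"
  shows "linear_map K U W (\<lambda>x. f (g x))"
  using assms by (auto simp: linear_map_def Pi_def)

lemma linear_map_cong:
  assumes "module K V" "linear_map K V W f" "\<And>x. x \<in> carrier V \<Longrightarrow> g x = f x"
  shows "linear_map K V W g"
proof -
  interpret V: module K V by fact
  show ?thesis using assms(2,3) by (auto simp: linear_map_def Pi_def)
qed

lemma linear_map_ident: "linear_map K V V (\<lambda>x. x)"
  by (auto simp: linear_map_def)

lemma linear_map_plus:
  assumes "module K W" "linear_map K V W f" "linear_map K V W g"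
  shows "linear_map K V W (\<lambda>x. f x \<oplus>\<^bsub>W\<^esub> g x)"
proof -
  interpret W: module K W by fact
  show ?thesis
    using assms(2,3)
    by (auto intro!: linear_mapI simp: linear_map_closed linear_map_add linear_map_smult
        W.M.a_ac W.smult_r_distr)
qed

lemma linear_map_smult_const:
  assumes "module K W" "c \<in> carrier K" "linear_map K V W f"
  shows "linear_map K V W (\<lambda>x. c \<odot>\<^bsub>W\<^esub> f x)"
proof -
  interpret W: module K W by fact
  show ?thesis
    using assms(2,3)
    by (auto intro!: linear_mapI simp: linear_map_closed linear_map_add linear_map_smult
        W.smult_r_distr W.smult_assoc1[symmetric] W.R.m_comm)
qed

lemma linear_map_minus:
  assumes "module K W" "linear_map K V W f" "linear_map K V W g"
  shows "linear_map K V W (\<lambda>x. f x \<ominus>\<^bsub>W\<^esub> g x)"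
proof -
  interpret W: module K W by fact
  show ?thesis
    using assms(2,3)
    by (auto intro!: linear_mapI simp: linear_map_closed linear_map_add linear_map_smult
        W.M.a_ac W.smult_r_distr a_minus_def W.M.minus_add W.smult_r_minus)
qed

lemma linear_map_const_zero:
  assumes "module K W"
  shows "linear_map K V W (\<lambda>x. \<zero>\<^bsub>W\<^esub>)"
proof -
  interpret W: module K W by fact
  show ?thesis by (auto intro!: linear_mapI)
qed

lemma linear_map_kernel:
  assumes "module K V" "module K W" "linear_map K V W f"
  shows "submodule {x \<in> carrier V. f x = \<zero>\<^bsub>W\<^esub>} K V"
proof -
  interpret V: module K V by fact
  interpret W: module K W by fact
  show ?thesis
    using linear_map_zero[OF assms] linear_map_uminus[OF assms] assms(3)
    by (intro V.submoduleI) (auto simp: linear_map_add linear_map_smult)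
qed

lemma linear_map_image:
  assumes "module K V" "module K W" "linear_map K V W f"
  shows "submodule (f ` carrier V) K W"
proof -
  interpret V: module K V by fact
  interpret W: module K W by fact
  show ?thesis
  proof (rule W.submoduleI)
    show "f ` carrier V \<subseteq> carrier W" using linear_map_closed[OF assms(3)] by auto
    show "\<zero>\<^bsub>W\<^esub> \<in> f ` carrier V"
      by (rule image_eqI[of _ _ "\<zero>\<^bsub>V\<^esub>"]) (auto simp: linear_map_zero[OF assms])
  next
    fix a assume "a \<in> f ` carrier V"
    then obtain x where "x \<in> carrier V" "a = f x" by blast
    then show "\<ominus>\<^bsub>W\<^esub> a \<in> f ` carrier V"
      by (intro image_eqI[of _ _ "\<ominus>\<^bsub>V\<^esub> x"]) (auto simp: linear_map_uminus[OF assms])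
  next
    fix a b assume "a \<in> f ` carrier V" "b \<in> f ` carrier V"
    then obtain x y where "x \<in> carrier V" "a = f x" "y \<in> carrier V" "b = f y" by blast
    then show "a \<oplus>\<^bsub>W\<^esub> b \<in> f ` carrier V"
      by (intro image_eqI[of _ _ "x \<oplus>\<^bsub>V\<^esub> y"]) (auto simp: linear_map_add[OF assms(3)])
  next
    fix c a assume "c \<in> carrier K" "a \<in> f ` carrier V"
    then obtain x where "c \<in> carrier K" "x \<in> carrier V" "a = f x" by blast
    then show "c \<odot>\<^bsub>W\<^esub> a \<in> f ` carrier V"
      by (intro image_eqI[of _ _ "c \<odot>\<^bsub>V\<^esub> x"]) (auto simp: linear_map_smult[OF assms(3)])
  qed
qed

lemma linear_map_inv_into:
  assumes "module K V" "linear_map K V W f" "bij_betw f (carrier V) (carrier W)"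
  shows "linear_map K W V (inv_into (carrier V) f)"
proof -
  interpret V: module K V by fact
  let ?g = "inv_into (carrier V) f"
  have inj: "inj_on f (carrier V)" and im: "f ` carrier V = carrier W"
    using assms(3) by (auto simp: bij_betw_def)
  have g: "?g y \<in> carrier V" "f (?g y) = y" if "y \<in> carrier W" for y
    using that im by (auto simp: inv_into_into f_inv_into_f)
  show ?thesis
  proof (rule linear_mapI)
    fix x y assume "x \<in> carrier W" "y \<in> carrier W"
    then show "?g (x \<oplus>\<^bsub>W\<^esub> y) = ?g x \<oplus>\<^bsub>V\<^esub> ?g y"
      using g by (intro inv_into_f_eq[OF inj]) (auto simp: linear_map_add[OF assms(2)])
  next
    fix c x assume "c \<in> carrier K" "x \<in> carrier W"
    then show "?g (c \<odot>\<^bsub>W\<^esub> x) = c \<odot>\<^bsub>V\<^esub> ?g x"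
      using g by (intro inv_into_f_eq[OF inj]) (auto simp: linear_map_smult[OF assms(2)])
  qed (use g in auto)
qed

section \<open>Bilinear maps\<close>

lemma bilinear_mapI:
  assumes "\<And>u. u \<in> carrier U \<Longrightarrow> linear_map K V W (f u)"
    and "\<And>v. v \<in> carrier V \<Longrightarrow> linear_map K U W (\<lambda>u. f u v)"
  shows "bilinear_map K U V W f"
  using assms by (simp add: bilinear_map_def)

lemma
  assumes "bilinear_map K U V W f"
  shows bilinear_map_left: "v \<in> carrier V \<Longrightarrow> linear_map K U W (\<lambda>u. f u v)"
    and bilinear_map_right: "u \<in> carrier U \<Longrightarrow> linear_map K V W (f u)"
  using assms by (simp_all add: bilinear_map_def)

lemma bilinear_map_closed:
  assumes "bilinear_map K U V W f" "u \<in> carrier U" "v \<in> carrier V"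
  shows "f u v \<in> carrier W"
  using bilinear_map_right[OF assms(1,2)] assms(3) by (rule linear_map_closed)

lemma bilinear_map_comp:
  assumes "bilinear_map K U V W f" "linear_map K U' U g" "linear_map K V' V h"
  shows "bilinear_map K U' V' W (\<lambda>u v. f (g u) (h v))"
  using linear_map_closed[OF assms(2)] linear_map_closed[OF assms(3)]
  by (intro bilinear_mapI linear_map_comp[OF bilinear_map_right[OF assms(1)] assms(3)]
      linear_map_comp[OF bilinear_map_left[OF assms(1)] assms(2)]) auto

lemma linear_bilinear_map_comp:
  assumes "linear_map K W W' k" "bilinear_map K U V W f"
  shows "bilinear_map K U V W' (\<lambda>u v. k (f u v))"
  by (intro bilinear_mapI linear_map_comp[OF assms(1)] bilinear_map_right[OF assms(2)]
      bilinear_map_left[OF assms(2)])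

text \<open>The ring record \<open>K\<close> is not a module record, so \<open>g\<close> cannot be
  passed as a \<open>linear_map\<close> into \<open>K\<close>; its linearity is spelled out instead.
  The instance in mind is the counit, with the scalar on either side.\<close>

lemma bilinear_map_smult:
  assumes "module K V" "linear_map K U V f" "\<And>w. w \<in> carrier W \<Longrightarrow> g w \<in> carrier K"
    and "\<And>w w'. \<lbrakk>w \<in> carrier W; w' \<in> carrier W\<rbrakk> \<Longrightarrow> g (w \<oplus>\<^bsub>W\<^esub> w') = g w \<oplus>\<^bsub>K\<^esub> g w'"
    and "\<And>c w. \<lbrakk>c \<in> carrier K; w \<in> carrier W\<rbrakk> \<Longrightarrow> g (c \<odot>\<^bsub>W\<^esub> w) = c \<otimes>\<^bsub>K\<^esub> g w"
  shows "bilinear_map K U W V (\<lambda>u w. g w \<odot>\<^bsub>V\<^esub> f u)"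
    and "bilinear_map K W U V (\<lambda>w u. g w \<odot>\<^bsub>V\<^esub> f u)"
proof -
  interpret V: module K V by fact
  have 1: "linear_map K U V (\<lambda>u. g w \<odot>\<^bsub>V\<^esub> f u)" if "w \<in> carrier W" for w
    using assms that by (intro linear_map_smult_const) auto
  have 2: "linear_map K W V (\<lambda>w. g w \<odot>\<^bsub>V\<^esub> f u)" if "u \<in> carrier U" for u
    using assms(3-) that linear_map_closed[OF assms(2)]
    by (intro linear_mapI) (auto simp: V.smult_l_distr V.smult_assoc1)
  show "bilinear_map K U W V (\<lambda>u w. g w \<odot>\<^bsub>V\<^esub> f u)" "bilinear_map K W U V (\<lambda>w u. g w \<odot>\<^bsub>V\<^esub> f u)"
    using 1 2 by (auto intro: bilinear_mapI)
qed

section \<open>Complements in vector spaces\<close>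

text \<open>Two members of a chain are comparable, so a sum can be formed in the larger one. This
  supplies upper bounds for Zorn's lemma.\<close>

lemma subset_chain_Un_submodule:
  assumes "module K V" "C \<noteq> {}" "subset.chain {N. submodule N K V} C"
  shows "submodule (\<Union>C) K V"
proof -
  interpret V: module K V by fact
  have sub: "submodule N K V" if "N \<in> C" for N
    using assms(3) that by (auto simp: subset.chain_def)
  have tot: "M \<subseteq> N \<or> N \<subseteq> M" if "M \<in> C" "N \<in> C" for M N
    using assms(3) that by (auto simp: subset.chain_def)
  show ?thesis
  proof (rule V.submoduleI)
    show "\<Union>C \<subseteq> carrier V" using V.submoduleE(1)[OF sub] by blast
    obtain N where "N \<in> C" using assms(2) by blast
    then show "\<zero>\<^bsub>V\<^esub> \<in> \<Union>C"
      using subgroup.one_closed[OF submodule.axioms(1)[OF sub]] by auto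
  next
    fix a b assume "a \<in> \<Union>C" "b \<in> \<Union>C"
    then obtain M N where MN: "M \<in> C" "a \<in> M" "N \<in> C" "b \<in> N" by blast
    then have "\<exists>N\<in>C. a \<in> N \<and> b \<in> N" using tot[of M N] by blast
    then obtain N where N: "N \<in> C" "a \<in> N" "b \<in> N" by blast
    then show "a \<oplus>\<^bsub>V\<^esub> b \<in> \<Union>C" using V.submoduleE(5)[OF sub[OF N(1)]] by blast
  qed (use V.submoduleE(3,4)[OF sub] in blast)+
qed

text \<open>By Zorn there is a maximal submodule \<open>C\<close> meeting \<open>U\<close> only in
  zero. If some \<open>x\<close> were outside \<open>U + C\<close>, then \<open>C + K x\<close>
  would still meet \<open>U\<close> only in zero, against maximality.\<close>

lemma (in field) submodule_complement:
  assumes "module R V" "submodule U R V"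
  obtains C where "submodule C R V" "U \<inter> C = {\<zero>\<^bsub>V\<^esub>}"
    "\<And>x. x \<in> carrier V \<Longrightarrow> \<exists>u\<in>U. \<exists>c\<in>C. x = u \<oplus>\<^bsub>V\<^esub> c"
proof -
  interpret V: module R V by fact
  let ?\<A> = "{N. submodule N R V \<and> U \<inter> N = {\<zero>\<^bsub>V\<^esub>}}"
  have U0: "\<zero>\<^bsub>V\<^esub> \<in> U" using subgroup.one_closed[OF submodule.axioms(1)[OF assms(2)]] by simp
  have "submodule {\<zero>\<^bsub>V\<^esub>} R V" by (rule V.submoduleI) auto
  then have ne: "?\<A> \<noteq> {}" using U0 by auto
  have "\<Union>C \<in> ?\<A>" if "C \<noteq> {}" "subset.chain ?\<A> C" for C
  proof -
    have "subset.chain {N. submodule N R V} C" using that(2) by (auto simp: subset.chain_def)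
    from subset_chain_Un_submodule[OF assms(1) that(1) this] that
    show ?thesis by (auto simp: subset.chain_def)
  qed
  from subset_Zorn_nonempty[OF ne this]
  obtain C where C: "submodule C R V" "U \<inter> C = {\<zero>\<^bsub>V\<^esub>}"
    and max: "\<And>N. submodule N R V \<Longrightarrow> U \<inter> N = {\<zero>\<^bsub>V\<^esub>} \<Longrightarrow> C \<subseteq> N \<Longrightarrow> N = C" by auto
  note CE = V.submoduleE[OF C(1)] and UE = V.submoduleE[OF assms(2)]
  have C0: "\<zero>\<^bsub>V\<^esub> \<in> C" using C(2) by auto
  have "\<exists>u\<in>U. \<exists>c\<in>C. x = u \<oplus>\<^bsub>V\<^esub> c" if x: "x \<in> carrier V" for x
  proof (rule ccontr)
    assume nx: "\<not> ?thesis"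
    \<comment> \<open>The enlargement \<open>C + K x\<close>, to be refuted by maximality.\<close>
    define N where "N = {c \<oplus>\<^bsub>V\<^esub> k \<odot>\<^bsub>V\<^esub> x |c k. c \<in> C \<and> k \<in> carrier R}"
    have Cc: "c \<in> carrier V" if "c \<in> C" for c using CE(1) that by auto
    have "submodule N R V"
    proof (rule V.submoduleI)
      show "N \<subseteq> carrier V" using Cc x by (auto simp: N_def)
      show "\<zero>\<^bsub>V\<^esub> \<in> N" unfolding N_def using C0 x
        by (intro CollectI exI[of _ "\<zero>\<^bsub>V\<^esub>"] exI[of _ \<zero>]) auto
    next
      fix a assume "a \<in> N"
      then obtain c k where "c \<in> C" "k \<in> carrier R" "a = c \<oplus>\<^bsub>V\<^esub> k \<odot>\<^bsub>V\<^esub> x" by (auto simp: N_def)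
      then show "\<ominus>\<^bsub>V\<^esub> a \<in> N" unfolding N_def using CE(3) x Cc
        by (intro CollectI exI[of _ "\<ominus>\<^bsub>V\<^esub> c"] exI[of _ "\<ominus> k"]) (auto simp: V.minus_add V.smult_l_minus)
    next
      fix a b assume "a \<in> N" "b \<in> N"
      then obtain c k c' k' where "c \<in> C" "k \<in> carrier R" "a = c \<oplus>\<^bsub>V\<^esub> k \<odot>\<^bsub>V\<^esub> x"
        "c' \<in> C" "k' \<in> carrier R" "b = c' \<oplus>\<^bsub>V\<^esub> k' \<odot>\<^bsub>V\<^esub> x" by (auto simp: N_def)
      then show "a \<oplus>\<^bsub>V\<^esub> b \<in> N" unfolding N_def using CE(5) x Cc
        by (intro CollectI exI[of _ "c \<oplus>\<^bsub>V\<^esub> c'"] exI[of _ "k \<oplus> k'"]) (auto simp: V.smult_l_distr V.M.a_ac)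
    next
      fix l a assume "l \<in> carrier R" "a \<in> N"
      then obtain c k where "c \<in> C" "k \<in> carrier R" "a = c \<oplus>\<^bsub>V\<^esub> k \<odot>\<^bsub>V\<^esub> x" "l \<in> carrier R" by (auto simp: N_def)
      then show "l \<odot>\<^bsub>V\<^esub> a \<in> N" unfolding N_def using CE(4) x Cc
        by (intro CollectI exI[of _ "l \<odot>\<^bsub>V\<^esub> c"] exI[of _ "l \<otimes> k"])
          (auto simp: V.smult_r_distr V.smult_assoc1)
    qed
    moreover have "U \<inter> N = {\<zero>\<^bsub>V\<^esub>}"
    proof -
      have "y = \<zero>\<^bsub>V\<^esub>" if y: "y \<in> U" "y \<in> N" for y
      proof -
        obtain c k where ck: "c \<in> C" "k \<in> carrier R" "y = c \<oplus>\<^bsub>V\<^esub> k \<odot>\<^bsub>V\<^esub> x"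
          using y(2) by (auto simp: N_def)
        show ?thesis
        proof (cases "k = \<zero>")
          case True
          then have "y = c" using ck x Cc by simp
          then show ?thesis using C(2) that(1) ck(1) by auto
        next
          case False
          \<comment> \<open>Dividing by \<open>k\<close> solves \<open>y = c + k x\<close> for
            \<open>x\<close> and puts \<open>x\<close> into \<open>U + C\<close>, contrary to
            \<open>nx\<close>.\<close>
          then have k: "inv k \<in> carrier R" "inv k \<otimes> k = \<one>"
            using field_Units ck(2) by auto
          have yc: "y \<in> carrier V" using UE(1) that(1) by auto
          have "k \<odot>\<^bsub>V\<^esub> x = y \<oplus>\<^bsub>V\<^esub> \<ominus>\<^bsub>V\<^esub> c"
            using ck x Cc[OF ck(1)] by (simp add: V.M.a_ac V.M.r_neg V.M.r_neg1 V.M.r_neg2)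
          then have "x = inv k \<odot>\<^bsub>V\<^esub> (y \<oplus>\<^bsub>V\<^esub> \<ominus>\<^bsub>V\<^esub> c)"
            using V.smult_assoc1[OF k(1) ck(2) x] k(2) x by simp
          also have "\<dots> = inv k \<odot>\<^bsub>V\<^esub> y \<oplus>\<^bsub>V\<^esub> inv k \<odot>\<^bsub>V\<^esub> (\<ominus>\<^bsub>V\<^esub> c)"
            using k(1) yc Cc[OF ck(1)] by (simp add: V.smult_r_distr)
          finally show ?thesis using nx UE(4)[OF k(1) that(1)] CE(4)[OF k(1) CE(3)[OF ck(1)]] by blast
        qed
      qed
      moreover have "\<zero>\<^bsub>V\<^esub> \<in> N" unfolding N_def using C0 x
        by (intro CollectI exI[of _ "\<zero>\<^bsub>V\<^esub>"] exI[of _ \<zero>]) auto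
      ultimately show ?thesis using U0 by blast
    qed
    moreover have "C \<subseteq> N"
    proof
      fix c assume "c \<in> C"
      then show "c \<in> N" unfolding N_def using x Cc
        by (intro CollectI exI[of _ c] exI[of _ \<zero>]) auto
    qed
    ultimately have "N = C" by (rule max)
    moreover have "x \<in> N" unfolding N_def using C0 x
      by (intro CollectI exI[of _ "\<zero>\<^bsub>V\<^esub>"] exI[of _ \<one>]) auto
    ultimately have "x = \<zero>\<^bsub>V\<^esub> \<oplus>\<^bsub>V\<^esub> x" "x \<in> C" using x by auto
    then show False using nx U0 by blast
  qed
  then show ?thesis using that C by blast
qed

text \<open>Take a complement \<open>C\<close> of the kernel and a complement \<open>H\<close> of
  the image, and let \<open>s y\<close> be the unique \<open>c\<close> in \<open>C\<close> with
  \<open>y - f c\<close> in \<open>H\<close>. Such an \<open>s\<close> serves two ends: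
  \<open>id - s f\<close> projects onto the kernel of \<open>f\<close>, which survives tensoring,
  and for \<open>f c = c w\<close> it is a linear functional that does not vanish at
  \<open>w\<close> unless \<open>w = 0\<close>.\<close>

lemma (in field) linear_generalized_inverse:
  assumes "module R V" "module R W" "linear_map R V W f"
  obtains s where "linear_map R W V s" "\<And>x. x \<in> carrier V \<Longrightarrow> f (s (f x)) = f x"
proof -
  interpret V: module R V by fact
  interpret W: module R W by fact
  obtain C where C: "submodule C R V" "{x \<in> carrier V. f x = \<zero>\<^bsub>W\<^esub>} \<inter> C = {\<zero>\<^bsub>V\<^esub>}"
    and Cex: "\<And>x. x \<in> carrier V \<Longrightarrow> \<exists>u\<in>{x \<in> carrier V. f x = \<zero>\<^bsub>W\<^esub>}. \<exists>c\<in>C. x = u \<oplus>\<^bsub>V\<^esub> c"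
    using that by (rule submodule_complement[OF assms(1) linear_map_kernel[OF assms]])
  obtain H where H: "submodule H R W" "f ` carrier V \<inter> H = {\<zero>\<^bsub>W\<^esub>}"
    and Hex: "\<And>y. y \<in> carrier W \<Longrightarrow> \<exists>u\<in>f ` carrier V. \<exists>h\<in>H. y = u \<oplus>\<^bsub>W\<^esub> h"
    using that by (rule submodule_complement[OF assms(2) linear_map_image[OF assms]])
  note CE = V.submoduleE[OF C(1)] and HE = W.submoduleE[OF H(1)]
  note fcl = linear_map_closed[OF assms(3)] and fadd = linear_map_add[OF assms(3)]
    and fsm = linear_map_smult[OF assms(3)] and fdiff = linear_map_diff[OF assms]
  have Cc: "c \<in> carrier V" if "c \<in> C" for c using CE(1) that by auto
  have Hc: "c \<in> carrier W" if "c \<in> H" for c using HE(1) that by auto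
  \<comment> \<open>Split \<open>y = f v + h\<close> along the image and \<open>H\<close>, then
    replace \<open>v\<close> by its component in \<open>C\<close>, which has the same image under
    \<open>f\<close>.\<close>
  have ex: "\<exists>c. c \<in> C \<and> y \<ominus>\<^bsub>W\<^esub> f c \<in> H" if y: "y \<in> carrier W" for y
  proof -
    obtain v h where vh: "v \<in> carrier V" "h \<in> H" "y = f v \<oplus>\<^bsub>W\<^esub> h" using Hex[OF y] by blast
    obtain k c where kc: "k \<in> carrier V" "f k = \<zero>\<^bsub>W\<^esub>" "c \<in> C" "v = k \<oplus>\<^bsub>V\<^esub> c"
      using Cex[OF vh(1)] by blast
    have "f v = f c" using kc fadd[of k c] Cc fcl by simp
    then have "y \<ominus>\<^bsub>W\<^esub> f c = h"
      using vh Hc fcl[OF Cc[OF kc(3)]] by (simp add: a_minus_def W.M.a_ac W.M.r_neg W.M.r_neg1 W.M.r_neg2)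
    then show ?thesis using kc vh by auto
  qed
  \<comment> \<open>The difference of two candidates is mapped by \<open>f\<close> into both the
    image and \<open>H\<close>, so it lies in the kernel; it also lies in \<open>C\<close>.\<close>
  have uniq: "c = c'" if "c \<in> C" "c' \<in> C" "y \<in> carrier W" "y \<ominus>\<^bsub>W\<^esub> f c \<in> H" "y \<ominus>\<^bsub>W\<^esub> f c' \<in> H" for y c c'
  proof -
    have cl: "f c \<in> carrier W" "f c' \<in> carrier W" using fcl Cc that by auto
    have "(y \<ominus>\<^bsub>W\<^esub> f c) \<oplus>\<^bsub>W\<^esub> \<ominus>\<^bsub>W\<^esub> (y \<ominus>\<^bsub>W\<^esub> f c') \<in> H"
      using that(4) HE(3)[OF that(5)] by (rule HE(5))
    also have "(y \<ominus>\<^bsub>W\<^esub> f c) \<oplus>\<^bsub>W\<^esub> \<ominus>\<^bsub>W\<^esub> (y \<ominus>\<^bsub>W\<^esub> f c') = f c' \<ominus>\<^bsub>W\<^esub> f c"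
      using cl that(3) by (simp add: a_minus_def W.M.minus_add W.M.a_ac W.M.r_neg W.M.r_neg1 W.M.r_neg2)
    also have "\<dots> = f (c' \<ominus>\<^bsub>V\<^esub> c)" using fdiff Cc that by simp
    finally have "f (c' \<ominus>\<^bsub>V\<^esub> c) = \<zero>\<^bsub>W\<^esub>" using H(2) Cc that(1,2) by blast
    moreover have "c' \<ominus>\<^bsub>V\<^esub> c \<in> C" using CE(3,5) that(1,2) by (auto simp: a_minus_def)
    ultimately have "c' \<ominus>\<^bsub>V\<^esub> c = \<zero>\<^bsub>V\<^esub>" using C(2) Cc by blast
    then show ?thesis using Cc that(1,2) by (metis V.M.minus_eq_zero_iff)
  qed
  define s where "s y = (THE c. c \<in> C \<and> y \<ominus>\<^bsub>W\<^esub> f c \<in> H)" for y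
  have s: "s y \<in> C" "y \<ominus>\<^bsub>W\<^esub> f (s y) \<in> H" if "y \<in> carrier W" for y
  proof -
    have "\<exists>!c. c \<in> C \<and> y \<ominus>\<^bsub>W\<^esub> f c \<in> H" using ex[OF that] uniq that by blast
    from theI'[OF this] show "s y \<in> C" "y \<ominus>\<^bsub>W\<^esub> f (s y) \<in> H" by (auto simp: s_def)
  qed
  have s_eq: "s y = c" if "y \<in> carrier W" "c \<in> C" "y \<ominus>\<^bsub>W\<^esub> f c \<in> H" for y c
    using uniq[of "s y" c y] s that by blast
  have scl: "s y \<in> carrier V" if "y \<in> carrier W" for y using s(1)[OF that] Cc by blast
  show ?thesis
  proof
    show "linear_map R W V s"
    proof (rule linear_mapI)
      fix x y assume xy: "x \<in> carrier W" "y \<in> carrier W"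
      have "(x \<oplus>\<^bsub>W\<^esub> y) \<ominus>\<^bsub>W\<^esub> f (s x \<oplus>\<^bsub>V\<^esub> s y) = (x \<ominus>\<^bsub>W\<^esub> f (s x)) \<oplus>\<^bsub>W\<^esub> (y \<ominus>\<^bsub>W\<^esub> f (s y))"
        using xy fcl scl by (simp add: fadd a_minus_def W.M.minus_add W.M.a_ac)
      then show "s (x \<oplus>\<^bsub>W\<^esub> y) = s x \<oplus>\<^bsub>V\<^esub> s y"
        using xy s HE(5) CE(5) by (intro s_eq) auto
    next
      fix c x assume xy: "c \<in> carrier R" "x \<in> carrier W"
      have "(c \<odot>\<^bsub>W\<^esub> x) \<ominus>\<^bsub>W\<^esub> f (c \<odot>\<^bsub>V\<^esub> s x) = c \<odot>\<^bsub>W\<^esub> (x \<ominus>\<^bsub>W\<^esub> f (s x))"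
        using xy fcl scl by (simp add: fsm a_minus_def W.smult_r_distr W.smult_r_minus)
      then show "s (c \<odot>\<^bsub>W\<^esub> x) = c \<odot>\<^bsub>V\<^esub> s x"
        using xy s HE(4) CE(4) by (intro s_eq) auto
    qed (use scl in auto)
  next
    fix x assume x: "x \<in> carrier V"
    have "f x \<ominus>\<^bsub>W\<^esub> f (s (f x)) = f (x \<ominus>\<^bsub>V\<^esub> s (f x))"
      using x fcl scl fdiff by simp
    then have "f x \<ominus>\<^bsub>W\<^esub> f (s (f x)) \<in> f ` carrier V \<inter> H"
      using x fcl scl s(2)[OF fcl[OF x]] by auto
    then have "f x \<ominus>\<^bsub>W\<^esub> f (s (f x)) = \<zero>\<^bsub>W\<^esub>" using H(2) by blast
    then show "f (s (f x)) = f x" using x fcl scl by (metis W.M.minus_eq_zero_iff)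
  qed
qed

section \<open>Quotients and spans\<close>

text \<open>Being a module depends on four fields only. This carries the property over to records
  that differ elsewhere, such as bimodules with their two actions.\<close>

lemma module_cong:
  assumes "module K V" "carrier W = carrier V" "add W = add V" "ring.zero W = ring.zero V"
    and "module.smult W = module.smult V"
  shows "module K W"
proof -
  interpret V: module K V by fact
  have "\<exists>y\<in>carrier V. y \<oplus>\<^bsub>V\<^esub> x = \<zero>\<^bsub>V\<^esub>" if "x \<in> carrier V" for x
    using that by (intro bexI[of _ "\<ominus>\<^bsub>V\<^esub> x"]) (auto simp: V.M.l_neg)
  then have "abelian_group W"
    using assms(2-5) by (intro abelian_groupI) (auto simp: V.M.a_ac)
  then show ?thesis
    using assms(2-5) by (intro moduleI) (auto simp: V.R.is_cring V.smult_l_distr V.smult_r_distr V.smult_assoc1)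
qed

lemma finsum_add_monoid_cong:
  assumes "carrier W = carrier V" "add W = add V" "ring.zero W = ring.zero V"
  shows "finsum W = finsum V"
  by (intro ext) (simp add: finsum_def finprod_def assms)

context module begin

lemma submodule_abelian_subgroup:
  assumes "submodule N R M" shows "abelian_subgroup N M"
  by (intro abelian_subgroupI3 additive_subgroupI submodule.axioms(1)[OF assms] M.abelian_group_axioms)

lemma coset_eq_iff:
  assumes "submodule N R M" "x \<in> carrier M" "y \<in> carrier M"
  shows "N +>\<^bsub>M\<^esub> x = N +>\<^bsub>M\<^esub> y \<longleftrightarrow> x \<ominus>\<^bsub>M\<^esub> y \<in> N"
proof -
  interpret N: abelian_subgroup N M by (rule submodule_abelian_subgroup) fact
  have "N +>\<^bsub>M\<^esub> x = N +>\<^bsub>M\<^esub> y \<longleftrightarrow> x \<in> N +>\<^bsub>M\<^esub> y"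
    using assms(2,3) N.a_rcos_self[of x] M.a_repr_independence[of x N y] N.a_subgroup by auto
  also have "\<dots> \<longleftrightarrow> x \<oplus>\<^bsub>M\<^esub> \<ominus>\<^bsub>M\<^esub> y \<in> N"
    using assms(2,3) N.a_rcos_module by blast
  finally show ?thesis by (simp add: a_minus_def)
qed

text \<open>Operations on quotients are encoded as unions over all representatives. If
  \<open>h\<close> preserves \<open>N\<close>, every set in the union is the same coset, so this is
  well-definedness in the form that scalar multiplication and both actions on a quotient
  require.\<close>

lemma coset_UN:
  assumes "submodule N R M" "x \<in> carrier M"
    and "\<And>y. y \<in> carrier M \<Longrightarrow> h y \<in> carrier M"
    and "\<And>y z. \<lbrakk>y \<in> carrier M; z \<in> carrier M\<rbrakk> \<Longrightarrow> h (y \<oplus>\<^bsub>M\<^esub> z) = h y \<oplus>\<^bsub>M\<^esub> h z"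
    and "\<And>n. n \<in> N \<Longrightarrow> h n \<in> N"
  shows "(\<Union>z\<in>N +>\<^bsub>M\<^esub> x. N +>\<^bsub>M\<^esub> h z) = N +>\<^bsub>M\<^esub> h x"
proof -
  interpret N: abelian_subgroup N M by (rule submodule_abelian_subgroup) fact
  have "N +>\<^bsub>M\<^esub> h z = N +>\<^bsub>M\<^esub> h x" if z: "z \<in> N +>\<^bsub>M\<^esub> x" for z
  proof -
    obtain n where n: "n \<in> N" "z = n \<oplus>\<^bsub>M\<^esub> x" using z by (auto simp: a_r_coset_def')
    have nc: "n \<in> carrier M" using n N.a_subset by auto
    have "h z \<ominus>\<^bsub>M\<^esub> h x = h n"
      using n nc assms by (simp add: a_minus_def M.a_ac M.r_neg M.r_neg1 M.r_neg2)
    then show ?thesis using n nc assms by (subst coset_eq_iff) auto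
  qed
  moreover have "x \<in> N +>\<^bsub>M\<^esub> x" using assms(2) by (rule N.a_rcos_self)
  ultimately show ?thesis by blast
qed

context
  fixes N
  assumes N: "submodule N R M"
begin

interpretation N: abelian_subgroup N M by (rule submodule_abelian_subgroup[OF N])

lemma quot_module_carrier: "carrier (quot_module M N) = (\<lambda>x. N +>\<^bsub>M\<^esub> x) ` carrier M"
  by (auto simp: quot_module_def A_RCOSETS_def')

lemma quot_module_zero: "\<zero>\<^bsub>quot_module M N\<^esub> = N"
  by (simp add: quot_module_def)

lemma quot_module_add:
  "\<lbrakk>x \<in> carrier M; y \<in> carrier M\<rbrakk>
    \<Longrightarrow> (N +>\<^bsub>M\<^esub> x) \<oplus>\<^bsub>quot_module M N\<^esub> (N +>\<^bsub>M\<^esub> y) = N +>\<^bsub>M\<^esub> (x \<oplus>\<^bsub>M\<^esub> y)"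
  by (simp add: quot_module_def N.a_rcos_sum)

lemma quot_module_smult:
  "\<lbrakk>c \<in> carrier R; x \<in> carrier M\<rbrakk>
    \<Longrightarrow> c \<odot>\<^bsub>quot_module M N\<^esub> (N +>\<^bsub>M\<^esub> x) = N +>\<^bsub>M\<^esub> (c \<odot>\<^bsub>M\<^esub> x)"
  unfolding quot_module_def using submoduleE(4)[OF N]
  by (simp, intro coset_UN) (auto simp: N smult_r_distr)

lemma quot_module_module: "module R (quot_module M N)"
proof -
  have N0: "N = N +>\<^bsub>M\<^esub> \<zero>\<^bsub>M\<^esub>" using N.a_subset by simp
  have "abelian_group (quot_module M N)"
  proof (rule abelian_groupI)
    fix X assume "X \<in> carrier (quot_module M N)"
    then obtain x where "x \<in> carrier M" "X = N +>\<^bsub>M\<^esub> x" by (auto simp: quot_module_carrier)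
    then show "\<zero>\<^bsub>quot_module M N\<^esub> \<oplus>\<^bsub>quot_module M N\<^esub> X = X"
      and "\<exists>Y\<in>carrier (quot_module M N). Y \<oplus>\<^bsub>quot_module M N\<^esub> X = \<zero>\<^bsub>quot_module M N\<^esub>"
      using quot_module_add[of "\<zero>\<^bsub>M\<^esub>" x] quot_module_add[of "\<ominus>\<^bsub>M\<^esub> x" x] N0
      by (auto simp: quot_module_carrier quot_module_zero M.l_neg)
  next
    show "\<zero>\<^bsub>quot_module M N\<^esub> \<in> carrier (quot_module M N)"
      using N0 by (auto simp: quot_module_carrier quot_module_zero)
  qed (auto simp: quot_module_carrier quot_module_add M.a_ac)
  then show ?thesis
    by (rule moduleI[OF R.is_cring])
      (auto simp: quot_module_carrier quot_module_smult quot_module_add smult_l_distr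
        smult_r_distr smult_assoc1)
qed

lemma quot_module_proj_linear: "linear_map R M (quot_module M N) (\<lambda>x. N +>\<^bsub>M\<^esub> x)"
  by (rule linear_mapI) (auto simp: quot_module_carrier quot_module_smult quot_module_add)

lemma quot_module_eq_zero_iff:
  "x \<in> carrier M \<Longrightarrow> N +>\<^bsub>M\<^esub> x = \<zero>\<^bsub>quot_module M N\<^esub> \<longleftrightarrow> x \<in> N"
  unfolding quot_module_zero
  by (rule iffI, erule (1) M.a_coset_join1[OF _ _ N.a_subgroup], erule (1) M.a_coset_join2[OF _ N.a_subgroup])

end

lemma
  assumes "X \<subseteq> carrier M"
  shows lin_span_submodule: "submodule (lin_span R M X) R M"
    and lin_span_superset: "X \<subseteq> lin_span R M X"
proof -
  have E: "submodule (carrier M) R M" by (rule carrier_is_submodule)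
  show "X \<subseteq> lin_span R M X" by (auto simp: lin_span_def)
  show "submodule (lin_span R M X) R M"
  proof (rule submoduleI)
    show "lin_span R M X \<subseteq> carrier M" using E assms by (auto simp: lin_span_def)
    show "\<zero>\<^bsub>M\<^esub> \<in> lin_span R M X"
      using subgroup.one_closed[OF submodule.axioms(1)] by (fastforce simp: lin_span_def)
  qed (auto simp: lin_span_def dest: submoduleE(3-5))
qed

end

lemma lin_span_least: "\<lbrakk>submodule N K V; X \<subseteq> N\<rbrakk> \<Longrightarrow> lin_span K V X \<subseteq> N"
  by (auto simp: lin_span_def)

section \<open>Free modules\<close>

context cring begin

lemma free_module_module: "module R (free_module R X)"
proof (rule moduleI)
  have fin: "finite {x. f x \<oplus> g x \<noteq> \<zero>}" "{x. f x \<oplus> g x \<noteq> \<zero>} \<subseteq> X"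
    if "finite {x. f x \<noteq> \<zero>}" "finite {x. g x \<noteq> \<zero>}"
      "{x. f x \<noteq> \<zero>} \<subseteq> X" "{x. g x \<noteq> \<zero>} \<subseteq> X" for f g :: "'c \<Rightarrow> 'a"
  proof -
    have "{x. f x \<oplus> g x \<noteq> \<zero>} \<subseteq> {x. f x \<noteq> \<zero>} \<union> {x. g x \<noteq> \<zero>}" by auto
    then show "finite {x. f x \<oplus> g x \<noteq> \<zero>}" "{x. f x \<oplus> g x \<noteq> \<zero>} \<subseteq> X"
      using that by (auto dest: finite_subset)
  qed
  show "abelian_group (free_module R X)"
  proof (rule abelian_groupI)
    fix f g assume "f \<in> carrier (free_module R X)" "g \<in> carrier (free_module R X)"
    then show "f \<oplus>\<^bsub>free_module R X\<^esub> g \<in> carrier (free_module R X)"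
      using fin[of f g] by (auto simp: free_module_def)
  next
    fix f assume "f \<in> carrier (free_module R X)"
    moreover from this have "{x. \<ominus> f x \<noteq> \<zero>} = {x. f x \<noteq> \<zero>}"
      by (auto simp: free_module_def)
    ultimately show "\<exists>g\<in>carrier (free_module R X). g \<oplus>\<^bsub>free_module R X\<^esub> f = \<zero>\<^bsub>free_module R X\<^esub>"
      by (intro bexI[of _ "\<lambda>x. \<ominus> f x"]) (auto simp: free_module_def l_neg)
  qed (auto simp: free_module_def fun_eq_iff a_ac)
next
  fix c f assume *: "c \<in> carrier R" "f \<in> carrier (free_module R X)"
  then have "{x. c \<otimes> f x \<noteq> \<zero>} \<subseteq> {x. f x \<noteq> \<zero>}" by auto
  with * show "c \<odot>\<^bsub>free_module R X\<^esub> f \<in> carrier (free_module R X)"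
    by (auto simp: free_module_def dest: finite_subset)
qed (auto simp: free_module_def fun_eq_iff is_cring l_distr r_distr m_assoc)

lemma free_gen_closed: "x \<in> X \<Longrightarrow> free_gen R x \<in> carrier (free_module R X)"
  by (auto simp: free_module_def free_gen_def)

text \<open>Induction on the size of the support: resetting one nonzero value to zero shrinks the
  support, and what was removed is a multiple of a generator.\<close>

lemma free_module_induct [consumes 1, case_names zero add]:
  assumes "\<phi> \<in> carrier (free_module R X)" "P \<zero>\<^bsub>free_module R X\<^esub>"
    and "\<And>\<psi> c x. \<lbrakk>\<psi> \<in> carrier (free_module R X); P \<psi>; c \<in> carrier R; x \<in> X\<rbrakk>
      \<Longrightarrow> P (\<psi> \<oplus>\<^bsub>free_module R X\<^esub> (c \<odot>\<^bsub>free_module R X\<^esub> free_gen R x))"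
  shows "P \<phi>"
  using assms(1)
proof (induction "card {x. \<phi> x \<noteq> \<zero>}" arbitrary: \<phi>)
  case 0
  then have "\<phi> = \<zero>\<^bsub>free_module R X\<^esub>" by (auto simp: free_module_def fun_eq_iff)
  then show ?case using assms(2) by simp
next
  case (Suc n)
  then obtain x where x: "\<phi> x \<noteq> \<zero>" by (metis (mono_tags, lifting) Collect_empty_eq card.empty nat.distinct(1))
  let ?\<psi> = "\<phi>(x := \<zero>)"
  have s: "{y. ?\<psi> y \<noteq> \<zero>} = {y. \<phi> y \<noteq> \<zero>} - {x}" by auto
  have \<phi>: "\<And>y. \<phi> y \<in> carrier R" "finite {y. \<phi> y \<noteq> \<zero>}" "{y. \<phi> y \<noteq> \<zero>} \<subseteq> X"
    using Suc.prems by (auto simp: free_module_def)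
  have \<psi>: "?\<psi> \<in> carrier (free_module R X)" using \<phi> s by (auto simp: free_module_def)
  have "P ?\<psi>" using Suc.hyps(2) \<phi> s x by (intro Suc.hyps(1) \<psi>) auto
  then have "P (?\<psi> \<oplus>\<^bsub>free_module R X\<^esub> (\<phi> x \<odot>\<^bsub>free_module R X\<^esub> free_gen R x))"
    using \<psi> \<phi> x by (intro assms(3)) auto
  also have "?\<psi> \<oplus>\<^bsub>free_module R X\<^esub> (\<phi> x \<odot>\<^bsub>free_module R X\<^esub> free_gen R x) = \<phi>"
    using \<phi> by (auto simp: free_module_def free_gen_def fun_eq_iff)
  finally show ?case .
qed

text \<open>Written as the same sum over the support that occurs in \<open>tensor_lift\<close>, so
  that the two coincide by unfolding once a representative is fixed.\<close>

definition free_lift :: "('a, 'u, 'm) module_scheme \<Rightarrow> ('x \<Rightarrow> 'u) \<Rightarrow> ('x \<Rightarrow> 'a) \<Rightarrow> 'u"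
  where "free_lift U f \<phi> = (\<Oplus>\<^bsub>U\<^esub> p\<in>{p. \<phi> p \<noteq> \<zero>}. \<phi> p \<odot>\<^bsub>U\<^esub> f p)"

text \<open>Cancellation can make the support of a sum smaller than the union of the supports.
  Summing over any finite superset puts all sums in the linearity proof over one index set.\<close>

lemma free_lift_eq:
  assumes "module R U" "f \<in> X \<rightarrow> carrier U" "\<phi> \<in> carrier (free_module R X)"
    and "finite S" "{p. \<phi> p \<noteq> \<zero>} \<subseteq> S" "S \<subseteq> X"
  shows "free_lift U f \<phi> = (\<Oplus>\<^bsub>U\<^esub> p\<in>S. \<phi> p \<odot>\<^bsub>U\<^esub> f p)"
proof -
  interpret U: module R U by fact
  have "\<phi> p \<in> carrier R" for p using assms(3) by (auto simp: free_module_def)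
  then show ?thesis unfolding free_lift_def
    using assms by (intro U.M.add.finprod_mono_neutral_cong_left) (auto simp: Pi_def subset_iff)
qed

lemma free_lift_linear:
  assumes "module R U" "f \<in> X \<rightarrow> carrier U"
  shows "linear_map R (free_module R X) U (free_lift U f)"
proof -
  interpret U: module R U by fact
  interpret F: module R "free_module R X" by (rule free_module_module)
  let ?S = "\<lambda>\<phi>. {p. \<phi> p \<noteq> \<zero>}"
  have c: "\<phi> p \<in> carrier R" "finite (?S \<phi>)" "?S \<phi> \<subseteq> X" if "\<phi> \<in> carrier (free_module R X)" for \<phi> p
    using that by (auto simp: free_module_def)
  note eq = free_lift_eq[OF assms]
  have f: "p \<in> X \<Longrightarrow> f p \<in> carrier U" for p using assms(2) by auto
  show ?thesis
  proof (rule linear_mapI)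
    fix \<phi> assume \<phi>: "\<phi> \<in> carrier (free_module R X)"
    show "free_lift U f \<phi> \<in> carrier U"
      unfolding free_lift_def using c[OF \<phi>] f by (intro U.M.finsum_closed) auto
  next
    fix \<phi> \<psi> assume \<phi>: "\<phi> \<in> carrier (free_module R X)" and \<psi>: "\<psi> \<in> carrier (free_module R X)"
    let ?T = "?S \<phi> \<union> ?S \<psi>"
    have fT: "p \<in> ?T \<Longrightarrow> f p \<in> carrier U" for p using c(3)[OF \<phi>] c(3)[OF \<psi>] f by auto
    have "free_lift U f (\<phi> \<oplus>\<^bsub>free_module R X\<^esub> \<psi>)
        = (\<Oplus>\<^bsub>U\<^esub> p\<in>?T. (\<phi> \<oplus>\<^bsub>free_module R X\<^esub> \<psi>) p \<odot>\<^bsub>U\<^esub> f p)"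
      using c[OF \<phi>] c[OF \<psi>] by (intro eq F.M.a_closed \<phi> \<psi>) (auto simp: free_module_def)
    also have "\<dots> = (\<Oplus>\<^bsub>U\<^esub> p\<in>?T. \<phi> p \<odot>\<^bsub>U\<^esub> f p \<oplus>\<^bsub>U\<^esub> \<psi> p \<odot>\<^bsub>U\<^esub> f p)"
      using c[OF \<phi>] c[OF \<psi>] fT by (intro U.M.finsum_cong') (auto simp: free_module_def U.smult_l_distr)
    also have "\<dots> = (\<Oplus>\<^bsub>U\<^esub> p\<in>?T. \<phi> p \<odot>\<^bsub>U\<^esub> f p) \<oplus>\<^bsub>U\<^esub> (\<Oplus>\<^bsub>U\<^esub> p\<in>?T. \<psi> p \<odot>\<^bsub>U\<^esub> f p)"
      using c[OF \<phi>] c[OF \<psi>] fT by (intro U.M.finsum_addf) (auto simp: Pi_def)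
    also have "(\<Oplus>\<^bsub>U\<^esub> p\<in>?T. \<phi> p \<odot>\<^bsub>U\<^esub> f p) = free_lift U f \<phi>"
      using c[OF \<phi>] c[OF \<psi>] by (intro eq[symmetric] \<phi>) auto
    also have "(\<Oplus>\<^bsub>U\<^esub> p\<in>?T. \<psi> p \<odot>\<^bsub>U\<^esub> f p) = free_lift U f \<psi>"
      using c[OF \<phi>] c[OF \<psi>] by (intro eq[symmetric] \<psi>) auto
    finally show "free_lift U f (\<phi> \<oplus>\<^bsub>free_module R X\<^esub> \<psi>) = free_lift U f \<phi> \<oplus>\<^bsub>U\<^esub> free_lift U f \<psi>" .
  next
    fix k \<phi> assume k: "k \<in> carrier R" and \<phi>: "\<phi> \<in> carrier (free_module R X)"
    have fT: "p \<in> ?S \<phi> \<Longrightarrow> f p \<in> carrier U" for p using c(3)[OF \<phi>] f by auto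
    have "free_lift U f (k \<odot>\<^bsub>free_module R X\<^esub> \<phi>)
        = (\<Oplus>\<^bsub>U\<^esub> p\<in>?S \<phi>. (k \<odot>\<^bsub>free_module R X\<^esub> \<phi>) p \<odot>\<^bsub>U\<^esub> f p)"
      using c[OF \<phi>] k by (intro eq F.smult_closed \<phi>) (auto simp: free_module_def)
    also have "\<dots> = (\<Oplus>\<^bsub>U\<^esub> p\<in>?S \<phi>. k \<odot>\<^bsub>U\<^esub> (\<phi> p \<odot>\<^bsub>U\<^esub> f p))"
      using c[OF \<phi>] fT k by (intro U.M.finsum_cong') (auto simp: free_module_def U.smult_assoc1)
    also have "\<dots> = k \<odot>\<^bsub>U\<^esub> free_lift U f \<phi>"
      unfolding free_lift_def
      using c[OF \<phi>] fT k by (intro U.finsum_smult_ldistr[symmetric]) auto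
    finally show "free_lift U f (k \<odot>\<^bsub>free_module R X\<^esub> \<phi>) = k \<odot>\<^bsub>U\<^esub> free_lift U f \<phi>" .
  qed
qed

lemma free_lift_gen:
  assumes "module R U" "f \<in> X \<rightarrow> carrier U" "x \<in> X"
  shows "free_lift U f (free_gen R x) = f x"
proof -
  interpret U: module R U by fact
  have "free_lift U f (free_gen R x) = (\<Oplus>\<^bsub>U\<^esub> p\<in>{x}. free_gen R x p \<odot>\<^bsub>U\<^esub> f p)"
    using assms by (intro free_lift_eq[OF assms(1,2)] free_gen_closed) (auto simp: free_gen_def)
  also have "\<dots> = f x"
  proof -
    have "f x \<in> carrier U" using assms by auto
    then show ?thesis by (subst U.M.finsum_insert) (auto simp: free_gen_def)
  qed
  finally show ?thesis .
qed

end

section \<open>Tensor products\<close>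

context cring begin

context
  fixes V :: "('a, 'v, 'm1) module_scheme" and W :: "('a, 'w, 'm2) module_scheme"
  assumes V: "module R V" and W: "module R W"
begin

interpretation V: module R V by (rule V)
interpretation W: module R W by (rule W)

private abbreviation (input) "FVW \<equiv> free_module R (carrier V \<times> carrier W)"
private abbreviation (input) "T \<equiv> tensor R V W"
private abbreviation (input) "tn \<equiv> tens R V W"

interpretation F: module R FVW by (rule free_module_module)

lemma tensor_rels_subset: "tensor_rels R V W \<subseteq> carrier FVW"
  unfolding tensor_rels_def Let_def
  by (auto intro!: F.M.minus_closed F.M.a_closed F.smult_closed free_gen_closed)

lemma tensor_null_submodule: "submodule (tensor_null R V W) R FVW"
  unfolding tensor_null_def by (rule F.lin_span_submodule[OF tensor_rels_subset])

lemma tensor_rels_null: "\<phi> \<in> tensor_rels R V W \<Longrightarrow> \<phi> \<in> tensor_null R V W"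
  unfolding tensor_null_def using F.lin_span_superset[OF tensor_rels_subset] by blast

lemma tensor_module: "module R T"
  unfolding tensor_def by (rule F.quot_module_module[OF tensor_null_submodule])

interpretation T: module R T by (rule tensor_module)

lemma tens_bilinear: "bilinear_map R V W T tn"
proof -
  note null = tensor_null_submodule
  note gen = free_gen_closed[of "(_, _)" "carrier V \<times> carrier W"]
  have add: "tensor_null R V W +>\<^bsub>FVW\<^esub> x = (tensor_null R V W +>\<^bsub>FVW\<^esub> y) \<oplus>\<^bsub>T\<^esub> (tensor_null R V W +>\<^bsub>FVW\<^esub> z)"
    if "x \<ominus>\<^bsub>FVW\<^esub> (y \<oplus>\<^bsub>FVW\<^esub> z) \<in> tensor_rels R V W" "x \<in> carrier FVW" "y \<in> carrier FVW" "z \<in> carrier FVW" for x y z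
    using that tensor_rels_null[OF that(1)]
    by (simp add: tensor_def F.quot_module_add[OF null] F.coset_eq_iff[OF null])
  have smult: "tensor_null R V W +>\<^bsub>FVW\<^esub> x = c \<odot>\<^bsub>T\<^esub> (tensor_null R V W +>\<^bsub>FVW\<^esub> y)"
    if "x \<ominus>\<^bsub>FVW\<^esub> (c \<odot>\<^bsub>FVW\<^esub> y) \<in> tensor_rels R V W" "x \<in> carrier FVW" "y \<in> carrier FVW" "c \<in> carrier R" for x y c
    using that tensor_rels_null[OF that(1)]
    by (simp add: tensor_def F.quot_module_smult[OF null] F.coset_eq_iff[OF null])
  have cl: "tn v w \<in> carrier T" if "v \<in> carrier V" "w \<in> carrier W" for v w
    using that gen by (auto simp: tens_def tensor_def F.quot_module_carrier[OF null])
  have a1: "tn (v \<oplus>\<^bsub>V\<^esub> v') w = tn v w \<oplus>\<^bsub>T\<^esub> tn v' w"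
    if "v \<in> carrier V" "v' \<in> carrier V" "w \<in> carrier W" for v v' w
    unfolding tens_def using that
    by (intro add) (auto intro!: gen simp: tensor_rels_def Let_def)
  have a2: "tn v (w \<oplus>\<^bsub>W\<^esub> w') = tn v w \<oplus>\<^bsub>T\<^esub> tn v w'"
    if "v \<in> carrier V" "w \<in> carrier W" "w' \<in> carrier W" for v w w'
    unfolding tens_def using that
    by (intro add) (auto intro!: gen simp: tensor_rels_def Let_def)
  have s1: "tn (c \<odot>\<^bsub>V\<^esub> v) w = c \<odot>\<^bsub>T\<^esub> tn v w"
    if "c \<in> carrier R" "v \<in> carrier V" "w \<in> carrier W" for c v w
    unfolding tens_def using that
    by (intro smult) (auto intro!: gen simp: tensor_rels_def Let_def)
  have s2: "tn v (c \<odot>\<^bsub>W\<^esub> w) = c \<odot>\<^bsub>T\<^esub> tn v w"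
    if "c \<in> carrier R" "v \<in> carrier V" "w \<in> carrier W" for c v w
    unfolding tens_def using that
    by (intro smult) (auto intro!: gen simp: tensor_rels_def Let_def)
  show ?thesis by (intro bilinear_mapI linear_mapI cl a1 a2 s1 s2)
qed

lemmas tens_closed = bilinear_map_closed[OF tens_bilinear]
lemmas tens_add_left = linear_map_add[OF bilinear_map_left[OF tens_bilinear]]
lemmas tens_smult_left = linear_map_smult[OF bilinear_map_left[OF tens_bilinear]]
lemmas tens_smult_right = linear_map_smult[OF bilinear_map_right[OF tens_bilinear]]

text \<open>Zero and scalar multiples are absorbed into the pure tensors, since
  \<open>0 = 0 \<otimes> 0\<close> and \<open>c (v \<otimes> w) = (c v) \<otimes> w\<close>; only
  sums remain as a closure step.\<close>

lemma tensor_induct [consumes 1, case_names tens add]: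
  assumes "X \<in> carrier T" "\<And>v w. \<lbrakk>v \<in> carrier V; w \<in> carrier W\<rbrakk> \<Longrightarrow> P (tn v w)"
    and "\<And>X Y. \<lbrakk>X \<in> carrier T; Y \<in> carrier T; P X; P Y\<rbrakk> \<Longrightarrow> P (X \<oplus>\<^bsub>T\<^esub> Y)"
  shows "P X"
proof -
  note null = tensor_null_submodule
  let ?N = "tensor_null R V W"
  obtain \<phi> where \<phi>: "\<phi> \<in> carrier FVW" "X = ?N +>\<^bsub>FVW\<^esub> \<phi>"
    using assms(1) by (auto simp: tensor_def F.quot_module_carrier[OF null])
  have pr: "linear_map R FVW T (\<lambda>x. ?N +>\<^bsub>FVW\<^esub> x)"
    unfolding tensor_def by (rule F.quot_module_proj_linear[OF null])
  have "P (?N +>\<^bsub>FVW\<^esub> \<phi>)" using \<phi>(1)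
  proof (induction \<phi> rule: free_module_induct)
    case zero
    have "tn \<zero>\<^bsub>V\<^esub> \<zero>\<^bsub>W\<^esub> = \<zero>\<^bsub>T\<^esub>"
      by (rule linear_map_zero[OF W tensor_module bilinear_map_right[OF tens_bilinear]]) simp
    then show ?case
      using assms(2)[of "\<zero>\<^bsub>V\<^esub>" "\<zero>\<^bsub>W\<^esub>"] linear_map_zero[OF F.module_axioms tensor_module pr] by simp
  next
    case (add \<psi> c x)
    obtain v w where x: "x = (v, w)" "v \<in> carrier V" "w \<in> carrier W" using add.hyps by auto
    have g: "free_gen R (v, w) \<in> carrier FVW" using x by (intro free_gen_closed) auto
    have "?N +>\<^bsub>FVW\<^esub> (\<psi> \<oplus>\<^bsub>FVW\<^esub> (c \<odot>\<^bsub>FVW\<^esub> free_gen R x))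
        = (?N +>\<^bsub>FVW\<^esub> \<psi>) \<oplus>\<^bsub>T\<^esub> tn (c \<odot>\<^bsub>V\<^esub> v) w"
      using add.hyps x g linear_map_add[OF pr] linear_map_smult[OF pr]
      by (simp add: tens_smult_left) (simp add: tens_def)
    moreover have "?N +>\<^bsub>FVW\<^esub> \<psi> \<in> carrier T" using linear_map_closed[OF pr] add.hyps by blast
    ultimately show ?case using add x tens_closed by (auto intro!: assms(2,3))
  qed
  then show ?thesis using \<phi> by simp
qed

lemma tens_zero_left: "w \<in> carrier W \<Longrightarrow> tn \<zero>\<^bsub>V\<^esub> w = \<zero>\<^bsub>T\<^esub>"
  by (rule linear_map_zero[OF V tensor_module bilinear_map_left[OF tens_bilinear]])

lemma tens_zero_right: "v \<in> carrier V \<Longrightarrow> tn v \<zero>\<^bsub>W\<^esub> = \<zero>\<^bsub>T\<^esub>"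
  by (rule linear_map_zero[OF W tensor_module bilinear_map_right[OF tens_bilinear]])

text \<open>Calculi are generated by, and covariance is tested on, families indexed by an initial
  segment of the naturals; this passes from a tensor to such a family.\<close>

lemma tensor_sum_of_tens:
  assumes "X \<in> carrier T"
  obtains n :: nat and v w where "v \<in> {..<n} \<rightarrow> carrier V" "w \<in> {..<n} \<rightarrow> carrier W"
    "X = (\<Oplus>\<^bsub>T\<^esub> k\<in>{..<n}. tn (v k) (w k))"
proof -
  have "\<exists>(n::nat) v w. v \<in> {..<n} \<rightarrow> carrier V \<and> w \<in> {..<n} \<rightarrow> carrier W
      \<and> X = (\<Oplus>\<^bsub>T\<^esub> k\<in>{..<n}. tn (v k) (w k))"
    using assms
  proof (induction X rule: tensor_induct)
    case (tens v w)
    then have "tn v w = (\<Oplus>\<^bsub>T\<^esub> k\<in>{..<Suc 0}. tn v w)"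
      using tens_closed by (simp add: lessThan_Suc)
    then show ?case using tens
      by (intro exI[of _ "Suc 0"] exI[of _ "\<lambda>_. v"] exI[of _ "\<lambda>_. w"]) auto
  next
    case (add X Y)
    then obtain n m v w v' w' where
      1: "v \<in> {..<n::nat} \<rightarrow> carrier V" "w \<in> {..<n} \<rightarrow> carrier W" "X = (\<Oplus>\<^bsub>T\<^esub> k\<in>{..<n}. tn (v k) (w k))" and
      2: "v' \<in> {..<m::nat} \<rightarrow> carrier V" "w' \<in> {..<m} \<rightarrow> carrier W" "Y = (\<Oplus>\<^bsub>T\<^esub> k\<in>{..<m}. tn (v' k) (w' k))"
      by blast
    \<comment> \<open>Concatenation of the two families, the second one shifted by
      \<open>n\<close>.\<close>
    let ?v = "\<lambda>k. if k < n then v k else v' (k - n)" and ?w = "\<lambda>k. if k < n then w k else w' (k - n)"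
    have vw: "?v \<in> {..<n+m} \<rightarrow> carrier V" "?w \<in> {..<n+m} \<rightarrow> carrier W"
      using 1(1,2) 2(1,2) by (auto simp: Pi_def)
    have sp: "{..<n+m} = {..<n} \<union> (\<lambda>k. k + n) ` {..<m}"
    proof (rule Set.set_eqI)
      fix k show "k \<in> {..<n+m} \<longleftrightarrow> k \<in> {..<n} \<union> (\<lambda>k. k + n) ` {..<m}"
        by (cases "k < n") (auto intro!: image_eqI[of k _ "k - n"])
    qed
    have cl: "tn (?v k) (?w k) \<in> carrier T" if "k \<in> {..<n+m}" for k
      using vw that by (intro tens_closed) (auto simp: Pi_def)
    have "(\<Oplus>\<^bsub>T\<^esub> k\<in>{..<n+m}. tn (?v k) (?w k))
        = (\<Oplus>\<^bsub>T\<^esub> k\<in>{..<n}. tn (?v k) (?w k)) \<oplus>\<^bsub>T\<^esub> (\<Oplus>\<^bsub>T\<^esub> k\<in>(\<lambda>k. k + n) ` {..<m}. tn (?v k) (?w k))"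
      unfolding sp using cl unfolding sp by (intro T.M.finsum_Un_disjoint) auto
    also have "(\<Oplus>\<^bsub>T\<^esub> k\<in>{..<n}. tn (?v k) (?w k)) = X"
      unfolding 1(3) using 1(1,2) by (intro T.M.finsum_cong') (auto intro!: tens_closed)
    also have "(\<Oplus>\<^bsub>T\<^esub> k\<in>(\<lambda>k. k + n) ` {..<m}. tn (?v k) (?w k))
        = (\<Oplus>\<^bsub>T\<^esub> k\<in>{..<m}. tn (?v (k + n)) (?w (k + n)))"
      using cl unfolding sp by (intro T.M.finsum_reindex) (auto simp: inj_on_def)
    also have "\<dots> = Y"
      unfolding 2(3) using 2(1,2) by (intro T.M.finsum_cong') (auto intro!: tens_closed)
    finally have "X \<oplus>\<^bsub>T\<^esub> Y = (\<Oplus>\<^bsub>T\<^esub> k\<in>{..<n+m}. tn (?v k) (?w k))" by simp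
    with vw show ?case by blast
  qed
  then show ?thesis using that by blast
qed

text \<open>The standard way to prove identities of tensor expressions below: view both sides as
  linear in one tensor and compare them on pure tensors.\<close>

lemma tensor_linear_ext:
  assumes "linear_map R T U f" "linear_map R T U g" "X \<in> carrier T"
    and "\<And>v w. \<lbrakk>v \<in> carrier V; w \<in> carrier W\<rbrakk> \<Longrightarrow> f (tn v w) = g (tn v w)"
  shows "f X = g X"
  using assms(3)
  by (induction X rule: tensor_induct)
    (auto simp: assms(4) linear_map_add[OF assms(1)] linear_map_add[OF assms(2)])

section \<open>The universal property\<close>

context
  fixes U :: "('a, 'u, 'm3) module_scheme" and f
  assumes U: "module R U" and f: "bilinear_map R V W U f"
begin

interpretation U: module R U by (rule U)

text \<open>The free extension of a bilinear map kills the defining relations, hence their span, and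
  is constant on cosets. The representative chosen by \<open>SOME\<close> may thus be replaced by
  any other.\<close>

lemma tensor_lift_free_lift:
  assumes "\<phi> \<in> carrier FVW"
  shows "tensor_lift R U f (tensor_null R V W +>\<^bsub>FVW\<^esub> \<phi>) = free_lift U (\<lambda>p. f (fst p) (snd p)) \<phi>"
proof -
  note null = tensor_null_submodule
  let ?N = "tensor_null R V W" and ?f = "\<lambda>p. f (fst p) (snd p)"
  interpret N: abelian_subgroup ?N FVW by (rule F.submodule_abelian_subgroup[OF null])
  have f': "?f \<in> carrier V \<times> carrier W \<rightarrow> carrier U"
    using bilinear_map_closed[OF f] by auto
  note lin = free_lift_linear[OF U f'] and gen = free_lift_gen[OF U f']
  have g: "free_gen R (v, w) \<in> carrier FVW" if "v \<in> carrier V" "w \<in> carrier W" for v w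
    using that by (intro free_gen_closed) auto
  have "tensor_rels R V W \<subseteq> {\<phi> \<in> carrier FVW. free_lift U ?f \<phi> = \<zero>\<^bsub>U\<^esub>}"
  proof
    fix \<psi> assume r: "\<psi> \<in> tensor_rels R V W"
    have "free_lift U ?f \<psi> = \<zero>\<^bsub>U\<^esub>"
      using r unfolding tensor_rels_def Let_def
      by (auto simp: linear_map_diff[OF F.module_axioms U lin] linear_map_add[OF lin]
          linear_map_smult[OF lin] gen g linear_map_add[OF bilinear_map_left[OF f]]
          linear_map_add[OF bilinear_map_right[OF f]] linear_map_smult[OF bilinear_map_left[OF f]]
          linear_map_smult[OF bilinear_map_right[OF f]] bilinear_map_closed[OF f] U.M.minus_eq_zero_iff)
    then show "\<psi> \<in> {\<phi> \<in> carrier FVW. free_lift U ?f \<phi> = \<zero>\<^bsub>U\<^esub>}"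
      using r tensor_rels_subset by auto
  qed
  then have ker: "?N \<subseteq> {\<phi> \<in> carrier FVW. free_lift U ?f \<phi> = \<zero>\<^bsub>U\<^esub>}"
    unfolding tensor_null_def
    by (rule lin_span_least[OF linear_map_kernel[OF F.module_axioms U lin]])
  have eq: "free_lift U ?f \<psi> = free_lift U ?f \<phi>" if \<psi>: "\<psi> \<in> ?N +>\<^bsub>FVW\<^esub> \<phi>" for \<psi>
  proof -
    obtain n where n: "n \<in> ?N" "\<psi> = n \<oplus>\<^bsub>FVW\<^esub> \<phi>" using \<psi> by (auto simp: a_r_coset_def')
    show ?thesis
      using n ker assms linear_map_add[OF lin, of n \<phi>] linear_map_closed[OF lin] by auto
  qed
  have "(SOME \<psi>. \<psi> \<in> ?N +>\<^bsub>FVW\<^esub> \<phi>) \<in> ?N +>\<^bsub>FVW\<^esub> \<phi>"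
    unfolding some_in_eq using N.a_rcos_self[OF assms] by blast
  from eq[OF this] show ?thesis by (simp add: tensor_lift_def free_lift_def Let_def)
qed

lemma tensor_lift_tens:
  assumes "v \<in> carrier V" "w \<in> carrier W"
  shows "tensor_lift R U f (tn v w) = f v w"
proof -
  have "(\<lambda>p. f (fst p) (snd p)) \<in> carrier V \<times> carrier W \<rightarrow> carrier U"
    using bilinear_map_closed[OF f] by auto
  then show ?thesis
    unfolding tens_def using assms
    by (subst tensor_lift_free_lift) (auto intro!: free_gen_closed simp: free_lift_gen[OF U])
qed

lemma tensor_lift_linear: "linear_map R T U (tensor_lift R U f)"
proof -
  note null = tensor_null_submodule
  have "(\<lambda>p. f (fst p) (snd p)) \<in> carrier V \<times> carrier W \<rightarrow> carrier U"
    using bilinear_map_closed[OF f] by auto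
  note lin = free_lift_linear[OF U this]
  show ?thesis
    unfolding tensor_def
    by (rule linear_mapI)
      (auto simp: F.quot_module_carrier[OF null] F.quot_module_add[OF null]
        F.quot_module_smult[OF null] tensor_lift_free_lift linear_map_add[OF lin]
        linear_map_smult[OF lin] linear_map_closed[OF lin])
qed

end

text \<open>Linearity in a parameter holds at pure tensors and is inherited by sums. It is what
  makes a lift nested inside another lift a legitimate multilinear integrand.\<close>

lemma tensor_lift_param:
  assumes "module R Z" "module R U" "\<And>z. z \<in> carrier Z \<Longrightarrow> bilinear_map R V W U (f z)"
    and "\<And>v w. \<lbrakk>v \<in> carrier V; w \<in> carrier W\<rbrakk> \<Longrightarrow> linear_map R Z U (\<lambda>z. f z v w)"
    and "X \<in> carrier T"
  shows "linear_map R Z U (\<lambda>z. tensor_lift R U (f z) X)"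
  using assms(5)
proof (induction X rule: tensor_induct)
  case (tens v w)
  show ?case
    by (rule linear_map_cong[OF assms(1) assms(4)[OF tens]])
      (simp add: tensor_lift_tens[OF assms(2,3)] tens)
next
  case (add X Y)
  show ?case
    by (rule linear_map_cong[OF assms(1) linear_map_plus[OF assms(2) add.IH]])
      (simp add: linear_map_add[OF tensor_lift_linear[OF assms(2,3)]] add.hyps)
qed

end

end

section \<open>Trilinear maps and associativity\<close>

context cring begin

text \<open>A trilinear map is encoded as bilinear in the last two arguments and linear in the
  first. Absorbing two adjacent arguments into a tensor leaves a bilinear map; this rule and
  \<open>tensor_lift_right3\<close> treat the two bracketings.\<close>

lemma tensor_lift_left3:
  assumes "module R U" "module R V" "module R W" "module R Z"
    and "\<And>u. u \<in> carrier U \<Longrightarrow> bilinear_map R V W Z (F u)"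
    and "\<And>v w. \<lbrakk>v \<in> carrier V; w \<in> carrier W\<rbrakk> \<Longrightarrow> linear_map R U Z (\<lambda>u. F u v w)"
  shows "bilinear_map R (tensor R U V) W Z (\<lambda>X w. tensor_lift R Z (\<lambda>u v. F u v w) X)"
proof (rule bilinear_mapI)
  have bil: "bilinear_map R U V Z (\<lambda>u v. F u v w)" if "w \<in> carrier W" for w
    using assms(6) that by (intro bilinear_mapI bilinear_map_left[OF assms(5)]) auto
  show "linear_map R (tensor R U V) Z (\<lambda>X. tensor_lift R Z (\<lambda>u v. F u v w) X)"
    if "w \<in> carrier W" for w
    by (rule tensor_lift_linear[OF assms(1,2,4) bil[OF that]])
  show "linear_map R W Z (\<lambda>w. tensor_lift R Z (\<lambda>u v. F u v w) X)"
    if "X \<in> carrier (tensor R U V)" for X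
    by (rule tensor_lift_param[OF assms(1,2,3,4) bil _ that]) (auto intro: bilinear_map_right[OF assms(5)])
qed

lemma tensor_lift_right3:
  assumes "module R U" "module R V" "module R W" "module R Z"
    and "\<And>u. u \<in> carrier U \<Longrightarrow> bilinear_map R V W Z (F u)"
    and "\<And>v w. \<lbrakk>v \<in> carrier V; w \<in> carrier W\<rbrakk> \<Longrightarrow> linear_map R U Z (\<lambda>u. F u v w)"
  shows "bilinear_map R U (tensor R V W) Z (\<lambda>u. tensor_lift R Z (F u))"
  using tensor_lift_linear[OF assms(2,3,4) assms(5)]
    tensor_lift_param[OF assms(2,3,1,4) assms(5,6)]
  by (intro bilinear_mapI) auto

lemma tens_trilinear:
  assumes "module R U" "module R V" "module R W"
  shows "u \<in> carrier U \<Longrightarrow> bilinear_map R V W (tensor R U (tensor R V W)) (\<lambda>v w. tens R U (tensor R V W) u (tens R V W v w))"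
    and "\<lbrakk>v \<in> carrier V; w \<in> carrier W\<rbrakk>
      \<Longrightarrow> linear_map R U (tensor R U (tensor R V W)) (\<lambda>u. tens R U (tensor R V W) u (tens R V W v w))"
  by (intro linear_bilinear_map_comp[OF bilinear_map_right[OF tens_bilinear] tens_bilinear]
      bilinear_map_left[OF tens_bilinear] tensor_module tens_closed assms; assumption)+

lemma tensor_assoc_linear:
  assumes "module R U" "module R V" "module R W"
  shows "linear_map R (tensor R (tensor R U V) W) (tensor R U (tensor R V W)) (tensor_assoc R U V W)"
  unfolding tensor_assoc_def Let_def
  by (intro tensor_lift_linear tensor_lift_left3 tens_trilinear tensor_module assms)

lemma tensor_assoc_tens:
  assumes "module R U" "module R V" "module R W"
    and "u \<in> carrier U" "v \<in> carrier V" "w \<in> carrier W"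
  shows "tensor_assoc R U V W (tens R (tensor R U V) W (tens R U V u v) w)
    = tens R U (tensor R V W) u (tens R V W v w)"
proof -
  let ?T = "tensor R U (tensor R V W)"
  note tri = tens_trilinear[OF assms(1-3)]
  have "bilinear_map R U V ?T (\<lambda>u v. tens R U (tensor R V W) u (tens R V W v w))"
    using assms(6) by (intro bilinear_mapI bilinear_map_left[OF tri(1)] tri(2))
  then show ?thesis
    unfolding tensor_assoc_def Let_def
    using tensor_lift_tens[OF tensor_module[OF assms(1,2)] assms(3)
        tensor_module[OF assms(1) tensor_module[OF assms(2,3)]] tensor_lift_left3[OF assms(1-3) _ tri]]
      tensor_lift_tens[OF assms(1,2) tensor_module[OF assms(1) tensor_module[OF assms(2,3)]]]
    by (simp add: assms tens_closed tensor_module)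
qed

text \<open>Evaluating a trilinear map on a triple tensor is independent of the bracketing: both
  sides are linear in \<open>X\<close>, and two reductions to pure tensors leave
  \<open>F u v w\<close> on each. Together with the coassociativity axiom this replaces the
  three-leg notation.\<close>

lemma tensor_lift_assoc:
  assumes "module R U" "module R V" "module R W" "module R Z"
    and "\<And>u. u \<in> carrier U \<Longrightarrow> bilinear_map R V W Z (F u)"
    and "\<And>v w. \<lbrakk>v \<in> carrier V; w \<in> carrier W\<rbrakk> \<Longrightarrow> linear_map R U Z (\<lambda>u. F u v w)"
    and "X \<in> carrier (tensor R (tensor R U V) W)"
  shows "tensor_lift R Z (\<lambda>u. tensor_lift R Z (F u)) (tensor_assoc R U V W X)
    = tensor_lift R Z (\<lambda>X w. tensor_lift R Z (\<lambda>u v. F u v w) X) X"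
proof -
  let ?UV = "tensor R U V" and ?VW = "tensor R V W"
  let ?l = "\<lambda>X. tensor_lift R Z (\<lambda>u. tensor_lift R Z (F u)) (tensor_assoc R U V W X)"
  let ?r = "tensor_lift R Z (\<lambda>X w. tensor_lift R Z (\<lambda>u v. F u v w) X)"
  note UV = tensor_module[OF assms(1,2)] and VW = tensor_module[OF assms(2,3)]
  note l3 = tensor_lift_left3[OF assms(1-6)] and r3 = tensor_lift_right3[OF assms(1-6)]
  have bil: "bilinear_map R U V Z (\<lambda>u v. F u v w)" if "w \<in> carrier W" for w
    using assms(6) that by (intro bilinear_mapI bilinear_map_left[OF assms(5)]) auto
  have l: "linear_map R (tensor R ?UV W) Z ?l"
    by (intro linear_map_comp[OF tensor_lift_linear tensor_assoc_linear] assms(1-4) VW r3)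
  have r: "linear_map R (tensor R ?UV W) Z ?r"
    by (intro tensor_lift_linear assms(1-4) UV l3)
  show ?thesis
  proof (rule tensor_linear_ext[OF UV assms(3) l r assms(7)])
    fix x w assume x: "x \<in> carrier ?UV" and w: "w \<in> carrier W"
    have t: "linear_map R ?UV (tensor R ?UV W) (\<lambda>x. tens R ?UV W x w)"
      by (rule bilinear_map_left[OF tens_bilinear[OF UV assms(3)] w])
    show "?l (tens R ?UV W x w) = ?r (tens R ?UV W x w)"
    proof (rule tensor_linear_ext[OF assms(1,2) linear_map_comp[OF l t] linear_map_comp[OF r t] x])
      fix u v assume "u \<in> carrier U" "v \<in> carrier V"
      then show "?l (tens R ?UV W (tens R U V u v) w) = ?r (tens R ?UV W (tens R U V u v) w)"
        using w by (simp add: tensor_assoc_tens assms(1-4) tens_closed tensor_lift_tens[OF assms(1) VW assms(4) r3]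
            tensor_lift_tens[OF UV assms(3,4) l3] tensor_lift_tens[OF assms(1,2,4) bil]
            tensor_lift_tens[OF assms(2,3,4) assms(5)])
    qed
  qed
qed

section \<open>Functoriality of the tensor product\<close>

context
  fixes V :: "('a, 'v, 'm1) module_scheme" and W :: "('a, 'w, 'm2) module_scheme"
    and V' :: "('a, 'v2, 'm3) module_scheme" and W' :: "('a, 'w2, 'm4) module_scheme" and f g
  assumes V: "module R V" and W: "module R W" and V': "module R V'" and W': "module R W'"
    and f: "linear_map R V V' f" and g: "linear_map R W W' g"
begin

lemma tensor_map_linear: "linear_map R (tensor R V W) (tensor R V' W') (tensor_map R V' W' f g)"
  unfolding tensor_map_def
  by (intro tensor_lift_linear bilinear_map_comp[OF tens_bilinear f g] tensor_module V W V' W')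

lemma tensor_map_tens:
  "\<lbrakk>v \<in> carrier V; w \<in> carrier W\<rbrakk>
    \<Longrightarrow> tensor_map R V' W' f g (tens R V W v w) = tens R V' W' (f v) (g w)"
  unfolding tensor_map_def
  by (intro tensor_lift_tens bilinear_map_comp[OF tens_bilinear f g] tensor_module V W V' W')

lemma tensor_lift_tensor_map:
  assumes Z: "module R Z" and h: "bilinear_map R V' W' Z h" and X: "X \<in> carrier (tensor R V W)"
  shows "tensor_lift R Z h (tensor_map R V' W' f g X) = tensor_lift R Z (\<lambda>v w. h (f v) (g w)) X"
proof (rule tensor_linear_ext[OF V W _ _ X])
  show "linear_map R (tensor R V W) Z (\<lambda>X. tensor_lift R Z h (tensor_map R V' W' f g X))"
    by (rule linear_map_comp[OF tensor_lift_linear[OF V' W' Z h] tensor_map_linear])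
  show "linear_map R (tensor R V W) Z (tensor_lift R Z (\<lambda>v w. h (f v) (g w)))"
    by (rule tensor_lift_linear[OF V W Z bilinear_map_comp[OF h f g]])
qed (simp add: tensor_map_tens tensor_lift_tens[OF V' W' Z h] linear_map_closed[OF f]
    linear_map_closed[OF g] tensor_lift_tens[OF V W Z bilinear_map_comp[OF h f g]])

end

text \<open>The integrands agree on the carriers only; bilinearity of both reduces the comparison to
  pure tensors, where this is enough.\<close>

lemma tensor_lift_cong:
  assumes "module R V" "module R W" "module R Z" "bilinear_map R V W Z f" "bilinear_map R V W Z g"
    and "\<And>v w. \<lbrakk>v \<in> carrier V; w \<in> carrier W\<rbrakk> \<Longrightarrow> f v w = g v w" "X \<in> carrier (tensor R V W)"
  shows "tensor_lift R Z f X = tensor_lift R Z g X"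
  by (rule tensor_linear_ext[OF assms(1,2) tensor_lift_linear[OF assms(1-4)]
        tensor_lift_linear[OF assms(1-3,5)] assms(7)])
    (simp add: tensor_lift_tens[OF assms(1-4)] tensor_lift_tens[OF assms(1-3,5)] assms(6))

lemma linear_tensor_lift:
  assumes "module R V" "module R W" "module R Z" "module R Z'" "bilinear_map R V W Z f"
    and "linear_map R Z Z' h" "X \<in> carrier (tensor R V W)"
  shows "h (tensor_lift R Z f X) = tensor_lift R Z' (\<lambda>v w. h (f v w)) X"
  by (rule tensor_linear_ext[OF assms(1,2) linear_map_comp[OF assms(6) tensor_lift_linear[OF assms(1-3,5)]]
        tensor_lift_linear[OF assms(1,2,4) linear_bilinear_map_comp[OF assms(6,5)]] assms(7)])
    (simp add: tensor_lift_tens[OF assms(1-3,5)]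
      tensor_lift_tens[OF assms(1,2,4) linear_bilinear_map_comp[OF assms(6,5)]])

context
  fixes V :: "('a, 'v, 'm1) module_scheme" and W :: "('a, 'w, 'm2) module_scheme"
    and V' :: "('a, 'v2, 'm3) module_scheme" and W' :: "('a, 'w2, 'm4) module_scheme"
    and Z :: "('a, 'z, 'm5) module_scheme" and F
  assumes V: "module R V" and W: "module R W" and V': "module R V'" and W': "module R W'"
    and Z: "module R Z"
    and F1: "\<And>v w. \<lbrakk>v \<in> carrier V; w \<in> carrier W\<rbrakk> \<Longrightarrow> bilinear_map R V' W' Z (F v w)"
    and F2: "\<And>v w. \<lbrakk>v \<in> carrier V'; w \<in> carrier W'\<rbrakk> \<Longrightarrow> bilinear_map R V W Z (\<lambda>a b. F a b v w)"
begin

private lemma inner_bilinear: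
  assumes "Y \<in> carrier (tensor R V' W')"
  shows "bilinear_map R V W Z (\<lambda>a b. tensor_lift R Z (F a b) Y)"
  by (intro bilinear_mapI tensor_lift_param[OF V' W' _ Z F1 _ assms] V W
      bilinear_map_left[OF F2] bilinear_map_right[OF F2])

text \<open>Common source of the product on \<open>B \<otimes> C\<close> and of its action on
  \<open>M \<otimes> C\<close>: both come from an expression in four arguments that is bilinear in
  each pair.\<close>

lemma tensor_lift2_bilinear:
  "bilinear_map R (tensor R V W) (tensor R V' W') Z
    (\<lambda>X Y. tensor_lift R Z (\<lambda>a b. tensor_lift R Z (F a b) Y) X)"
  by (intro bilinear_mapI tensor_lift_linear inner_bilinear V W Z
      tensor_lift_param[OF V W tensor_module[OF V' W'] Z inner_bilinear] F1 V' W')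

lemma tensor_lift2_tens:
  "\<lbrakk>a \<in> carrier V; b \<in> carrier W; a' \<in> carrier V'; b' \<in> carrier W'\<rbrakk>
    \<Longrightarrow> tensor_lift R Z (\<lambda>a b. tensor_lift R Z (F a b) (tens R V' W' a' b')) (tens R V W a b)
      = F a b a' b'"
  by (simp add: tensor_lift_tens[OF V W Z inner_bilinear] tensor_lift_tens[OF V' W' Z F1]
      tens_closed[OF V' W'])

end

lemma tensor_bilinear_ext:
  assumes "module R V" "module R W" "module R V'" "module R W'"
    and "bilinear_map R (tensor R V W) (tensor R V' W') Z f"
    and "bilinear_map R (tensor R V W) (tensor R V' W') Z g"
    and "\<And>v w v' w'. \<lbrakk>v \<in> carrier V; w \<in> carrier W; v' \<in> carrier V'; w' \<in> carrier W'\<rbrakk>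
      \<Longrightarrow> f (tens R V W v w) (tens R V' W' v' w') = g (tens R V W v w) (tens R V' W' v' w')"
    and "X \<in> carrier (tensor R V W)" "Y \<in> carrier (tensor R V' W')"
  shows "f X Y = g X Y"
proof (rule tensor_linear_ext[OF assms(1,2) bilinear_map_left[OF assms(5,9)]
      bilinear_map_left[OF assms(6,9)] assms(8)])
  fix v w assume vw: "v \<in> carrier V" "w \<in> carrier W"
  note c = tens_closed[OF assms(1,2) vw]
  show "f (tens R V W v w) Y = g (tens R V W v w) Y"
    by (rule tensor_linear_ext[OF assms(3,4) bilinear_map_right[OF assms(5) c]
          bilinear_map_right[OF assms(6) c] assms(9) assms(7)[OF vw]])
qed

section \<open>Subspaces \<open>S \<otimes> W\<close> of a tensor product\<close>

lemma tensor_sub_submodule: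
  assumes "module R V" "module R W" "S \<subseteq> carrier V"
  shows "submodule (tensor_sub R V W S) R (tensor R V W)"
    and "\<lbrakk>x \<in> S; w \<in> carrier W\<rbrakk> \<Longrightarrow> tens R V W x w \<in> tensor_sub R V W S"
proof -
  interpret T: module R "tensor R V W" by (intro tensor_module assms)
  have s: "{tens R V W x w |x w. x \<in> S \<and> w \<in> carrier W} \<subseteq> carrier (tensor R V W)"
    using assms by (auto intro!: tens_closed)
  show "submodule (tensor_sub R V W S) R (tensor R V W)"
    unfolding tensor_sub_def by (rule T.lin_span_submodule[OF s])
  show "\<lbrakk>x \<in> S; w \<in> carrier W\<rbrakk> \<Longrightarrow> tens R V W x w \<in> tensor_sub R V W S"
    unfolding tensor_sub_def using T.lin_span_superset[OF s] by blast
qed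

lemma submodule_vimage:
  assumes "module R V" "module R W" "linear_map R V W h" "submodule N R W"
  shows "submodule {x \<in> carrier V. h x \<in> N} R V"
proof -
  interpret V: module R V by fact
  interpret W: module R W by fact
  have "\<zero>\<^bsub>W\<^esub> \<in> N" using subgroup.one_closed[OF submodule.axioms(1)[OF assms(4)]] by simp
  then show ?thesis
    using W.submoduleE[OF assms(4)]
    by (intro V.submoduleI) (auto simp: linear_map_zero[OF assms(1-3)] linear_map_uminus[OF assms(1-3)]
        linear_map_add[OF assms(3)] linear_map_smult[OF assms(3)])
qed

text \<open>The preimage of a submodule is a submodule, so it contains a span as soon as it contains
  the generators. This acts as the induction principle for \<open>tensor_sub\<close>.\<close>

lemma linear_map_tensor_sub:
  assumes "module R V" "module R W" "module R Z" "S \<subseteq> carrier V"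
    and "linear_map R (tensor R V W) Z h" "submodule N R Z"
    and "\<And>x w. \<lbrakk>x \<in> S; w \<in> carrier W\<rbrakk> \<Longrightarrow> h (tens R V W x w) \<in> N"
    and "X \<in> tensor_sub R V W S"
  shows "h X \<in> N"
proof -
  have "tensor_sub R V W S \<subseteq> {x \<in> carrier (tensor R V W). h x \<in> N}"
    unfolding tensor_sub_def
    using assms(1-4,7) by (intro lin_span_least submodule_vimage[OF _ _ assms(5,6)])
      (auto intro!: tens_closed tensor_module)
  then show ?thesis using assms(8) by auto
qed

lemma zero_submodule: "module R V \<Longrightarrow> submodule {\<zero>\<^bsub>V\<^esub>} R V"
proof -
  assume "module R V"
  then interpret V: module R V .
  show ?thesis by (rule V.submoduleI) auto
qed

lemma tensor_map_in_tensor_sub: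
  assumes "module R V" "module R W" "module R V'" "linear_map R V V' f"
    and "S \<subseteq> carrier V'" "\<And>v. v \<in> S' \<Longrightarrow> f v \<in> S" "S' \<subseteq> carrier V" "X \<in> tensor_sub R V W S'"
  shows "tensor_map R V' W f (\<lambda>y. y) X \<in> tensor_sub R V' W S"
proof (rule linear_map_tensor_sub[OF assms(1,2) tensor_module[OF assms(3,2)] assms(7)
      tensor_map_linear[OF assms(1,2,3,2,4) linear_map_ident]
      tensor_sub_submodule(1)[OF assms(3,2,5)] _ assms(8)])
  fix x w assume "x \<in> S'" "w \<in> carrier W"
  then show "tensor_map R V' W f (\<lambda>y. y) (tens R V W x w) \<in> tensor_sub R V' W S"
    using assms(6,7) tensor_map_tens[OF assms(1,2,3,2,4) linear_map_ident, of x w]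
      tensor_sub_submodule(2)[OF assms(3,2,5)] by auto
qed

text \<open>Makes the rules for \<open>tensor_sub\<close> applicable to an arbitrary tensor.\<close>

lemma tensor_sub_carrier:
  assumes "module R V" "module R W" "X \<in> carrier (tensor R V W)"
  shows "X \<in> tensor_sub R V W (carrier V)"
proof -
  interpret T: module R "tensor R V W" by (intro tensor_module assms)
  show ?thesis
    by (rule tensor_induct[OF assms])
      (auto intro: tensor_sub_submodule(2)[OF assms(1,2)] T.submoduleE(5)[OF tensor_sub_submodule(1)[OF assms(1,2)]])
qed

end

section \<open>Kernels and pure tensors over a field\<close>

context field begin

text \<open>With \<open>f s f = f\<close>, the identity of \<open>V\<close> is the sum of
  \<open>p = id - s f\<close> and \<open>s f\<close>. After tensoring with \<open>W\<close>, the
  second summand kills \<open>X\<close> because \<open>f \<otimes> id\<close> does, and the first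
  maps into \<open>ker f \<otimes> W\<close>.\<close>

lemma tensor_map_kernel:
  assumes "module R V" "module R W" "module R V'" "linear_map R V V' f"
    and "X \<in> carrier (tensor R V W)" "tensor_map R V' W f (\<lambda>y. y) X = \<zero>\<^bsub>tensor R V' W\<^esub>"
  shows "X \<in> tensor_sub R V W {v \<in> carrier V. f v = \<zero>\<^bsub>V'\<^esub>}"
proof -
  interpret V: module R V by fact
  interpret V': module R V' by fact
  obtain s where s: "linear_map R V' V s" "\<And>x. x \<in> carrier V \<Longrightarrow> f (s (f x)) = f x"
    using linear_generalized_inverse[OF assms(1,3,4)] by blast
  interpret T: module R "tensor R V W" by (intro tensor_module assms)
  let ?id = "\<lambda>y::'e. y" and ?p = "\<lambda>v. v \<ominus>\<^bsub>V\<^esub> s (f v)"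
  have sf: "linear_map R V V (\<lambda>v. s (f v))" by (rule linear_map_comp[OF s(1) assms(4)])
  have p: "linear_map R V V ?p" by (intro linear_map_minus assms linear_map_ident sf)
  note tl = tensor_map_linear[OF assms(1,2) _ assms(2) _ linear_map_ident]
  have "X = tensor_map R V W ?p ?id X \<oplus>\<^bsub>tensor R V W\<^esub> tensor_map R V W s ?id (tensor_map R V' W f ?id X)"
  proof (rule tensor_linear_ext[OF assms(1,2) linear_map_ident _ assms(5)])
    show "linear_map R (tensor R V W) (tensor R V W) (\<lambda>X. tensor_map R V W ?p ?id X
        \<oplus>\<^bsub>tensor R V W\<^esub> tensor_map R V W s ?id (tensor_map R V' W f ?id X))"
      by (intro linear_map_plus linear_map_comp[OF tensor_map_linear[OF assms(3,2,1,2) s(1) linear_map_ident]]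
          tl tensor_module assms p)
  next
    fix v w assume vw: "v \<in> carrier V" "w \<in> carrier W"
    have c: "f v \<in> carrier V'" "s (f v) \<in> carrier V"
      using linear_map_closed[OF assms(4) vw(1)] linear_map_closed[OF sf vw(1)] by auto
    have "tens R V W (?p v) w \<oplus>\<^bsub>tensor R V W\<^esub> tens R V W (s (f v)) w = tens R V W v w"
    proof -
      have "?p v \<oplus>\<^bsub>V\<^esub> s (f v) = v" using vw c by (simp add: a_minus_def V.M.a_assoc V.M.l_neg)
      then show ?thesis using tens_add_left[OF assms(1,2) vw(2), of "?p v" "s (f v)"] vw c by simp
    qed
    then show "tens R V W v w = tensor_map R V W ?p ?id (tens R V W v w)
        \<oplus>\<^bsub>tensor R V W\<^esub> tensor_map R V W s ?id (tensor_map R V' W f ?id (tens R V W v w))"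
      using vw c by (simp add: tensor_map_tens[OF assms(1,2) _ assms(2) _ linear_map_ident] assms p
          tensor_map_tens[OF assms(3,2) _ assms(2) _ linear_map_ident] s(1))
  qed
  also have "tensor_map R V W s ?id (tensor_map R V' W f ?id X) = \<zero>\<^bsub>tensor R V W\<^esub>"
    unfolding assms(6)
    by (intro linear_map_zero[OF _ _ tensor_map_linear[OF assms(3,2,1,2) s(1) linear_map_ident]]
        tensor_module assms)
  finally have "X = tensor_map R V W ?p ?id X"
    using linear_map_closed[OF tl[OF assms(1) p] assms(5)] by simp
  also have "\<dots> \<in> tensor_sub R V W {v \<in> carrier V. f v = \<zero>\<^bsub>V'\<^esub>}"
  proof (rule tensor_map_in_tensor_sub[OF assms(1,2,1) p _ _ subset_refl tensor_sub_carrier[OF assms(1,2,5)]])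
    fix v assume v: "v \<in> carrier V"
    then have "f (?p v) = \<zero>\<^bsub>V'\<^esub>"
      using linear_map_diff[OF assms(1,3,4) v, of "s (f v)"] linear_map_closed[OF sf v] s(2)[OF v]
        linear_map_closed[OF assms(4) v] by (simp add: V'.M.minus_eq_zero_iff)
    then show "?p v \<in> {v \<in> carrier V. f v = \<zero>\<^bsub>V'\<^esub>}" using linear_map_closed[OF p v] by simp
  qed auto
  finally show ?thesis .
qed

text \<open>A functional \<open>s\<close> with \<open>s w \<noteq> 0\<close> turns the bilinear map
  \<open>s w \<odot> v\<close> into a linear map on the tensor product that recovers a nonzero
  multiple of \<open>v\<close>.\<close>

lemma tens_eq_zero:
  assumes "module R V" "module R W" "v \<in> carrier V" "w \<in> carrier W" "w \<noteq> \<zero>\<^bsub>W\<^esub>"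
    and "tens R V W v w = \<zero>\<^bsub>tensor R V W\<^esub>"
  shows "v = \<zero>\<^bsub>V\<^esub>"
proof -
  interpret V: module R V by fact
  interpret W: module R W by fact
  \<comment> \<open>The ground field as a vector space over itself, repackaged so that the
    generalized inverse of \<open>c \<mapsto> c w\<close> can be taken.\<close>
  define L where "L = \<lparr>carrier = carrier R, monoid.mult = (\<otimes>), one = \<one>, ring.zero = \<zero>, add = (\<oplus>), smult = (\<otimes>)\<rparr>"
  have L: "module R L"
    by (rule moduleI[OF is_cring abelian_groupI]) (auto simp: L_def a_ac l_distr r_distr m_assoc
        intro!: bexI[of _ "\<ominus> _"] l_neg)
  have f: "linear_map R L W (\<lambda>c. c \<odot>\<^bsub>W\<^esub> w)"
    using assms(4) by (auto intro!: linear_mapI simp: L_def W.smult_l_distr W.smult_assoc1)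
  obtain s where s: "linear_map R W L s"
    and ss: "\<And>x. x \<in> carrier L \<Longrightarrow> s (x \<odot>\<^bsub>W\<^esub> w) \<odot>\<^bsub>W\<^esub> w = x \<odot>\<^bsub>W\<^esub> w"
    using linear_generalized_inverse[OF L assms(2) f] by blast
  have sw: "s w \<in> carrier R" using linear_map_closed[OF s assms(4)] by (simp add: L_def)
  \<comment> \<open>The identity \<open>f s f = f\<close> evaluated at 1; since
    \<open>w \<noteq> 0\<close>, the scalar \<open>s w\<close> cannot vanish.\<close>
  have "s w \<odot>\<^bsub>W\<^esub> w = w" using ss[of \<one>] assms(4) by (simp add: L_def)
  then have "s w \<noteq> \<zero>" using assms(4,5) by auto
  then have i: "inv (s w) \<in> carrier R" "inv (s w) \<otimes> s w = \<one>" using field_Units sw by auto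
  have b: "bilinear_map R V W V (\<lambda>v w. s w \<odot>\<^bsub>V\<^esub> v)"
    using linear_map_closed[OF s] linear_map_add[OF s] linear_map_smult[OF s]
    by (intro bilinear_map_smult assms linear_map_ident) (auto simp: L_def)
  have "s w \<odot>\<^bsub>V\<^esub> v = \<zero>\<^bsub>V\<^esub>"
    using tensor_lift_tens[OF assms(1,2,1) b assms(3,4)] assms(6)
      linear_map_zero[OF tensor_module[OF assms(1,2)] assms(1) tensor_lift_linear[OF assms(1,2,1) b]] by simp
  then show ?thesis using V.smult_assoc1[OF i(1) sw assms(3)] i assms(3) by simp
qed

end

section \<open>Tensor products of algebras and their actions\<close>

lemma
  assumes "k_algebra K B"
  shows k_algebra_module: "module K B" and k_algebra_ring: "ring B"
    and k_algebra_bilinear: "bilinear_map K B B B (\<lambda>a b. a \<otimes>\<^bsub>B\<^esub> b)"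
  using assms by (simp_all add: k_algebra_def)

lemma
  assumes "bimodule K B M"
  shows bimodule_module: "module K M"
    and lact_bilinear: "bilinear_map K B M M (lact M)"
    and ract_bilinear: "bilinear_map K M B M (ract M)"
    and lact_one: "x \<in> carrier M \<Longrightarrow> lact M \<one>\<^bsub>B\<^esub> x = x"
    and ract_one: "x \<in> carrier M \<Longrightarrow> ract M x \<one>\<^bsub>B\<^esub> = x"
    and lact_lact: "\<lbrakk>a \<in> carrier B; b \<in> carrier B; x \<in> carrier M\<rbrakk>
      \<Longrightarrow> lact M (a \<otimes>\<^bsub>B\<^esub> b) x = lact M a (lact M b x)"
    and ract_ract: "\<lbrakk>a \<in> carrier B; b \<in> carrier B; x \<in> carrier M\<rbrakk>
      \<Longrightarrow> ract M x (a \<otimes>\<^bsub>B\<^esub> b) = ract M (ract M x a) b"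
    and lact_ract: "\<lbrakk>a \<in> carrier B; b \<in> carrier B; x \<in> carrier M\<rbrakk>
      \<Longrightarrow> ract M (lact M a x) b = lact M a (ract M x b)"
  using assms by (auto simp: bimodule_def)

lemma tensor_alg_simps [simp]:
  "carrier (tensor_alg K B C) = carrier (tensor K B C)"
  "add (tensor_alg K B C) = add (tensor K B C)"
  "ring.zero (tensor_alg K B C) = ring.zero (tensor K B C)"
  "module.smult (tensor_alg K B C) = module.smult (tensor K B C)"
  "one (tensor_alg K B C) = tens K B C \<one>\<^bsub>B\<^esub> \<one>\<^bsub>C\<^esub>"
  by (simp_all add: tensor_alg_def Let_def)

lemma linear_map_tensor_alg [simp]:
  "linear_map K V (tensor_alg K B C) f \<longleftrightarrow> linear_map K V (tensor K B C) f"
  by (simp add: linear_map_def)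

lemma tensor_lift_tensor_alg [simp]:
  "tensor_lift K (tensor_alg K B C) f = tensor_lift K (tensor K B C) f"
  by (intro ext)
    (simp add: tensor_lift_def Let_def finsum_add_monoid_cong[of "tensor_alg K B C" "tensor K B C"])

section \<open>The algebra \<open>B \<otimes> C\<close>\<close>

context cring begin

context
  fixes B :: "('a, 'x, 'm1) module_scheme" and C :: "('a, 'c, 'm2) module_scheme"
  assumes B: "k_algebra R B" and C: "k_algebra R C"
begin

interpretation B: ring B by (rule k_algebra_ring[OF B])
interpretation C: ring C by (rule k_algebra_ring[OF C])

private lemmas modsBC = k_algebra_module[OF B] k_algebra_module[OF C]

private lemma mult_bil1:
  "\<lbrakk>a \<in> carrier B; b \<in> carrier C\<rbrakk>
    \<Longrightarrow> bilinear_map R B C (tensor R B C) (\<lambda>a' b'. tens R B C (a \<otimes>\<^bsub>B\<^esub> a') (b \<otimes>\<^bsub>C\<^esub> b'))"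
  by (intro bilinear_map_comp[OF tens_bilinear[OF modsBC]]
      bilinear_map_right[OF k_algebra_bilinear[OF B]] bilinear_map_right[OF k_algebra_bilinear[OF C]])

private lemma mult_bil2:
  "\<lbrakk>a' \<in> carrier B; b' \<in> carrier C\<rbrakk>
    \<Longrightarrow> bilinear_map R B C (tensor R B C) (\<lambda>a b. tens R B C (a \<otimes>\<^bsub>B\<^esub> a') (b \<otimes>\<^bsub>C\<^esub> b'))"
  by (intro bilinear_map_comp[OF tens_bilinear[OF modsBC]]
      bilinear_map_left[OF k_algebra_bilinear[OF B]] bilinear_map_left[OF k_algebra_bilinear[OF C]])

lemma tensor_alg_bilinear:
  "bilinear_map R (tensor R B C) (tensor R B C) (tensor R B C) (monoid.mult (tensor_alg R B C))"
  unfolding tensor_alg_def Let_def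
  using tensor_lift2_bilinear[OF modsBC modsBC tensor_module[OF modsBC] mult_bil1 mult_bil2] by simp

lemma tensor_alg_tens:
  "\<lbrakk>a \<in> carrier B; b \<in> carrier C; a' \<in> carrier B; b' \<in> carrier C\<rbrakk>
    \<Longrightarrow> tens R B C a b \<otimes>\<^bsub>tensor_alg R B C\<^esub> tens R B C a' b'
      = tens R B C (a \<otimes>\<^bsub>B\<^esub> a') (b \<otimes>\<^bsub>C\<^esub> b')"
  unfolding tensor_alg_def Let_def
  using tensor_lift2_tens[OF modsBC modsBC tensor_module[OF modsBC] mult_bil1 mult_bil2] by simp

lemma tensor_alg_assoc:
  assumes "X \<in> carrier (tensor R B C)" "Y \<in> carrier (tensor R B C)" "Z \<in> carrier (tensor R B C)"
  shows "X \<otimes>\<^bsub>tensor_alg R B C\<^esub> Y \<otimes>\<^bsub>tensor_alg R B C\<^esub> Z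
    = X \<otimes>\<^bsub>tensor_alg R B C\<^esub> (Y \<otimes>\<^bsub>tensor_alg R B C\<^esub> Z)"
proof (rule tensor_linear_ext[OF modsBC _ _ assms(1)])
  note bil = tensor_alg_bilinear
  note cl = bilinear_map_closed[OF bil]
  show "linear_map R (tensor R B C) (tensor R B C)
      (\<lambda>X. X \<otimes>\<^bsub>tensor_alg R B C\<^esub> Y \<otimes>\<^bsub>tensor_alg R B C\<^esub> Z)"
    by (intro linear_map_comp[OF bilinear_map_left[OF bil] bilinear_map_left[OF bil]] assms)
  show "linear_map R (tensor R B C) (tensor R B C)
      (\<lambda>X. X \<otimes>\<^bsub>tensor_alg R B C\<^esub> (Y \<otimes>\<^bsub>tensor_alg R B C\<^esub> Z))"
    by (intro bilinear_map_left[OF bil] cl assms)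
  fix a b assume ab: "a \<in> carrier B" "b \<in> carrier C"
  note t = tens_closed[OF modsBC ab]
  show "tens R B C a b \<otimes>\<^bsub>tensor_alg R B C\<^esub> Y \<otimes>\<^bsub>tensor_alg R B C\<^esub> Z
      = tens R B C a b \<otimes>\<^bsub>tensor_alg R B C\<^esub> (Y \<otimes>\<^bsub>tensor_alg R B C\<^esub> Z)"
    by (rule tensor_bilinear_ext[OF modsBC modsBC
          bilinear_map_comp[OF bil bilinear_map_right[OF bil t] linear_map_ident]
          linear_bilinear_map_comp[OF bilinear_map_right[OF bil t] bil] _ assms(2,3)])
      (simp add: tensor_alg_tens ab B.m_assoc C.m_assoc)
qed

lemma tensor_alg_l_one:
  assumes "X \<in> carrier (tensor R B C)"
  shows "tens R B C \<one>\<^bsub>B\<^esub> \<one>\<^bsub>C\<^esub> \<otimes>\<^bsub>tensor_alg R B C\<^esub> X = X"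
  by (rule tensor_linear_ext[OF modsBC bilinear_map_right[OF tensor_alg_bilinear tens_closed[OF modsBC]]
        linear_map_ident assms]) (auto simp: tensor_alg_tens)

end

section \<open>The action of \<open>B \<otimes> C\<close> on \<open>M \<otimes> C\<close>\<close>

context
  fixes B :: "('a, 'x, 'm1) module_scheme" and C :: "('a, 'c, 'm2) module_scheme"
    and M :: "('a, 'x, 'g, 'm3) bimod_scheme"
  assumes B: "k_algebra R B" and C: "k_algebra R C" and M: "bimodule R B M"
begin

interpretation B: ring B by (rule k_algebra_ring[OF B])
interpretation C: ring C by (rule k_algebra_ring[OF C])

private lemmas modsB = k_algebra_module[OF B] k_algebra_module[OF C]
private lemmas modsM = bimodule_module[OF M] k_algebra_module[OF C]

private lemma act_bil1:
  "\<lbrakk>a \<in> carrier B; b \<in> carrier C\<rbrakk>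
    \<Longrightarrow> bilinear_map R M C (tensor R M C) (\<lambda>x b'. tens R M C (lact M a x) (b \<otimes>\<^bsub>C\<^esub> b'))"
  by (intro bilinear_map_comp[OF tens_bilinear[OF modsM]]
      bilinear_map_right[OF lact_bilinear[OF M]] bilinear_map_right[OF k_algebra_bilinear[OF C]])

private lemma act_bil2:
  "\<lbrakk>x \<in> carrier M; b' \<in> carrier C\<rbrakk>
    \<Longrightarrow> bilinear_map R B C (tensor R M C) (\<lambda>a b. tens R M C (lact M a x) (b \<otimes>\<^bsub>C\<^esub> b'))"
  by (intro bilinear_map_comp[OF tens_bilinear[OF modsM]]
      bilinear_map_left[OF lact_bilinear[OF M]] bilinear_map_left[OF k_algebra_bilinear[OF C]])

lemma tensor_lact_bilinear:
  "bilinear_map R (tensor R B C) (tensor R M C) (tensor R M C) (tensor_lact R M C)"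
  unfolding tensor_lact_def Let_def
  by (rule tensor_lift2_bilinear[OF modsB modsM tensor_module[OF modsM] act_bil1 act_bil2])

lemma tensor_lact_tens:
  "\<lbrakk>a \<in> carrier B; b \<in> carrier C; x \<in> carrier M; b' \<in> carrier C\<rbrakk>
    \<Longrightarrow> tensor_lact R M C (tens R B C a b) (tens R M C x b')
      = tens R M C (lact M a x) (b \<otimes>\<^bsub>C\<^esub> b')"
  unfolding tensor_lact_def Let_def
  by (rule tensor_lift2_tens[OF modsB modsM tensor_module[OF modsM] act_bil1 act_bil2])

lemma tensor_lact_mult:
  assumes "X \<in> carrier (tensor R B C)" "Y \<in> carrier (tensor R B C)" "Z \<in> carrier (tensor R M C)"
  shows "tensor_lact R M C (X \<otimes>\<^bsub>tensor_alg R B C\<^esub> Y) Z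
    = tensor_lact R M C X (tensor_lact R M C Y Z)"
proof (rule tensor_linear_ext[OF modsB _ _ assms(1)])
  note bil = tensor_lact_bilinear and bil' = tensor_alg_bilinear[OF B C]
  show "linear_map R (tensor R B C) (tensor R M C)
      (\<lambda>X. tensor_lact R M C (X \<otimes>\<^bsub>tensor_alg R B C\<^esub> Y) Z)"
    by (intro linear_map_comp[OF bilinear_map_left[OF bil] bilinear_map_left[OF bil']] assms)
  show "linear_map R (tensor R B C) (tensor R M C)
      (\<lambda>X. tensor_lact R M C X (tensor_lact R M C Y Z))"
    by (intro bilinear_map_left[OF bil] bilinear_map_closed[OF bil] assms)
  fix a b assume ab: "a \<in> carrier B" "b \<in> carrier C"
  note t = tens_closed[OF modsB ab]
  show "tensor_lact R M C (tens R B C a b \<otimes>\<^bsub>tensor_alg R B C\<^esub> Y) Z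
      = tensor_lact R M C (tens R B C a b) (tensor_lact R M C Y Z)"
    by (rule tensor_bilinear_ext[OF modsB modsM
          bilinear_map_comp[OF bil bilinear_map_right[OF bil' t] linear_map_ident]
          linear_bilinear_map_comp[OF bilinear_map_right[OF bil t] bil] _ assms(2,3)])
      (simp add: tensor_alg_tens[OF B C] tensor_lact_tens ab C.m_assoc lact_lact[OF M]
        bilinear_map_closed[OF lact_bilinear[OF M]])
qed

lemma lact_tens_bilinear:
  "x \<in> carrier M \<Longrightarrow> bilinear_map R B C (tensor R M C) (\<lambda>a b. tens R M C (lact M a x) b)"
  by (rule bilinear_map_comp[OF tens_bilinear[OF modsM] bilinear_map_left[OF lact_bilinear[OF M]] linear_map_ident])

lemma tensor_lact_one_bilinear:
  "bilinear_map R M (tensor R B C) (tensor R M C) (\<lambda>x Y. tensor_lact R M C Y (tens R M C x \<one>\<^bsub>C\<^esub>))"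
proof (rule bilinear_mapI)
  note tl = tensor_lact_bilinear
  show "linear_map R (tensor R B C) (tensor R M C) (\<lambda>Y. tensor_lact R M C Y (tens R M C x \<one>\<^bsub>C\<^esub>))"
    if "x \<in> carrier M" for x
    by (rule bilinear_map_left[OF tl tens_closed[OF modsM that C.one_closed]])
  show "linear_map R M (tensor R M C) (\<lambda>x. tensor_lact R M C Y (tens R M C x \<one>\<^bsub>C\<^esub>))"
    if "Y \<in> carrier (tensor R B C)" for Y
    by (rule linear_map_comp[OF bilinear_map_right[OF tl that]
          bilinear_map_left[OF tens_bilinear[OF modsM] C.one_closed]])
qed

text \<open>The action on \<open>x \<otimes> 1\<close> collapses to one lift over \<open>Y\<close>,
  the shape on which coassociativity can operate.\<close>

lemma tensor_lact_one_eq: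
  assumes "x \<in> carrier M" "Y \<in> carrier (tensor R B C)"
  shows "tensor_lact R M C Y (tens R M C x \<one>\<^bsub>C\<^esub>)
    = tensor_lift R (tensor R M C) (\<lambda>a b. tens R M C (lact M a x) b) Y"
  by (rule tensor_linear_ext[OF modsB bilinear_map_right[OF tensor_lact_one_bilinear assms(1)]
        tensor_lift_linear[OF modsB tensor_module[OF modsM] lact_tens_bilinear[OF assms(1)]] assms(2)])
    (simp add: assms(1) tensor_lact_tens
      tensor_lift_tens[OF modsB tensor_module[OF modsM] lact_tens_bilinear[OF assms(1)]])

end

end

section \<open>Bimodules\<close>

definition tensor_mult ::
  "('k, 'n) ring_scheme \<Rightarrow> ('k, 'a, 'm) module_scheme \<Rightarrow> ('a \<times> 'a \<Rightarrow> 'k) set \<Rightarrow> 'a"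
  where "tensor_mult K B = tensor_lift K B (\<lambda>a b. a \<otimes>\<^bsub>B\<^esub> b)"

section \<open>The universal bimodule and its derivation\<close>

context cring begin

context
  fixes B :: "('a, 'x, 'm) module_scheme"
  assumes B: "k_algebra R B"
begin

interpretation B: ring B by (rule k_algebra_ring[OF B])
interpretation Bm: module R B by (rule k_algebra_module[OF B])

private lemmas modsBB = k_algebra_module[OF B] k_algebra_module[OF B]

private abbreviation (input) "TB \<equiv> tensor R B B"
private abbreviation (input) "tB \<equiv> tens R B B"
private abbreviation (input) "UB \<equiv> univ_bimod R B"

interpretation T: module R TB by (rule tensor_module[OF modsBB])

lemma tensor_mult_linear: "linear_map R TB B (tensor_mult R B)"
  unfolding tensor_mult_def by (rule tensor_lift_linear[OF modsBB modsBB(1) k_algebra_bilinear[OF B]])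

lemma tensor_mult_tens:
  "\<lbrakk>a \<in> carrier B; b \<in> carrier B\<rbrakk> \<Longrightarrow> tensor_mult R B (tB a b) = a \<otimes>\<^bsub>B\<^esub> b"
  unfolding tensor_mult_def by (rule tensor_lift_tens[OF modsBB modsBB(1) k_algebra_bilinear[OF B]])

lemma univ_bimod_simps:
  "carrier UB = {q \<in> carrier TB. tensor_mult R B q = \<zero>\<^bsub>B\<^esub>}"
  "add UB = add TB" "ring.zero UB = ring.zero TB" "module.smult UB = module.smult TB"
  by (simp_all add: univ_bimod_def Let_def tensor_mult_def)

private lemma univ_lact_bil:
  "c \<in> carrier B \<Longrightarrow> bilinear_map R B B TB (\<lambda>a b. tB (c \<otimes>\<^bsub>B\<^esub> a) b)"
  by (intro bilinear_map_comp[OF tens_bilinear[OF modsBB]] linear_map_ident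
      bilinear_map_right[OF k_algebra_bilinear[OF B]])

private lemma univ_ract_bil:
  "c \<in> carrier B \<Longrightarrow> bilinear_map R B B TB (\<lambda>a b. tB a (b \<otimes>\<^bsub>B\<^esub> c))"
  by (intro bilinear_map_comp[OF tens_bilinear[OF modsBB]] linear_map_ident
      bilinear_map_left[OF k_algebra_bilinear[OF B]])

text \<open>Stated on all of \<open>B \<otimes> B\<close>, because elements of the kernel of
  multiplication are rarely pure tensors: laws are checked on \<open>B \<otimes> B\<close> and then
  restricted.\<close>

lemma univ_lact_bilinear: "bilinear_map R B TB TB (lact UB)"
  unfolding univ_bimod_def Let_def bimod.simps
proof (rule bilinear_mapI)
  show "linear_map R B TB (\<lambda>c. tensor_lift R TB (\<lambda>a b. tB (c \<otimes>\<^bsub>B\<^esub> a) b) q)" if "q \<in> carrier TB" for q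
    by (intro tensor_lift_param[OF modsBB modsBB(1) tensor_module[OF modsBB] univ_lact_bil _ that]
        linear_map_comp[OF bilinear_map_left[OF tens_bilinear[OF modsBB]]
          bilinear_map_left[OF k_algebra_bilinear[OF B]]])
qed (rule tensor_lift_linear[OF modsBB tensor_module[OF modsBB] univ_lact_bil])

lemma univ_ract_bilinear: "bilinear_map R TB B TB (ract UB)"
  unfolding univ_bimod_def Let_def bimod.simps
proof (rule bilinear_mapI)
  show "linear_map R B TB (\<lambda>c. tensor_lift R TB (\<lambda>a b. tB a (b \<otimes>\<^bsub>B\<^esub> c)) q)" if "q \<in> carrier TB" for q
    by (intro tensor_lift_param[OF modsBB modsBB(1) tensor_module[OF modsBB] univ_ract_bil _ that]
        linear_map_comp[OF bilinear_map_right[OF tens_bilinear[OF modsBB]]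
          bilinear_map_right[OF k_algebra_bilinear[OF B]]])
qed (rule tensor_lift_linear[OF modsBB tensor_module[OF modsBB] univ_ract_bil])

lemma univ_lact_tens:
  "\<lbrakk>c \<in> carrier B; a \<in> carrier B; b \<in> carrier B\<rbrakk> \<Longrightarrow> lact UB c (tB a b) = tB (c \<otimes>\<^bsub>B\<^esub> a) b"
  unfolding univ_bimod_def Let_def bimod.simps
  by (rule tensor_lift_tens[OF modsBB tensor_module[OF modsBB] univ_lact_bil])

lemma univ_ract_tens:
  "\<lbrakk>c \<in> carrier B; a \<in> carrier B; b \<in> carrier B\<rbrakk> \<Longrightarrow> ract UB (tB a b) c = tB a (b \<otimes>\<^bsub>B\<^esub> c)"
  unfolding univ_bimod_def Let_def bimod.simps
  by (rule tensor_lift_tens[OF modsBB tensor_module[OF modsBB] univ_ract_bil])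

lemma tensor_mult_lact:
  assumes "c \<in> carrier B" "q \<in> carrier TB"
  shows "tensor_mult R B (lact UB c q) = c \<otimes>\<^bsub>B\<^esub> tensor_mult R B q"
  by (rule tensor_linear_ext[OF modsBB
        linear_map_comp[OF tensor_mult_linear bilinear_map_right[OF univ_lact_bilinear assms(1)]]
        linear_map_comp[OF bilinear_map_right[OF k_algebra_bilinear[OF B] assms(1)] tensor_mult_linear] assms(2)])
    (simp add: assms univ_lact_tens tensor_mult_tens B.m_assoc)

lemma tensor_mult_ract:
  assumes "c \<in> carrier B" "q \<in> carrier TB"
  shows "tensor_mult R B (ract UB q c) = tensor_mult R B q \<otimes>\<^bsub>B\<^esub> c"
  by (rule tensor_linear_ext[OF modsBB
        linear_map_comp[OF tensor_mult_linear bilinear_map_left[OF univ_ract_bilinear assms(1)]]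
        linear_map_comp[OF bilinear_map_left[OF k_algebra_bilinear[OF B] assms(1)] tensor_mult_linear] assms(2)])
    (simp add: assms univ_ract_tens tensor_mult_tens B.m_assoc)

lemma univ_bimod_module: "module R UB"
proof -
  have "submodule {q \<in> carrier TB. tensor_mult R B q = \<zero>\<^bsub>B\<^esub>} R TB"
    by (rule linear_map_kernel[OF tensor_module[OF modsBB] modsBB(1) tensor_mult_linear])
  from submodule.submodule_is_module[OF this tensor_module[OF modsBB]]
  show ?thesis by (rule module_cong) (auto simp: univ_bimod_simps)
qed

lemma univ_bimod_bimodule: "bimodule R B UB"
proof -
  note lb = univ_lact_bilinear and rb = univ_ract_bilinear
  note lc = bilinear_map_closed[OF lb] and rc = bilinear_map_closed[OF rb]
  have l: "linear_map R B UB (\<lambda>a. lact UB a q)" if "q \<in> carrier UB" for q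
    using bilinear_map_left[OF lb, of q] that
    by (auto simp: linear_map_def univ_bimod_simps tensor_mult_lact)
  have l': "linear_map R UB UB (lact UB c)" if "c \<in> carrier B" for c
    using bilinear_map_right[OF lb, of c] that
    by (auto simp: linear_map_def univ_bimod_simps tensor_mult_lact)
  have r: "linear_map R B UB (ract UB q)" if "q \<in> carrier UB" for q
    using bilinear_map_right[OF rb, of q] that
    by (auto simp: linear_map_def univ_bimod_simps tensor_mult_ract)
  have r': "linear_map R UB UB (\<lambda>q. ract UB q c)" if "c \<in> carrier B" for c
    using bilinear_map_left[OF rb, of c] that
    by (auto simp: linear_map_def univ_bimod_simps tensor_mult_ract)
  have one: "lact UB \<one>\<^bsub>B\<^esub> q = q" "ract UB q \<one>\<^bsub>B\<^esub> = q" if q: "q \<in> carrier TB" for q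
    by (rule tensor_linear_ext[OF modsBB bilinear_map_right[OF lb] linear_map_ident q]
        tensor_linear_ext[OF modsBB bilinear_map_left[OF rb] linear_map_ident q];
      simp add: univ_lact_tens univ_ract_tens)+
  have ll: "lact UB (a \<otimes>\<^bsub>B\<^esub> b) q = lact UB a (lact UB b q)"
    if "a \<in> carrier B" "b \<in> carrier B" "q \<in> carrier TB" for a b q
    by (rule tensor_linear_ext[OF modsBB bilinear_map_right[OF lb B.m_closed[OF that(1,2)]]
          linear_map_comp[OF bilinear_map_right[OF lb that(1)] bilinear_map_right[OF lb that(2)]] that(3)])
      (simp add: that univ_lact_tens B.m_assoc)
  have rr: "ract UB q (a \<otimes>\<^bsub>B\<^esub> b) = ract UB (ract UB q a) b"
    if "a \<in> carrier B" "b \<in> carrier B" "q \<in> carrier TB" for a b q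
    by (rule tensor_linear_ext[OF modsBB bilinear_map_left[OF rb B.m_closed[OF that(1,2)]]
          linear_map_comp[OF bilinear_map_left[OF rb that(2)] bilinear_map_left[OF rb that(1)]] that(3)])
      (simp add: that univ_ract_tens B.m_assoc)
  have lr: "ract UB (lact UB a q) b = lact UB a (ract UB q b)"
    if "a \<in> carrier B" "b \<in> carrier B" "q \<in> carrier TB" for a b q
    by (rule tensor_linear_ext[OF modsBB
          linear_map_comp[OF bilinear_map_left[OF rb that(2)] bilinear_map_right[OF lb that(1)]]
          linear_map_comp[OF bilinear_map_right[OF lb that(1)] bilinear_map_left[OF rb that(2)]] that(3)])
      (simp add: that univ_lact_tens univ_ract_tens)
  show ?thesis
    unfolding bimodule_def
    using univ_bimod_module bilinear_mapI[OF l' l] bilinear_mapI[OF r r'] one ll rr lr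
    by (auto simp: univ_bimod_simps)
qed

text \<open>Additive inverses are defined relative to a carrier, and \<open>UB\<close> has a smaller
  one than \<open>TB\<close>; the inclusion is linear and so preserves them.\<close>

lemma a_inv_univ_bimod: "q \<in> carrier UB \<Longrightarrow> \<ominus>\<^bsub>UB\<^esub> q = \<ominus>\<^bsub>TB\<^esub> q"
  using linear_map_uminus[OF univ_bimod_module tensor_module[OF modsBB], of "\<lambda>x. x"]
  by (auto simp: linear_map_def univ_bimod_simps)

lemma univ_d_linear: "linear_map R B TB (univ_d R B)"
  unfolding univ_d_def
  by (intro linear_map_minus tensor_module modsBB bilinear_map_left[OF tens_bilinear[OF modsBB]]
      bilinear_map_right[OF tens_bilinear[OF modsBB]] B.one_closed)

lemma univ_d_closed: "b \<in> carrier B \<Longrightarrow> univ_d R B b \<in> carrier UB"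
  using linear_map_closed[OF univ_d_linear, of b]
    linear_map_diff[OF tensor_module[OF modsBB] modsBB(1) tensor_mult_linear, of "tB \<one>\<^bsub>B\<^esub> b" "tB b \<one>\<^bsub>B\<^esub>"]
  by (auto simp: univ_bimod_simps univ_d_def tens_closed[OF modsBB] tensor_mult_tens B.minus_eq_zero_iff)

lemma lact_univ_d:
  assumes "a \<in> carrier B" "b \<in> carrier B"
  shows "lact UB a (univ_d R B b) = tB a b \<ominus>\<^bsub>TB\<^esub> tB (a \<otimes>\<^bsub>B\<^esub> b) \<one>\<^bsub>B\<^esub>"
  unfolding univ_d_def using assms
  by (subst linear_map_diff[OF tensor_module[OF modsBB] tensor_module[OF modsBB] bilinear_map_right[OF univ_lact_bilinear]])
    (auto simp: univ_lact_tens tens_closed[OF modsBB])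

end

section \<open>Quotient bimodules\<close>

context
  fixes B :: "('a, 'x, 'm) module_scheme" and M :: "('a, 'x, 'g, 'm1) bimod_scheme" and N
  assumes B: "k_algebra R B" and M: "bimodule R B M" and N: "sub_bimodule R B M N"
begin

interpretation B: ring B by (rule k_algebra_ring[OF B])
interpretation M: module R M by (rule bimodule_module[OF M])

private abbreviation (input) "Q \<equiv> quot_bimod M N"

private lemma Nsub: "submodule N R M" using N by (simp add: sub_bimodule_def)

private lemma quot_bimod_quot_module:
  "carrier Q = carrier (quot_module M N)" "add Q = add (quot_module M N)"
  "ring.zero Q = ring.zero (quot_module M N)" "module.smult Q = module.smult (quot_module M N)"
  by (simp_all add: quot_bimod_def quot_module_def)

lemma quot_bimod_module: "module R Q"
  by (rule module_cong[OF M.quot_module_module[OF Nsub]]) (simp_all add: quot_bimod_quot_module)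

lemma quot_bimod_carrier: "carrier Q = (\<lambda>x. N +>\<^bsub>M\<^esub> x) ` carrier M"
  by (simp add: quot_bimod_quot_module M.quot_module_carrier[OF Nsub])

lemma quot_bimod_proj_linear: "linear_map R M Q (\<lambda>x. N +>\<^bsub>M\<^esub> x)"
  using M.quot_module_proj_linear[OF Nsub] by (simp add: linear_map_def quot_bimod_quot_module)

lemma quot_bimod_eq_zero_iff: "x \<in> carrier M \<Longrightarrow> N +>\<^bsub>M\<^esub> x = \<zero>\<^bsub>Q\<^esub> \<longleftrightarrow> x \<in> N"
  using M.quot_module_eq_zero_iff[OF Nsub] by (simp add: quot_bimod_quot_module)

lemma quot_bimod_lact:
  "\<lbrakk>a \<in> carrier B; x \<in> carrier M\<rbrakk> \<Longrightarrow> lact Q a (N +>\<^bsub>M\<^esub> x) = N +>\<^bsub>M\<^esub> lact M a x"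
  unfolding quot_bimod_def bimod.simps using N
  by (intro M.coset_UN[OF Nsub] linear_map_closed[OF bilinear_map_right[OF lact_bilinear[OF M]]]
      linear_map_add[OF bilinear_map_right[OF lact_bilinear[OF M]]])
    (auto simp: sub_bimodule_def)

lemma quot_bimod_ract:
  "\<lbrakk>a \<in> carrier B; x \<in> carrier M\<rbrakk> \<Longrightarrow> ract Q (N +>\<^bsub>M\<^esub> x) a = N +>\<^bsub>M\<^esub> ract M x a"
  unfolding quot_bimod_def bimod.simps using N
  by (intro M.coset_UN[OF Nsub] linear_map_closed[OF bilinear_map_left[OF ract_bilinear[OF M]]]
      linear_map_add[OF bilinear_map_left[OF ract_bilinear[OF M]]])
    (auto simp: sub_bimodule_def)

lemma quot_bimod_bimodule: "bimodule R B Q"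
proof -
  note p = quot_bimod_proj_linear
  note lb = lact_bilinear[OF M] and rb = ract_bilinear[OF M]
  note lc = bilinear_map_closed[OF lb] and rc = bilinear_map_closed[OF rb]
  have L: "linear_map R B Q (\<lambda>a. lact Q a X)" if X: "X \<in> carrier Q" for X
  proof -
    obtain x where x: "x \<in> carrier M" "X = N +>\<^bsub>M\<^esub> x" using X by (auto simp: quot_bimod_carrier)
    show ?thesis
      by (rule linear_map_cong[OF k_algebra_module[OF B] linear_map_comp[OF p bilinear_map_left[OF lb x(1)]]])
        (simp add: x quot_bimod_lact)
  qed
  have Rr: "linear_map R B Q (ract Q X)" if X: "X \<in> carrier Q" for X
  proof -
    obtain x where x: "x \<in> carrier M" "X = N +>\<^bsub>M\<^esub> x" using X by (auto simp: quot_bimod_carrier)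
    show ?thesis
      by (rule linear_map_cong[OF k_algebra_module[OF B] linear_map_comp[OF p bilinear_map_right[OF rb x(1)]]])
        (simp add: x quot_bimod_ract)
  qed
  have L': "linear_map R Q Q (lact Q a)" if "a \<in> carrier B" for a
    using that
    by (intro linear_mapI) (auto simp: quot_bimod_carrier quot_bimod_lact lc
        linear_map_add[OF p, symmetric] linear_map_smult[OF p, symmetric]
        linear_map_add[OF bilinear_map_right[OF lb]] linear_map_smult[OF bilinear_map_right[OF lb]])
  have R': "linear_map R Q Q (\<lambda>X. ract Q X a)" if "a \<in> carrier B" for a
    using that
    by (intro linear_mapI) (auto simp: quot_bimod_carrier quot_bimod_ract rc
        linear_map_add[OF p, symmetric] linear_map_smult[OF p, symmetric]
        linear_map_add[OF bilinear_map_left[OF rb]] linear_map_smult[OF bilinear_map_left[OF rb]])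
  show ?thesis
    unfolding bimodule_def
    using quot_bimod_module bilinear_mapI[OF L' L] bilinear_mapI[OF Rr R']
    by (auto simp: quot_bimod_carrier quot_bimod_lact quot_bimod_ract lc rc lact_one[OF M] ract_one[OF M]
        lact_lact[OF M] ract_ract[OF M] lact_ract[OF M])
qed

end

end

section \<open>First order calculi as quotients of the universal one\<close>

definition first_order_calculus ::
  "('k, 'n) ring_scheme \<Rightarrow> ('k, 'a, 'm1) module_scheme \<Rightarrow> ('k, 'a, 'g, 'm2) bimod_scheme
    \<Rightarrow> ('a \<Rightarrow> 'g) \<Rightarrow> bool"
  where "first_order_calculus K B G d \<longleftrightarrow>
    bimodule K B G \<and> linear_map K B G d \<and>
    (\<forall>a\<in>carrier B. \<forall>b\<in>carrier B. d (a \<otimes>\<^bsub>B\<^esub> b) = ract G (d a) b \<oplus>\<^bsub>G\<^esub> lact G a (d b)) \<and>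
    (\<forall>x\<in>carrier G. \<exists>(n::nat) a b.
      a \<in> {..<n} \<rightarrow> carrier B \<and> b \<in> {..<n} \<rightarrow> carrier B \<and>
      x = (\<Oplus>\<^bsub>G\<^esub> k \<in> {..<n}. lact G (a k) (d (b k))))"

lemma fodc_iff:
  "fodc K P A \<Gamma> d \<longleftrightarrow> (\<forall>\<alpha>\<in>carrier P. first_order_calculus K (A \<alpha>) (\<Gamma> \<alpha>) (d \<alpha>))"
  by (simp add: fodc_def first_order_calculus_def)

text \<open>\<open>a \<otimes> b \<mapsto> a d(b)\<close>, defined on all of \<open>B \<otimes> B\<close> and not just on \<open>B\<^sup>2\<close>; hence no
  flatness is needed when it is tensored with another space.\<close>

definition calc_map ::
  "('k, 'n) ring_scheme \<Rightarrow> ('k, 'a, 'g, 'm) bimod_scheme \<Rightarrow> ('a \<Rightarrow> 'g)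
    \<Rightarrow> ('a \<times> 'a \<Rightarrow> 'k) set \<Rightarrow> 'g"
  where "calc_map K G d = tensor_lift K G (\<lambda>a b. lact G a (d b))"

context cring begin

context
  fixes B :: "('a, 'x, 'm) module_scheme"
  assumes B: "k_algebra R B"
begin

interpretation B: ring B by (rule k_algebra_ring[OF B])
interpretation Bm: module R B by (rule k_algebra_module[OF B])

private lemmas mods2 = k_algebra_module[OF B] k_algebra_module[OF B]

private abbreviation (input) "TT \<equiv> tensor R B B"
private abbreviation (input) "tt \<equiv> tens R B B"
private abbreviation (input) "UU \<equiv> univ_bimod R B"

interpretation T: module R TT by (rule tensor_module[OF mods2])
interpretation U: module R UU by (rule univ_bimod_module[OF B])

lemma finsum_univ_bimod:
  assumes "finite I" "f \<in> I \<rightarrow> carrier UU"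
  shows "(\<Oplus>\<^bsub>UU\<^esub> k\<in>I. f k) = (\<Oplus>\<^bsub>TT\<^esub> k\<in>I. f k)"
proof -
  have "linear_map R UU TT (\<lambda>x. x)" by (auto simp: linear_map_def univ_bimod_simps[OF B])
  from linear_map_finsum[OF univ_bimod_module[OF B] tensor_module[OF mods2] this assms]
  show ?thesis .
qed

lemma linear_map_univ_bimod:
  "linear_map R TT Z f \<Longrightarrow> linear_map R UU Z f"
  by (auto simp: linear_map_def univ_bimod_simps[OF B])

lemma ract_univ_d:
  assumes "a \<in> carrier B" "b \<in> carrier B"
  shows "ract UU (univ_d R B a) b = tt \<one>\<^bsub>B\<^esub> (a \<otimes>\<^bsub>B\<^esub> b) \<ominus>\<^bsub>TT\<^esub> tt a b"
  unfolding univ_d_def using assms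
  by (subst linear_map_diff[OF tensor_module[OF mods2] tensor_module[OF mods2]
        bilinear_map_left[OF univ_ract_bilinear[OF B]]])
    (auto simp: univ_ract_tens[OF B] tens_closed[OF mods2])

text \<open>The two summands are \<open>1 \<otimes> a b - a \<otimes> b\<close> and
  \<open>a \<otimes> b - a b \<otimes> 1\<close>, and the middle terms cancel.\<close>

lemma univ_d_mult:
  assumes "a \<in> carrier B" "b \<in> carrier B"
  shows "univ_d R B (a \<otimes>\<^bsub>B\<^esub> b) = ract UU (univ_d R B a) b \<oplus>\<^bsub>TT\<^esub> lact UU a (univ_d R B b)"
  using assms tens_closed[OF mods2]
  by (simp add: ract_univ_d lact_univ_d[OF B])
    (simp add: univ_d_def a_minus_def T.M.a_ac T.M.r_neg T.M.r_neg1 T.M.r_neg2)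

text \<open>\<open>q - m(q) \<otimes> 1\<close> is the projection of \<open>B \<otimes> B\<close>
  onto the kernel of \<open>m\<close> along \<open>B \<otimes> 1\<close>. On a pure tensor it gives
  \<open>a D(b)\<close>, with \<open>D\<close> the universal derivation.\<close>

lemma tensor_retract_linear:
  "linear_map R TT TT (\<lambda>q. q \<ominus>\<^bsub>TT\<^esub> tt (tensor_mult R B q) \<one>\<^bsub>B\<^esub>)"
  by (intro linear_map_minus tensor_module mods2 linear_map_ident B.one_closed
      linear_map_comp[OF bilinear_map_left[OF tens_bilinear[OF mods2]] tensor_mult_linear[OF B]])

lemma tensor_retract_closed:
  assumes "q \<in> carrier TT"
  shows "q \<ominus>\<^bsub>TT\<^esub> tt (tensor_mult R B q) \<one>\<^bsub>B\<^esub> \<in> carrier UU"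
  using assms linear_map_closed[OF tensor_retract_linear assms]
    linear_map_closed[OF tensor_mult_linear[OF B] assms]
  by (simp add: univ_bimod_simps[OF B] tensor_mult_tens[OF B] tens_closed[OF mods2] B.minus_eq_zero_iff
      linear_map_diff[OF tensor_module[OF mods2] mods2(1) tensor_mult_linear[OF B]])

section \<open>Calculi given by a sub-bimodule\<close>

context
  fixes N assumes N: "sub_bimodule R B UU N"
begin

private abbreviation (input) "QU \<equiv> quot_bimod UU N"
private abbreviation (input) "dQ \<equiv> (\<lambda>b. N +>\<^bsub>UU\<^esub> univ_d R B b)"

private lemmas qfacts = B univ_bimod_bimodule[OF B] N
private lemmas p = quot_bimod_proj_linear[OF qfacts]

lemma quot_lact_d:
  assumes "a \<in> carrier B" "b \<in> carrier B"
  shows "lact QU a (dQ b) = N +>\<^bsub>UU\<^esub> (tt a b \<ominus>\<^bsub>TT\<^esub> tt (tensor_mult R B (tt a b)) \<one>\<^bsub>B\<^esub>)"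
  using assms
  by (simp add: quot_bimod_lact[OF qfacts] univ_d_closed[OF B] lact_univ_d[OF B] tensor_mult_tens[OF B])

text \<open>The Leibniz rule descends from the universal derivation. For the spanning condition, a
  representative is decomposed into pure tensors, which leave the universal bimodule; the retraction
  fixes the representative and turns each \<open>a \<otimes> b\<close> into
  \<open>a D(b)\<close>.\<close>

lemma quot_first_order_calculus: "first_order_calculus R B QU dQ"
proof -
  note lc = bilinear_map_closed[OF lact_bilinear[OF univ_bimod_bimodule[OF B]]]
    and rc = bilinear_map_closed[OF ract_bilinear[OF univ_bimod_bimodule[OF B]]]
  have lin: "linear_map R B UU (univ_d R B)"
    using univ_d_linear[OF B] univ_d_closed[OF B]
    by (auto simp: linear_map_def univ_bimod_simps[OF B])
  have leib: "dQ (a \<otimes>\<^bsub>B\<^esub> b) = ract QU (dQ a) b \<oplus>\<^bsub>QU\<^esub> lact QU a (dQ b)"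
    if "a \<in> carrier B" "b \<in> carrier B" for a b
  proof -
    have "univ_d R B (a \<otimes>\<^bsub>B\<^esub> b) = ract UU (univ_d R B a) b \<oplus>\<^bsub>UU\<^esub> lact UU a (univ_d R B b)"
      using univ_d_mult[OF that] by (simp add: univ_bimod_simps[OF B])
    then show ?thesis
      using that univ_d_closed[OF B] lc rc
      by (simp add: quot_bimod_lact[OF qfacts] quot_bimod_ract[OF qfacts] linear_map_add[OF p])
  qed
  have span: "\<exists>(n::nat) a b. a \<in> {..<n} \<rightarrow> carrier B \<and> b \<in> {..<n} \<rightarrow> carrier B \<and>
      X = (\<Oplus>\<^bsub>QU\<^esub> k \<in> {..<n}. lact QU (a k) (dQ (b k)))" if X: "X \<in> carrier QU" for X
  proof -
    obtain q where q: "q \<in> carrier UU" "X = N +>\<^bsub>UU\<^esub> q"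
      using X by (auto simp: quot_bimod_carrier[OF qfacts])
    then have qT: "q \<in> carrier TT" and q0: "tensor_mult R B q = \<zero>\<^bsub>B\<^esub>"
      by (simp_all add: univ_bimod_simps[OF B])
    obtain n :: nat and a b where ab: "a \<in> {..<n} \<rightarrow> carrier B" "b \<in> {..<n} \<rightarrow> carrier B"
      "q = (\<Oplus>\<^bsub>TT\<^esub> k\<in>{..<n}. tt (a k) (b k))" by (rule tensor_sum_of_tens[OF mods2 qT])
    have t: "(\<lambda>k. tt (a k) (b k)) \<in> {..<n} \<rightarrow> carrier TT" using ab by (auto intro!: tens_closed[OF mods2])
    let ?r = "\<lambda>q. q \<ominus>\<^bsub>TT\<^esub> tt (tensor_mult R B q) \<one>\<^bsub>B\<^esub>"
    \<comment> \<open>A representative has product zero, so the correction term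
      \<open>m(q) \<otimes> 1\<close> vanishes.\<close>
    have "?r q = q" using qT q0 by (simp add: tens_zero_left[OF mods2] a_minus_def)
    then have "q = (\<Oplus>\<^bsub>TT\<^esub> k\<in>{..<n}. ?r (tt (a k) (b k)))"
      using linear_map_finsum[OF tensor_module[OF mods2] tensor_module[OF mods2] tensor_retract_linear _ t]
        ab(3) by simp
    also have "\<dots> = (\<Oplus>\<^bsub>UU\<^esub> k\<in>{..<n}. ?r (tt (a k) (b k)))"
      using t tensor_retract_closed by (intro finsum_univ_bimod[symmetric]) auto
    finally have "q = (\<Oplus>\<^bsub>UU\<^esub> k\<in>{..<n}. ?r (tt (a k) (b k)))" .
    then have "X = (\<Oplus>\<^bsub>QU\<^esub> k\<in>{..<n}. N +>\<^bsub>UU\<^esub> ?r (tt (a k) (b k)))"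
      using linear_map_finsum[OF univ_bimod_module[OF B] quot_bimod_module[OF qfacts] p, of "{..<n}"
          "\<lambda>k. ?r (tt (a k) (b k))"] t tensor_retract_closed q(2) by (auto simp: Pi_def)
    also have "\<dots> = (\<Oplus>\<^bsub>QU\<^esub> k\<in>{..<n}. lact QU (a k) (dQ (b k)))"
    proof -
      interpret Q: module R QU by (rule quot_bimod_module[OF qfacts])
      show ?thesis
        using ab(1,2) t tensor_retract_closed linear_map_closed[OF p]
        by (intro Q.M.finsum_cong') (auto simp: quot_lact_d Pi_def)
    qed
    finally show ?thesis using ab(1,2) by blast
  qed
  show ?thesis
    unfolding first_order_calculus_def
    using quot_bimod_bimodule[OF qfacts] linear_map_comp[OF p lin] leib span by blast
qed

text \<open>The total map of the quotient calculus is the projection preceded by the retraction. Its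
  kernel therefore consists of the \<open>n + c \<otimes> 1\<close> with \<open>n\<close> in
  \<open>N\<close>.\<close>

lemma quot_calc_map:
  assumes "q \<in> carrier TT"
  shows "calc_map R QU dQ q = N +>\<^bsub>UU\<^esub> (q \<ominus>\<^bsub>TT\<^esub> tt (tensor_mult R B q) \<one>\<^bsub>B\<^esub>)"
proof -
  note Q = quot_first_order_calculus[unfolded first_order_calculus_def]
  have bil: "bilinear_map R B B QU (\<lambda>a b. lact QU a (dQ b))"
    using Q by (intro bilinear_map_comp[OF lact_bilinear[OF quot_bimod_bimodule[OF qfacts]] linear_map_ident]) blast
  have r: "linear_map R TT UU (\<lambda>q. q \<ominus>\<^bsub>TT\<^esub> tt (tensor_mult R B q) \<one>\<^bsub>B\<^esub>)"
    using tensor_retract_linear tensor_retract_closed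
    by (auto simp: linear_map_def univ_bimod_simps[OF B])
  note qm = quot_bimod_module[OF qfacts]
  show ?thesis
    unfolding calc_map_def
    by (rule tensor_linear_ext[OF mods2 tensor_lift_linear[OF mods2 qm bil] linear_map_comp[OF p r] assms])
      (simp add: tensor_lift_tens[OF mods2 qm bil] quot_lact_d)
qed

end

section \<open>Every calculus as a quotient of the universal one\<close>

context
  fixes G :: "('a, 'x, 'g, 'm1) bimod_scheme" and d
  assumes D: "first_order_calculus R B G d"
begin

private lemma G: "bimodule R B G" and d: "linear_map R B G d"
  and leib: "\<lbrakk>a \<in> carrier B; b \<in> carrier B\<rbrakk> \<Longrightarrow> d (a \<otimes>\<^bsub>B\<^esub> b) = ract G (d a) b \<oplus>\<^bsub>G\<^esub> lact G a (d b)"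
  using D by (auto simp: first_order_calculus_def)

interpretation G: module R G by (rule bimodule_module[OF G])

private lemmas dcl = linear_map_closed[OF d]
private lemmas lcl = bilinear_map_closed[OF lact_bilinear[OF G]]
private lemmas rcl = bilinear_map_closed[OF ract_bilinear[OF G]]

private lemma bil: "bilinear_map R B B G (\<lambda>a b. lact G a (d b))"
  by (rule bilinear_map_comp[OF lact_bilinear[OF G] linear_map_ident d])

lemma calc_map_linear: "linear_map R TT G (calc_map R G d)"
  unfolding calc_map_def by (rule tensor_lift_linear[OF mods2 bimodule_module[OF G] bil])

lemma calc_map_tens:
  "\<lbrakk>a \<in> carrier B; b \<in> carrier B\<rbrakk> \<Longrightarrow> calc_map R G d (tt a b) = lact G a (d b)"
  unfolding calc_map_def by (rule tensor_lift_tens[OF mods2 bimodule_module[OF G] bil])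

lemma calculus_d_one: "d \<one>\<^bsub>B\<^esub> = \<zero>\<^bsub>G\<^esub>"
proof -
  have "d \<one>\<^bsub>B\<^esub> = d \<one>\<^bsub>B\<^esub> \<oplus>\<^bsub>G\<^esub> d \<one>\<^bsub>B\<^esub>"
    using leib[of "\<one>\<^bsub>B\<^esub>" "\<one>\<^bsub>B\<^esub>"] dcl[of "\<one>\<^bsub>B\<^esub>"] by (simp add: lact_one[OF G] ract_one[OF G])
  then show ?thesis using dcl[of "\<one>\<^bsub>B\<^esub>"] G.M.add.r_cancel_one' by fastforce
qed

lemma calc_map_tens_one: "a \<in> carrier B \<Longrightarrow> calc_map R G d (tt a \<one>\<^bsub>B\<^esub>) = \<zero>\<^bsub>G\<^esub>"
  by (simp add: calc_map_tens calculus_d_one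
      linear_map_zero[OF bimodule_module[OF G] bimodule_module[OF G] bilinear_map_right[OF lact_bilinear[OF G]]])

lemma calc_map_univ_d:
  assumes "b \<in> carrier B"
  shows "calc_map R G d (univ_d R B b) = d b"
  unfolding univ_d_def using assms dcl
  by (subst linear_map_diff[OF tensor_module[OF mods2] bimodule_module[OF G] calc_map_linear])
    (auto simp: tens_closed[OF mods2] calc_map_tens_one a_minus_def, simp add: calc_map_tens lact_one[OF G])

lemma calc_map_lact:
  assumes "c \<in> carrier B" "q \<in> carrier TT"
  shows "calc_map R G d (lact UU c q) = lact G c (calc_map R G d q)"
  by (rule tensor_linear_ext[OF mods2
        linear_map_comp[OF calc_map_linear bilinear_map_right[OF univ_lact_bilinear[OF B] assms(1)]]
        linear_map_comp[OF bilinear_map_right[OF lact_bilinear[OF G] assms(1)] calc_map_linear] assms(2)])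
    (simp add: assms univ_lact_tens[OF B] calc_map_tens lact_lact[OF G] dcl)

text \<open>By the Leibniz rule \<open>a d(b c) = a d(b) c + a b d(c)\<close>. The second term is
  the obstruction to right linearity, and it disappears exactly where it has to, on elements with
  product zero.\<close>

lemma calc_map_ract:
  assumes "c \<in> carrier B" "q \<in> carrier TT"
  shows "calc_map R G d (ract UU q c)
    = ract G (calc_map R G d q) c \<oplus>\<^bsub>G\<^esub> lact G (tensor_mult R B q) (d c)"
proof (rule tensor_linear_ext[OF mods2 _ _ assms(2)])
  show "linear_map R TT G (\<lambda>q. calc_map R G d (ract UU q c))"
    by (rule linear_map_comp[OF calc_map_linear bilinear_map_left[OF univ_ract_bilinear[OF B] assms(1)]])
  show "linear_map R TT G (\<lambda>q. ract G (calc_map R G d q) c \<oplus>\<^bsub>G\<^esub> lact G (tensor_mult R B q) (d c))"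
    by (intro linear_map_plus bimodule_module[OF G] dcl assms
        linear_map_comp[OF bilinear_map_left[OF ract_bilinear[OF G]] calc_map_linear]
        linear_map_comp[OF bilinear_map_left[OF lact_bilinear[OF G]] tensor_mult_linear[OF B]])
  fix a b assume "a \<in> carrier B" "b \<in> carrier B"
  then show "calc_map R G d (ract UU (tt a b) c)
      = ract G (calc_map R G d (tt a b)) c \<oplus>\<^bsub>G\<^esub> lact G (tensor_mult R B (tt a b)) (d c)"
    using assms(1) dcl rcl lcl
    by (simp add: univ_ract_tens[OF B] calc_map_tens tensor_mult_tens[OF B] leib lact_lact[OF G]
        lact_ract[OF G] linear_map_add[OF bilinear_map_right[OF lact_bilinear[OF G]]])
qed

text \<open>The preimage of \<open>a d(b)\<close> is taken as \<open>a D(b)\<close> rather than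
  \<open>a \<otimes> b\<close>, so that it lies in the universal bimodule.\<close>

lemma calc_map_surj:
  assumes "x \<in> carrier G"
  obtains q where "q \<in> carrier UU" "calc_map R G d q = x"
proof -
  obtain n :: nat and a b where ab: "a \<in> {..<n} \<rightarrow> carrier B" "b \<in> {..<n} \<rightarrow> carrier B"
    "x = (\<Oplus>\<^bsub>G\<^esub> k \<in> {..<n}. lact G (a k) (d (b k)))"
    using D assms unfolding first_order_calculus_def by blast
  have c: "univ_d R B (b k) \<in> carrier UU" "univ_d R B (b k) \<in> carrier TT"
    "a k \<in> carrier B" "b k \<in> carrier B" if "k < n" for k
    using ab that univ_d_closed[OF B, of "b k"] by (auto simp: Pi_def univ_bimod_simps[OF B])
  have l: "(\<lambda>k. lact UU (a k) (univ_d R B (b k))) \<in> {..<n} \<rightarrow> carrier UU"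
    using c bilinear_map_closed[OF lact_bilinear[OF univ_bimod_bimodule[OF B]]] by auto
  let ?q = "\<Oplus>\<^bsub>UU\<^esub> k\<in>{..<n}. lact UU (a k) (univ_d R B (b k))"
  have "calc_map R G d ?q = (\<Oplus>\<^bsub>G\<^esub> k\<in>{..<n}. calc_map R G d (lact UU (a k) (univ_d R B (b k))))"
    by (rule linear_map_finsum[OF univ_bimod_module[OF B] bimodule_module[OF G]
          linear_map_univ_bimod[OF calc_map_linear] _ l]) simp
  also have "\<dots> = x"
    unfolding ab(3) using c dcl lcl
    by (intro G.M.finsum_cong') (auto simp: calc_map_lact calc_map_univ_d)
  finally show ?thesis using that U.M.finsum_closed[OF l] by blast
qed

text \<open>Restricting the kernel to the universal bimodule is what gives stability under the right
  action: there the correction term of \<open>calc_map_ract\<close> is zero.\<close>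

lemma calc_map_kernel_sub_bimodule:
  "sub_bimodule R B UU {q \<in> carrier UU. calc_map R G d q = \<zero>\<^bsub>G\<^esub>}"
proof -
  note Gm = bimodule_module[OF G]
  have "submodule {q \<in> carrier UU. calc_map R G d q = \<zero>\<^bsub>G\<^esub>} R UU"
    by (rule linear_map_kernel[OF univ_bimod_module[OF B] Gm linear_map_univ_bimod[OF calc_map_linear]])
  moreover have "lact G c \<zero>\<^bsub>G\<^esub> = \<zero>\<^bsub>G\<^esub>" "ract G \<zero>\<^bsub>G\<^esub> c = \<zero>\<^bsub>G\<^esub>" if "c \<in> carrier B" for c
    using that linear_map_zero[OF Gm Gm bilinear_map_right[OF lact_bilinear[OF G]]]
      linear_map_zero[OF Gm Gm bilinear_map_left[OF ract_bilinear[OF G]]] by auto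
  moreover have "lact G \<zero>\<^bsub>B\<^esub> x = \<zero>\<^bsub>G\<^esub>" if "x \<in> carrier G" for x
    using that linear_map_zero[OF mods2(1) Gm bilinear_map_left[OF lact_bilinear[OF G]]] by auto
  moreover have "lact UU c q \<in> carrier UU" "ract UU q c \<in> carrier UU"
    if "c \<in> carrier B" "q \<in> carrier UU" for c q
    using that bilinear_map_closed[OF lact_bilinear[OF univ_bimod_bimodule[OF B]]]
      bilinear_map_closed[OF ract_bilinear[OF univ_bimod_bimodule[OF B]]] by auto
  ultimately show ?thesis
    using dcl unfolding sub_bimodule_def
    by (auto simp: univ_bimod_simps[OF B] calc_map_lact calc_map_ract)
qed

text \<open>The first isomorphism theorem for the restriction of \<open>calc_map\<close> to the
  universal bimodule, with the compatibility of the differentials included.\<close>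

lemma calculus_iso_quotient:
  defines "N \<equiv> {q \<in> carrier UU. calc_map R G d q = \<zero>\<^bsub>G\<^esub>}"
  obtains i where "bij_betw i (carrier (quot_bimod UU N)) (carrier G)"
    "linear_map R (quot_bimod UU N) G i"
    "\<And>a x. \<lbrakk>a \<in> carrier B; x \<in> carrier (quot_bimod UU N)\<rbrakk>
      \<Longrightarrow> i (lact (quot_bimod UU N) a x) = lact G a (i x)"
    "\<And>a x. \<lbrakk>a \<in> carrier B; x \<in> carrier (quot_bimod UU N)\<rbrakk>
      \<Longrightarrow> i (ract (quot_bimod UU N) x a) = ract G (i x) a"
    "\<And>a. a \<in> carrier B \<Longrightarrow> i (N +>\<^bsub>UU\<^esub> univ_d R B a) = d a"
proof -
  have N: "sub_bimodule R B UU N" unfolding N_def by (rule calc_map_kernel_sub_bimodule)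
  note q = B univ_bimod_bimodule[OF B] N
  note p = quot_bimod_proj_linear[OF q]
  have Ns: "submodule N R UU" using N by (simp add: sub_bimodule_def)
  interpret Na: abelian_subgroup N UU by (rule U.submodule_abelian_subgroup[OF Ns])
  note lin = linear_map_univ_bimod[OF calc_map_linear]
  note cl = linear_map_closed[OF lin]
  have lc: "lact UU c q \<in> carrier UU" and rc: "ract UU q c \<in> carrier UU"
    if "c \<in> carrier B" "q \<in> carrier UU" for c q
    using that bilinear_map_closed[OF lact_bilinear[OF univ_bimod_bimodule[OF B]]]
      bilinear_map_closed[OF ract_bilinear[OF univ_bimod_bimodule[OF B]]] by auto
  have UT: "q \<in> carrier TT" "tensor_mult R B q = \<zero>\<^bsub>B\<^esub>" if "q \<in> carrier UU" for q
    using that by (auto simp: univ_bimod_simps[OF B])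
  have l0: "lact G \<zero>\<^bsub>B\<^esub> x = \<zero>\<^bsub>G\<^esub>" if "x \<in> carrier G" for x
    using that linear_map_zero[OF mods2(1) bimodule_module[OF G] bilinear_map_left[OF lact_bilinear[OF G]]] by auto
  \<comment> \<open>Evaluation at an arbitrary representative of the coset; two representatives
    differ by an element of \<open>N\<close>, where \<open>calc_map\<close> vanishes.\<close>
  define i where "i X = calc_map R G d (SOME q. q \<in> X)" for X
  have i: "i (N +>\<^bsub>UU\<^esub> q) = calc_map R G d q" if q: "q \<in> carrier UU" for q
  proof -
    have "calc_map R G d q' = calc_map R G d q" if q': "q' \<in> N +>\<^bsub>UU\<^esub> q" for q'
    proof -
      obtain n where n: "n \<in> N" "q' = n \<oplus>\<^bsub>UU\<^esub> q" using q' unfolding a_r_coset_def' by blast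
      have n': "n \<in> carrier UU" "calc_map R G d n = \<zero>\<^bsub>G\<^esub>" using n(1) unfolding N_def by blast+
      show ?thesis unfolding n(2) linear_map_add[OF lin n'(1) q] n'(2) using cl[OF q] by (rule G.M.l_zero)
    qed
    moreover have "(SOME q'. q' \<in> N +>\<^bsub>UU\<^esub> q) \<in> N +>\<^bsub>UU\<^esub> q"
      unfolding some_in_eq using Na.a_rcos_self[OF q] by blast
    ultimately show ?thesis by (simp add: i_def)
  qed
  have Q: "\<exists>q\<in>carrier UU. X = N +>\<^bsub>UU\<^esub> q" if "X \<in> carrier (quot_bimod UU N)" for X
    using that by (auto simp: quot_bimod_carrier[OF q])
  have Qi: "N +>\<^bsub>UU\<^esub> q \<in> carrier (quot_bimod UU N)" if "q \<in> carrier UU" for q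
    using that by (auto simp: quot_bimod_carrier[OF B univ_bimod_bimodule[OF B] N])
  have "inj_on i (carrier (quot_bimod UU N))"
  proof (rule inj_onI)
    fix X Y assume XY: "X \<in> carrier (quot_bimod UU N)" "Y \<in> carrier (quot_bimod UU N)" and e: "i X = i Y"
    obtain x y where x: "x \<in> carrier UU" "X = N +>\<^bsub>UU\<^esub> x" and y: "y \<in> carrier UU" "Y = N +>\<^bsub>UU\<^esub> y"
      using Q[OF XY(1)] Q[OF XY(2)] by blast
    have "calc_map R G d x = calc_map R G d y" using e i[OF x(1)] i[OF y(1)] x(2) y(2) by simp
    then have "calc_map R G d (x \<ominus>\<^bsub>UU\<^esub> y) = \<zero>\<^bsub>G\<^esub>"
      using linear_map_diff[OF univ_bimod_module[OF B] bimodule_module[OF G] lin x(1) y(1)]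
        cl[OF x(1)] cl[OF y(1)] by (simp add: G.M.minus_eq_zero_iff)
    then have "x \<ominus>\<^bsub>UU\<^esub> y \<in> N" unfolding N_def using x(1) y(1) by blast
    then show "X = Y" using x y U.coset_eq_iff[OF Ns] by simp
  qed
  moreover have "i ` carrier (quot_bimod UU N) = carrier G"
  proof
    show "i ` carrier (quot_bimod UU N) \<subseteq> carrier G" using Q i cl by fastforce
    show "carrier G \<subseteq> i ` carrier (quot_bimod UU N)"
    proof
      fix x assume "x \<in> carrier G"
      then obtain q where "q \<in> carrier UU" "calc_map R G d q = x" by (rule calc_map_surj)
      then show "x \<in> i ` carrier (quot_bimod UU N)"
        using i Qi by (intro image_eqI[of _ _ "N +>\<^bsub>UU\<^esub> q"]) auto
    qed
  qed
  ultimately have "bij_betw i (carrier (quot_bimod UU N)) (carrier G)" by (simp add: bij_betw_def)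
  moreover have "linear_map R (quot_bimod UU N) G i"
  proof (rule linear_mapI)
    fix X assume "X \<in> carrier (quot_bimod UU N)"
    then show "i X \<in> carrier G" using Q i cl by fastforce
  next
    fix X Y assume "X \<in> carrier (quot_bimod UU N)" "Y \<in> carrier (quot_bimod UU N)"
    then obtain x y where x: "x \<in> carrier UU" "X = N +>\<^bsub>UU\<^esub> x" and y: "y \<in> carrier UU" "Y = N +>\<^bsub>UU\<^esub> y"
      using Q by meson
    show "i (X \<oplus>\<^bsub>quot_bimod UU N\<^esub> Y) = i X \<oplus>\<^bsub>G\<^esub> i Y"
      using x y i by (simp add: linear_map_add[OF p, symmetric] linear_map_add[OF lin])
  next
    fix c X assume c: "c \<in> carrier R" "X \<in> carrier (quot_bimod UU N)"
    then obtain x where x: "x \<in> carrier UU" "X = N +>\<^bsub>UU\<^esub> x" using Q by meson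
    show "i (c \<odot>\<^bsub>quot_bimod UU N\<^esub> X) = c \<odot>\<^bsub>G\<^esub> i X"
      using x c i by (simp add: linear_map_smult[OF p, symmetric] linear_map_smult[OF lin])
  qed
  moreover have "i (lact (quot_bimod UU N) a X) = lact G a (i X)"
    "i (ract (quot_bimod UU N) X a) = ract G (i X) a"
    if a: "a \<in> carrier B" and X: "X \<in> carrier (quot_bimod UU N)" for a X
  proof -
    obtain x where x: "x \<in> carrier UU" "X = N +>\<^bsub>UU\<^esub> x" using Q[OF X] by meson
    show "i (lact (quot_bimod UU N) a X) = lact G a (i X)"
      using x a i lc UT by (simp add: quot_bimod_lact[OF B univ_bimod_bimodule[OF B] N] calc_map_lact)
    show "i (ract (quot_bimod UU N) X a) = ract G (i X) a"
      using x a i rc UT l0 dcl rcl cl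
      by (simp add: quot_bimod_ract[OF B univ_bimod_bimodule[OF B] N] calc_map_ract)
  qed
  moreover have "i (N +>\<^bsub>UU\<^esub> univ_d R B a) = d a" if "a \<in> carrier B" for a
    using that i univ_d_closed[OF B] calc_map_univ_d by simp
  ultimately show ?thesis using that by blast
qed

end

end

end

section \<open>The Galois map\<close>

context hopf_group_coalgebra begin

abbreviation (input) "A1 \<equiv> A \<one>\<^bsub>P\<^esub>"

lemma mod: "\<alpha> \<in> carrier P \<Longrightarrow> module K (A \<alpha>)"
  and rng: "\<alpha> \<in> carrier P \<Longrightarrow> ring (A \<alpha>)"
  and mult_bilinear: "\<alpha> \<in> carrier P \<Longrightarrow> bilinear_map K (A \<alpha>) (A \<alpha>) (A \<alpha>) (\<lambda>a b. a \<otimes>\<^bsub>A \<alpha>\<^esub> b)"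
  using algebra by (simp_all add: k_algebra_def)

lemma one_closed: "\<alpha> \<in> carrier P \<Longrightarrow> \<one>\<^bsub>A \<alpha>\<^esub> \<in> carrier (A \<alpha>)"
  by (rule monoid.one_closed[OF ring.is_monoid[OF rng]])

lemma tens_mod: "\<lbrakk>\<alpha> \<in> carrier P; \<beta> \<in> carrier P\<rbrakk> \<Longrightarrow> module K (tensor K (A \<alpha>) (A \<beta>))"
  by (intro K.tensor_module mod)

lemma comult_linear:
  "\<lbrakk>\<alpha> \<in> carrier P; \<beta> \<in> carrier P\<rbrakk>
    \<Longrightarrow> linear_map K (A (\<alpha> \<otimes>\<^bsub>P\<^esub> \<beta>)) (tensor K (A \<alpha>) (A \<beta>)) (\<Delta> \<alpha> \<beta>)"
  using comult_hom by (simp add: alg_hom_def)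

lemma comult_mult:
  "\<lbrakk>\<alpha> \<in> carrier P; \<beta> \<in> carrier P; x \<in> carrier (A (\<alpha> \<otimes>\<^bsub>P\<^esub> \<beta>)); y \<in> carrier (A (\<alpha> \<otimes>\<^bsub>P\<^esub> \<beta>))\<rbrakk>
    \<Longrightarrow> \<Delta> \<alpha> \<beta> (x \<otimes>\<^bsub>A (\<alpha> \<otimes>\<^bsub>P\<^esub> \<beta>)\<^esub> y) = \<Delta> \<alpha> \<beta> x \<otimes>\<^bsub>tensor_alg K (A \<alpha>) (A \<beta>)\<^esub> \<Delta> \<alpha> \<beta> y"
  using comult_hom[of \<alpha> \<beta>] by (simp add: alg_hom_def ring_hom_def)

lemma comult_one:
  "\<lbrakk>\<alpha> \<in> carrier P; \<beta> \<in> carrier P\<rbrakk>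
    \<Longrightarrow> \<Delta> \<alpha> \<beta> \<one>\<^bsub>A (\<alpha> \<otimes>\<^bsub>P\<^esub> \<beta>)\<^esub> = tens K (A \<alpha>) (A \<beta>) \<one>\<^bsub>A \<alpha>\<^esub> \<one>\<^bsub>A \<beta>\<^esub>"
  using comult_hom[of \<alpha> \<beta>] by (simp add: alg_hom_def ring_hom_def)

lemma comult_1_linear:
  "\<alpha> \<in> carrier P \<Longrightarrow> linear_map K (A \<alpha>) (tensor K A1 (A \<alpha>)) (\<Delta> \<one>\<^bsub>P\<^esub> \<alpha>)"
  using comult_linear[of "\<one>\<^bsub>P\<^esub>" \<alpha>] by simp

lemma comult_1_mult:
  "\<lbrakk>\<alpha> \<in> carrier P; x \<in> carrier (A \<alpha>); y \<in> carrier (A \<alpha>)\<rbrakk>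
    \<Longrightarrow> \<Delta> \<one>\<^bsub>P\<^esub> \<alpha> (x \<otimes>\<^bsub>A \<alpha>\<^esub> y) = \<Delta> \<one>\<^bsub>P\<^esub> \<alpha> x \<otimes>\<^bsub>tensor_alg K A1 (A \<alpha>)\<^esub> \<Delta> \<one>\<^bsub>P\<^esub> \<alpha> y"
  using comult_mult[of "\<one>\<^bsub>P\<^esub>" \<alpha>] by simp

lemma counit_closed: "x \<in> carrier A1 \<Longrightarrow> \<epsilon> x \<in> carrier K"
  and counit_add: "\<lbrakk>x \<in> carrier A1; y \<in> carrier A1\<rbrakk> \<Longrightarrow> \<epsilon> (x \<oplus>\<^bsub>A1\<^esub> y) = \<epsilon> x \<oplus>\<^bsub>K\<^esub> \<epsilon> y"
  and counit_mult: "\<lbrakk>x \<in> carrier A1; y \<in> carrier A1\<rbrakk> \<Longrightarrow> \<epsilon> (x \<otimes>\<^bsub>A1\<^esub> y) = \<epsilon> x \<otimes>\<^bsub>K\<^esub> \<epsilon> y"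
  and counit_one: "\<epsilon> \<one>\<^bsub>A1\<^esub> = \<one>\<^bsub>K\<^esub>"
  using counit_hom by (auto simp: ring_hom_def)

text \<open>The working form of coassociativity: a trilinear expression in three legs may be
  computed by splitting either the first or the second leg of \<open>\<Delta> x\<close>. It
  transports the axiom through \<open>tensor_lift_assoc\<close>.\<close>

lemma comult_coassoc_lift:
  assumes "\<alpha> \<in> carrier P" "\<beta> \<in> carrier P" "\<gamma> \<in> carrier P" "module K Z"
    and F1: "\<And>u. u \<in> carrier (A \<alpha>) \<Longrightarrow> bilinear_map K (A \<beta>) (A \<gamma>) Z (F u)"
    and F2: "\<And>v w. \<lbrakk>v \<in> carrier (A \<beta>); w \<in> carrier (A \<gamma>)\<rbrakk> \<Longrightarrow> linear_map K (A \<alpha>) Z (\<lambda>u. F u v w)"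
    and x: "x \<in> carrier (A (\<alpha> \<otimes>\<^bsub>P\<^esub> \<beta> \<otimes>\<^bsub>P\<^esub> \<gamma>))"
  shows "tensor_lift K Z (\<lambda>y w. tensor_lift K Z (\<lambda>u v. F u v w) (\<Delta> \<alpha> \<beta> y)) (\<Delta> (\<alpha> \<otimes>\<^bsub>P\<^esub> \<beta>) \<gamma> x)
    = tensor_lift K Z (\<lambda>u y. tensor_lift K Z (F u) (\<Delta> \<beta> \<gamma> y)) (\<Delta> \<alpha> (\<beta> \<otimes>\<^bsub>P\<^esub> \<gamma>) x)"
proof -
  have pc: "\<alpha> \<otimes>\<^bsub>P\<^esub> \<beta> \<in> carrier P" "\<beta> \<otimes>\<^bsub>P\<^esub> \<gamma> \<in> carrier P" using assms by auto
  have x': "x \<in> carrier (A (\<alpha> \<otimes>\<^bsub>P\<^esub> (\<beta> \<otimes>\<^bsub>P\<^esub> \<gamma>)))" using x assms by (simp add: P.m_assoc)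
  note m = mod[OF assms(1)] mod[OF assms(2)] mod[OF assms(3)]
  note l3 = K.tensor_lift_left3[OF m assms(4) F1 F2] and r3 = K.tensor_lift_right3[OF m assms(4) F1 F2]
  note d1 = linear_map_closed[OF comult_linear[OF pc(1) assms(3)] x]
    and d2 = linear_map_closed[OF comult_linear[OF assms(1) pc(2)] x']
  note tab = tens_mod[OF assms(1,2)] and tbc = tens_mod[OF assms(2,3)]
  have "tensor_lift K Z (\<lambda>y w. tensor_lift K Z (\<lambda>u v. F u v w) (\<Delta> \<alpha> \<beta> y)) (\<Delta> (\<alpha> \<otimes>\<^bsub>P\<^esub> \<beta>) \<gamma> x)
    = tensor_lift K Z (\<lambda>X w. tensor_lift K Z (\<lambda>u v. F u v w) X)
        (tensor_map K (tensor K (A \<alpha>) (A \<beta>)) (A \<gamma>) (\<Delta> \<alpha> \<beta>) (\<lambda>y. y) (\<Delta> (\<alpha> \<otimes>\<^bsub>P\<^esub> \<beta>) \<gamma> x))"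
    by (rule K.tensor_lift_tensor_map[OF mod[OF pc(1)] m(3) tab m(3) comult_linear[OF assms(1,2)]
          linear_map_ident assms(4) l3 d1, symmetric])
  also have "\<dots> = tensor_lift K Z (\<lambda>u. tensor_lift K Z (F u)) (tensor_assoc K (A \<alpha>) (A \<beta>) (A \<gamma>)
        (tensor_map K (tensor K (A \<alpha>) (A \<beta>)) (A \<gamma>) (\<Delta> \<alpha> \<beta>) (\<lambda>y. y) (\<Delta> (\<alpha> \<otimes>\<^bsub>P\<^esub> \<beta>) \<gamma> x)))"
    by (rule K.tensor_lift_assoc[OF m assms(4) F1 F2, symmetric])
      (auto intro: linear_map_closed[OF K.tensor_map_linear[OF mod[OF pc(1)] m(3) tab m(3)
            comult_linear[OF assms(1,2)] linear_map_ident] d1])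
  also have "\<dots> = tensor_lift K Z (\<lambda>u. tensor_lift K Z (F u))
      (tensor_map K (A \<alpha>) (tensor K (A \<beta>) (A \<gamma>)) (\<lambda>y. y) (\<Delta> \<beta> \<gamma>) (\<Delta> \<alpha> (\<beta> \<otimes>\<^bsub>P\<^esub> \<gamma>) x))"
    by (simp add: coassoc[OF assms(1-3) x])
  also have "\<dots> = tensor_lift K Z (\<lambda>u y. tensor_lift K Z (F u) (\<Delta> \<beta> \<gamma> y)) (\<Delta> \<alpha> (\<beta> \<otimes>\<^bsub>P\<^esub> \<gamma>) x)"
    by (rule K.tensor_lift_tensor_map[OF m(1) mod[OF pc(2)] m(1) tbc linear_map_ident
          comult_linear[OF assms(2,3)] assms(4) r3 d2])
  finally show ?thesis .
qed

lemma counit_smult_bilinear: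
  assumes "module K V" "linear_map K U V f"
  shows "bilinear_map K U A1 V (\<lambda>u a. \<epsilon> a \<odot>\<^bsub>V\<^esub> f u)" "bilinear_map K A1 U V (\<lambda>a u. \<epsilon> a \<odot>\<^bsub>V\<^esub> f u)"
proof -
  show "bilinear_map K U A1 V (\<lambda>u a. \<epsilon> a \<odot>\<^bsub>V\<^esub> f u)"
    by (rule bilinear_map_smult(1)[OF assms counit_closed counit_add counit_smult])
  show "bilinear_map K A1 U V (\<lambda>a u. \<epsilon> a \<odot>\<^bsub>V\<^esub> f u)"
    by (rule bilinear_map_smult(2)[OF assms counit_closed counit_add counit_smult])
qed

section \<open>The map \<open>t\<close> in a fixed degree\<close>

context
  fixes \<alpha> assumes \<alpha>: "\<alpha> \<in> carrier P"
begin

interpretation A\<alpha>: ring "A \<alpha>" by (rule rng[OF \<alpha>])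
interpretation A\<alpha>m: module K "A \<alpha>" by (rule mod[OF \<alpha>])
interpretation A1: ring A1 by (rule rng[OF P.one_closed])

private lemmas m1 = mod[OF P.one_closed]
private lemmas ma = mod[OF \<alpha>]
private lemmas T1a = tens_mod[OF P.one_closed \<alpha>]
private lemmas alg1 = algebra[OF P.one_closed]
private lemmas alga = algebra[OF \<alpha>]

private lemmas mb = K.tensor_alg_bilinear[OF algebra[OF P.one_closed] algebra[OF \<alpha>]]
private abbreviation (input) "mul X Y \<equiv> X \<otimes>\<^bsub>tensor_alg K A1 (A \<alpha>)\<^esub> Y"
private abbreviation (input) "tn \<equiv> tens K A1 (A \<alpha>)"
private abbreviation (input) "ts \<equiv> tens K (A \<alpha>) (A \<alpha>)"
private abbreviation (input) "t \<equiv> t_map K P A \<Delta> \<alpha>"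
private abbreviation (input) "U\<alpha> \<equiv> univ_bimod K (A \<alpha>)"

private lemmas tn_cl = K.tens_closed[OF mod[OF P.one_closed] mod[OF \<alpha>]]
private lemmas dcl = linear_map_closed[OF comult_1_linear[OF \<alpha>]]

private lemma t_bil:
  "bilinear_map K (A \<alpha>) (A \<alpha>) (tensor K A1 (A \<alpha>)) (\<lambda>a b. mul (tn \<one>\<^bsub>A1\<^esub> a) (\<Delta> \<one>\<^bsub>P\<^esub> \<alpha> b))"
  by (rule bilinear_map_comp[OF mb bilinear_map_right[OF K.tens_bilinear[OF m1 ma] A1.one_closed]
        comult_1_linear[OF \<alpha>]])

lemma t_linear: "linear_map K (tensor K (A \<alpha>) (A \<alpha>)) (tensor K A1 (A \<alpha>)) t"
  unfolding t_map_def Let_def tensor_lift_tensor_alg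
  by (rule K.tensor_lift_linear[OF ma ma T1a t_bil])

lemma t_tens:
  "\<lbrakk>a \<in> carrier (A \<alpha>); b \<in> carrier (A \<alpha>)\<rbrakk> \<Longrightarrow> t (ts a b) = mul (tn \<one>\<^bsub>A1\<^esub> a) (\<Delta> \<one>\<^bsub>P\<^esub> \<alpha> b)"
  unfolding t_map_def Let_def tensor_lift_tensor_alg
  by (rule K.tensor_lift_tens[OF ma ma T1a t_bil])

lemma t_tens_one_left: "b \<in> carrier (A \<alpha>) \<Longrightarrow> t (ts \<one>\<^bsub>A \<alpha>\<^esub> b) = \<Delta> \<one>\<^bsub>P\<^esub> \<alpha> b"
  by (simp add: t_tens K.tensor_alg_l_one[OF alg1 alga] dcl)

lemma t_tens_one_right: "a \<in> carrier (A \<alpha>) \<Longrightarrow> t (ts a \<one>\<^bsub>A \<alpha>\<^esub>) = tn \<one>\<^bsub>A1\<^esub> a"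
  using comult_one[of "\<one>\<^bsub>P\<^esub>" \<alpha>] \<alpha> by (simp add: t_tens K.tensor_alg_tens[OF alg1 alga])

lemma t_lact:
  assumes "c \<in> carrier (A \<alpha>)" "q \<in> carrier (tensor K (A \<alpha>) (A \<alpha>))"
  shows "t (lact U\<alpha> c q) = mul (tn \<one>\<^bsub>A1\<^esub> c) (t q)"
proof (rule K.tensor_linear_ext[OF ma ma
      linear_map_comp[OF t_linear bilinear_map_right[OF K.univ_lact_bilinear[OF alga] assms(1)]]
      linear_map_comp[OF bilinear_map_right[OF mb tn_cl[OF A1.one_closed assms(1)]] t_linear] assms(2)])
  fix a b assume ab: "a \<in> carrier (A \<alpha>)" "b \<in> carrier (A \<alpha>)"
  then show "t (lact U\<alpha> c (ts a b)) = mul (tn \<one>\<^bsub>A1\<^esub> c) (t (ts a b))"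
    using assms(1) by (simp add: K.univ_lact_tens[OF alga] t_tens dcl tn_cl
        K.tensor_alg_assoc[OF alg1 alga, symmetric] K.tensor_alg_tens[OF alg1 alga])
qed

text \<open>Multiplicativity of \<open>\<Delta>\<close> gives \<open>(1 \<otimes> a) \<Delta>(b c) =
  (1 \<otimes> a) \<Delta>(b) \<Delta>(c)\<close>. With \<open>t_lact\<close> this trades the
  bimodule structure of \<open>A \<alpha> \<otimes> A \<alpha>\<close> for multiplications in the
  algebra \<open>A1 \<otimes> A \<alpha>\<close>.\<close>

lemma t_ract:
  assumes "c \<in> carrier (A \<alpha>)" "q \<in> carrier (tensor K (A \<alpha>) (A \<alpha>))"
  shows "t (ract U\<alpha> q c) = mul (t q) (\<Delta> \<one>\<^bsub>P\<^esub> \<alpha> c)"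
proof (rule K.tensor_linear_ext[OF ma ma
      linear_map_comp[OF t_linear bilinear_map_left[OF K.univ_ract_bilinear[OF alga] assms(1)]]
      linear_map_comp[OF bilinear_map_left[OF mb dcl[OF assms(1)]] t_linear] assms(2)])
  fix a b assume ab: "a \<in> carrier (A \<alpha>)" "b \<in> carrier (A \<alpha>)"
  then show "t (ract U\<alpha> (ts a b) c) = mul (t (ts a b)) (\<Delta> \<one>\<^bsub>P\<^esub> \<alpha> c)"
    using assms(1) by (simp add: K.univ_ract_tens[OF alga] t_tens dcl tn_cl comult_1_mult[OF \<alpha>]
        K.tensor_alg_assoc[OF alg1 alga])
qed

abbreviation (input) "counit_id \<equiv> tensor_lift K (A \<alpha>) (\<lambda>a b. \<epsilon> a \<odot>\<^bsub>A \<alpha>\<^esub> b)"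

private lemmas eb = counit_smult_bilinear(2)[OF mod[OF \<alpha>] linear_map_ident]

lemma counit_id_linear: "linear_map K (tensor K A1 (A \<alpha>)) (A \<alpha>) counit_id"
  by (rule K.tensor_lift_linear[OF m1 ma ma eb])

lemma counit_id_tens: "\<lbrakk>a \<in> carrier A1; b \<in> carrier (A \<alpha>)\<rbrakk> \<Longrightarrow> counit_id (tn a b) = \<epsilon> a \<odot>\<^bsub>A \<alpha>\<^esub> b"
  by (rule K.tensor_lift_tens[OF m1 ma ma eb])

text \<open>The factor \<open>a\<close> passes through \<open>\<epsilon> \<otimes> id\<close>, and
  the counit axiom reduces \<open>\<Delta> b\<close> to \<open>b\<close>. Thus \<open>t\<close>
  matches the kernel of the multiplication with the kernel of
  \<open>\<epsilon> \<otimes> id\<close>.\<close>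

lemma counit_id_t:
  assumes "q \<in> carrier (tensor K (A \<alpha>) (A \<alpha>))"
  shows "counit_id (t q) = tensor_mult K (A \<alpha>) q"
proof (rule K.tensor_linear_ext[OF ma ma linear_map_comp[OF counit_id_linear t_linear]
      K.tensor_mult_linear[OF alga] assms])
  fix a b assume ab: "a \<in> carrier (A \<alpha>)" "b \<in> carrier (A \<alpha>)"
  have "counit_id (mul (tn \<one>\<^bsub>A1\<^esub> a) Y) = a \<otimes>\<^bsub>A \<alpha>\<^esub> counit_id Y" if Y: "Y \<in> carrier (tensor K A1 (A \<alpha>))" for Y
    by (rule K.tensor_linear_ext[OF m1 ma
          linear_map_comp[OF counit_id_linear bilinear_map_right[OF mb tn_cl[OF A1.one_closed ab(1)]]]
          linear_map_comp[OF bilinear_map_right[OF mult_bilinear[OF \<alpha>] ab(1)] counit_id_linear] Y])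
      (simp add: K.tensor_alg_tens[OF alg1 alga] ab counit_id_tens counit_closed
        linear_map_smult[OF bilinear_map_right[OF mult_bilinear[OF \<alpha>]]])
  then show "counit_id (t (ts a b)) = tensor_mult K (A \<alpha>) (ts a b)"
    using ab by (simp add: t_tens dcl counit_left[OF \<alpha>] K.tensor_mult_tens[OF alga])
qed

end

end

section \<open>Consequences of the bijectivity of \<open>t\<close>\<close>

locale galois_hopf_group_coalgebra = hopf_group_coalgebra +
  assumes t_bij: "\<alpha> \<in> carrier P \<Longrightarrow>
      bij_betw (t_map K P A \<Delta> \<alpha>)
        (carrier (tensor K (A \<alpha>) (A \<alpha>))) (carrier (tensor K (A \<one>\<^bsub>P\<^esub>) (A \<alpha>)))"
begin

definition
  "t_inv \<alpha> = inv_into (carrier (tensor K (A \<alpha>) (A \<alpha>))) (t_map K P A \<Delta> \<alpha>)"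

context
  fixes \<alpha> assumes \<alpha>: "\<alpha> \<in> carrier P"
begin

lemma t_inv_linear: "linear_map K (tensor K A1 (A \<alpha>)) (tensor K (A \<alpha>) (A \<alpha>)) (t_inv \<alpha>)"
  unfolding t_inv_def by (rule linear_map_inv_into[OF tens_mod[OF \<alpha> \<alpha>] t_linear[OF \<alpha>] t_bij[OF \<alpha>]])

lemma t_t_inv: "X \<in> carrier (tensor K A1 (A \<alpha>)) \<Longrightarrow> t_map K P A \<Delta> \<alpha> (t_inv \<alpha> X) = X"
  unfolding t_inv_def using t_bij[OF \<alpha>] by (intro f_inv_into_f) (simp add: bij_betw_def)

lemma t_inv_t: "q \<in> carrier (tensor K (A \<alpha>) (A \<alpha>)) \<Longrightarrow> t_inv \<alpha> (t_map K P A \<Delta> \<alpha> q) = q"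
  unfolding t_inv_def using t_bij[OF \<alpha>] by (intro inv_into_f_f) (simp_all add: bij_betw_def)

text \<open>For a bijection, the image under the inverse is the preimage. The preimage form allows
  arguments by spans and linear maps.\<close>

lemma N_sub_iff:
  assumes "J \<subseteq> carrier A1"
  shows "q \<in> N_sub K P A \<Delta> J \<alpha> \<longleftrightarrow> q \<in> carrier (tensor K (A \<alpha>) (A \<alpha>))
    \<and> t_map K P A \<Delta> \<alpha> q \<in> tensor_sub K A1 (A \<alpha>) J"
proof -
  interpret T: module K "tensor K A1 (A \<alpha>)" by (rule tens_mod[OF P.one_closed \<alpha>])
  have "tensor_sub K A1 (A \<alpha>) J \<subseteq> carrier (tensor K A1 (A \<alpha>))"
    by (rule T.submoduleE(1)[OF K.tensor_sub_submodule(1)[OF mod[OF P.one_closed] mod[OF \<alpha>] assms]])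
  then show ?thesis
    unfolding N_sub_def t_inv_def[symmetric]
    using t_t_inv t_inv_t linear_map_closed[OF t_inv_linear] by (auto intro: image_eqI[of q "t_inv \<alpha>", OF t_inv_t[symmetric]])
qed

text \<open>Since \<open>J\<close> lies in \<open>ker \<epsilon>\<close>, the map
  \<open>\<epsilon> \<otimes> id\<close> kills \<open>J \<otimes> A \<alpha>\<close>, so elements of
  \<open>N_sub\<close> have product zero. The left action multiplies only the second leg. The right
  action multiplies by \<open>\<Delta> c\<close>, whose first leg acts on \<open>J\<close> from the
  right, and here the right ideal property enters.\<close>

lemma N_sub_sub_bimodule:
  assumes J: "right_ideal J A1" and Jk: "J \<subseteq> a_kernel A1 K \<epsilon>"
  shows "sub_bimodule K (A \<alpha>) (univ_bimod K (A \<alpha>)) (N_sub K P A \<Delta> J \<alpha>)"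
proof -
  let ?U = "univ_bimod K (A \<alpha>)" and ?N = "N_sub K P A \<Delta> J \<alpha>" and ?S = "tensor_sub K A1 (A \<alpha>) J"
  let ?T = "tensor K (A \<alpha>) (A \<alpha>)"
  interpret A\<alpha>: ring "A \<alpha>" by (rule rng[OF \<alpha>])
  interpret A1: ring A1 by (rule rng[OF P.one_closed])
  interpret Am: module K "A \<alpha>" by (rule mod[OF \<alpha>])
  interpret U: module K ?U by (rule K.univ_bimod_module[OF algebra[OF \<alpha>]])
  interpret T: module K ?T by (rule tens_mod[OF \<alpha> \<alpha>])
  have Jc: "J \<subseteq> carrier A1" and Je: "\<And>r. r \<in> J \<Longrightarrow> \<epsilon> r = \<zero>\<^bsub>K\<^esub>"
    using Jk by (auto simp: a_kernel_def')
  note m1 = mod[OF P.one_closed] and ma = mod[OF \<alpha>] and alg1 = algebra[OF P.one_closed] and alga = algebra[OF \<alpha>]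
  note mb = K.tensor_alg_bilinear[OF alg1 alga]
  note Ss = K.tensor_sub_submodule[OF m1 ma Jc]
  note tm = tens_mod[OF P.one_closed \<alpha>]
  note iff = N_sub_iff[OF Jc]
  have "?N = {q \<in> carrier ?T. t_map K P A \<Delta> \<alpha> q \<in> ?S}" using iff by blast
  then have NT: "submodule ?N K ?T"
    using K.submodule_vimage[OF tens_mod[OF \<alpha> \<alpha>] tm t_linear[OF \<alpha>] Ss(1)] by simp
  have NU: "?N \<subseteq> carrier ?U"
  proof
    fix q assume "q \<in> ?N"
    then have q: "q \<in> carrier ?T" "t_map K P A \<Delta> \<alpha> q \<in> ?S" using iff by auto
    have "counit_id \<alpha> (t_map K P A \<Delta> \<alpha> q) \<in> {\<zero>\<^bsub>A \<alpha>\<^esub>}"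
      by (rule K.linear_map_tensor_sub[OF m1 ma ma Jc counit_id_linear[OF \<alpha>] K.zero_submodule[OF ma] _ q(2)])
        (use Jc Je in \<open>auto simp: counit_id_tens[OF \<alpha>]\<close>)
    then show "q \<in> carrier ?U"
      using q(1) counit_id_t[OF \<alpha> q(1)] by (simp add: K.univ_bimod_simps[OF alga])
  qed
  have "submodule ?N K ?U"
  proof (rule U.submoduleI[OF NU])
    show "\<zero>\<^bsub>?U\<^esub> \<in> ?N"
      using subgroup.one_closed[OF submodule.axioms(1)[OF NT]] by (simp add: K.univ_bimod_simps[OF alga])
    show "\<ominus>\<^bsub>?U\<^esub> a \<in> ?N" if "a \<in> ?N" for a
      using T.submoduleE(3)[OF NT that] NU that by (subst K.a_inv_univ_bimod[OF alga]) auto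
  qed (use T.submoduleE(4,5)[OF NT] in \<open>auto simp: K.univ_bimod_simps[OF alga]\<close>)
  moreover have "lact ?U c q \<in> ?N" if c: "c \<in> carrier (A \<alpha>)" and q: "q \<in> ?N" for c q
  proof -
    have q: "q \<in> carrier ?T" "t_map K P A \<Delta> \<alpha> q \<in> ?S" using q iff by auto
    have "tens K A1 (A \<alpha>) \<one>\<^bsub>A1\<^esub> c \<otimes>\<^bsub>tensor_alg K A1 (A \<alpha>)\<^esub> t_map K P A \<Delta> \<alpha> q \<in> ?S"
      by (rule K.linear_map_tensor_sub[OF m1 ma tm Jc bilinear_map_right[OF mb K.tens_closed[OF m1 ma A1.one_closed c]]
            Ss(1) _ q(2)])
        (use Jc c Ss(2) in \<open>auto simp: K.tensor_alg_tens[OF alg1 alga] subset_iff\<close>)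
    then show ?thesis
      using q c by (simp add: iff t_lact[OF \<alpha>] bilinear_map_closed[OF K.univ_lact_bilinear[OF alga]])
  qed
  moreover have "ract ?U q c \<in> ?N" if c: "c \<in> carrier (A \<alpha>)" and q: "q \<in> ?N" for c q
  proof -
    have q: "q \<in> carrier ?T" "t_map K P A \<Delta> \<alpha> q \<in> ?S" using q iff by auto
    note dc = linear_map_closed[OF comult_1_linear[OF \<alpha>] c]
    have "t_map K P A \<Delta> \<alpha> q \<otimes>\<^bsub>tensor_alg K A1 (A \<alpha>)\<^esub> \<Delta> \<one>\<^bsub>P\<^esub> \<alpha> c \<in> ?S"
    proof (rule K.linear_map_tensor_sub[OF m1 ma tm Jc bilinear_map_left[OF mb dc] Ss(1) _ q(2)])
      fix x w assume x: "x \<in> J" and w: "w \<in> carrier (A \<alpha>)"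
      have xc: "x \<in> carrier A1" using x Jc by auto
      show "tens K A1 (A \<alpha>) x w \<otimes>\<^bsub>tensor_alg K A1 (A \<alpha>)\<^esub> \<Delta> \<one>\<^bsub>P\<^esub> \<alpha> c \<in> ?S"
        \<comment> \<open>Expands \<open>\<Delta> c\<close> into pure tensors
          \<open>a \<otimes> b\<close>, leaving \<open>x a \<otimes> w b\<close> with
          \<open>x a\<close> in \<open>J\<close>.\<close>
        by (rule K.linear_map_tensor_sub[OF m1 ma tm subset_refl
              bilinear_map_right[OF mb K.tens_closed[OF m1 ma xc w]] Ss(1) _ K.tensor_sub_carrier[OF m1 ma dc]])
          (use J x xc w Ss(2) in \<open>auto simp: K.tensor_alg_tens[OF alg1 alga] right_ideal_def\<close>)
    qed
    then show ?thesis
      using q c by (simp add: iff t_ract[OF \<alpha>] bilinear_map_closed[OF K.univ_ract_bilinear[OF alga]])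
  qed
  ultimately show ?thesis by (simp add: sub_bimodule_def)
qed

lemma t_inv_mult:
  assumes "c \<in> carrier (A \<alpha>)" "X \<in> carrier (tensor K A1 (A \<alpha>))"
  shows "t_inv \<alpha> (tens K A1 (A \<alpha>) \<one>\<^bsub>A1\<^esub> c \<otimes>\<^bsub>tensor_alg K A1 (A \<alpha>)\<^esub> X)
    = lact (univ_bimod K (A \<alpha>)) c (t_inv \<alpha> X)"
proof -
  note i = linear_map_closed[OF t_inv_linear assms(2)]
  have "t_inv \<alpha> (t_map K P A \<Delta> \<alpha> (lact (univ_bimod K (A \<alpha>)) c (t_inv \<alpha> X)))
      = lact (univ_bimod K (A \<alpha>)) c (t_inv \<alpha> X)"
    by (rule t_inv_t[OF bilinear_map_closed[OF K.univ_lact_bilinear[OF algebra[OF \<alpha>]] assms(1) i]])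
  then show ?thesis by (simp add: t_lact[OF \<alpha> assms(1) i] t_t_inv[OF assms(2)])
qed

end

end

section \<open>The inverse of the antipode\<close>

context galois_hopf_group_coalgebra begin

abbreviation (input) "A11 \<equiv> tensor K A1 A1"

text \<open>If \<open>S'\<close> is an inverse of the antipode and
  \<open>\<Delta> x = x1 \<otimes> x2\<close>, then the inverse of \<open>t\<close> sends
  \<open>x \<otimes> y\<close> to \<open>y S'(x2) \<otimes> x1\<close>. Applying
  \<open>id \<otimes> \<epsilon>\<close> yields \<open>y S'(x)\<close>, so \<open>S'\<close> can be
  read off from \<open>t\<close> alone, at \<open>y = 1\<close>.\<close>

definition "counit_t_inv X
  = tensor_lift K A1 (\<lambda>a b. \<epsilon> b \<odot>\<^bsub>A1\<^esub> a) (t_inv \<one>\<^bsub>P\<^esub> X)"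

text \<open>\<open>S_bar\<close> is the antipode of the co-opposite algebra of \<open>A\<^sub>1\<close>, that is, the
  inverse of the antipode.\<close>

definition "S_bar b = counit_t_inv (tens K A1 A1 b \<one>\<^bsub>A1\<^esub>)"

context begin

interpretation A1: ring A1 by (rule rng[OF P.one_closed])
interpretation A1m: module K A1 by (rule mod[OF P.one_closed])

private lemmas mA1 = mod[OF P.one_closed]
private lemmas alg1 = algebra[OF P.one_closed]
private lemmas mb1 = mult_bilinear[OF P.one_closed]
private lemmas tb1 = K.tens_bilinear[OF mod[OF P.one_closed] mod[OF P.one_closed]]
private lemmas tc1 = K.tens_closed[OF mod[OF P.one_closed] mod[OF P.one_closed]]
private lemmas dl1 = comult_1_linear[OF P.one_closed]
private lemmas Mb = K.tensor_alg_bilinear[OF algebra[OF P.one_closed] algebra[OF P.one_closed]]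
private lemmas cb = counit_smult_bilinear(1)[OF mod[OF P.one_closed] linear_map_ident]

lemma counit_t_inv_linear: "linear_map K A11 A1 counit_t_inv"
  unfolding counit_t_inv_def
  by (rule linear_map_comp[OF K.tensor_lift_linear[OF mA1 mA1 mA1 cb] t_inv_linear[OF P.one_closed]])

lemma counit_t_inv_t:
  "\<lbrakk>a \<in> carrier A1; b \<in> carrier A1\<rbrakk>
    \<Longrightarrow> counit_t_inv (t_map K P A \<Delta> \<one>\<^bsub>P\<^esub> (tens K A1 A1 a b)) = \<epsilon> b \<odot>\<^bsub>A1\<^esub> a"
  by (simp add: counit_t_inv_def t_inv_t[OF P.one_closed] tc1 K.tensor_lift_tens[OF mA1 mA1 mA1 cb])

lemma S_bar_linear: "linear_map K A1 A1 S_bar"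
  unfolding S_bar_def
  by (rule linear_map_comp[OF counit_t_inv_linear bilinear_map_left[OF tb1 A1.one_closed]])

private abbreviation (input) "F x y c \<equiv> counit_t_inv (tens K A1 A1 y c) \<otimes>\<^bsub>A1\<^esub> x"

private lemma F1: "x \<in> carrier A1 \<Longrightarrow> bilinear_map K A1 A1 A1 (\<lambda>y c. F x y c)"
  by (rule linear_bilinear_map_comp[OF linear_map_comp[OF bilinear_map_left[OF mb1] counit_t_inv_linear] tb1])

private lemma F2: "\<lbrakk>y \<in> carrier A1; c \<in> carrier A1\<rbrakk> \<Longrightarrow> linear_map K A1 A1 (\<lambda>x. F x y c)"
  by (rule bilinear_map_right[OF mb1 linear_map_closed[OF counit_t_inv_linear tc1]])

private lemmas left3 = K.tensor_lift_left3[OF mA1 mA1 mA1 mA1 F1 F2]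

private lemma J_bil: "bilinear_map K A1 A1 A1 (\<lambda>b c. tensor_lift K A1 (\<lambda>x y. F x y c) (\<Delta> \<one>\<^bsub>P\<^esub> \<one>\<^bsub>P\<^esub> b))"
  by (rule bilinear_map_comp[OF left3 dl1 linear_map_ident])

private abbreviation (input) "J \<equiv> tensor_lift K A1 (\<lambda>b c. tensor_lift K A1 (\<lambda>x y. F x y c) (\<Delta> \<one>\<^bsub>P\<^esub> \<one>\<^bsub>P\<^esub> b))"

text \<open>Write \<open>E\<close> for \<open>counit_t_inv\<close>, so that
  \<open>J(b \<otimes> c) = E(b2 \<otimes> c) b1\<close>. Then
  \<open>J(t(a \<otimes> b)) = E(b2 \<otimes> a b3) b1\<close>, where coassociativity recognizes
  \<open>E(t(a \<otimes> b2)) b1 = \<epsilon>(b2) a b1 = a b\<close>.\<close>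

private lemma J_t:
  assumes q: "q \<in> carrier A11"
  shows "J (t_map K P A \<Delta> \<one>\<^bsub>P\<^esub> q) = tensor_mult K A1 q"
proof (rule K.tensor_linear_ext[OF mA1 mA1
      linear_map_comp[OF K.tensor_lift_linear[OF mA1 mA1 mA1 J_bil] t_linear[OF P.one_closed]]
      K.tensor_mult_linear[OF alg1] q])
  fix a b assume a: "a \<in> carrier A1" and b: "b \<in> carrier A1"
  note ma = bilinear_map_right[OF mb1 a]
  have F1': "bilinear_map K A1 A1 A1 (\<lambda>y c. F x y (a \<otimes>\<^bsub>A1\<^esub> c))" if "x \<in> carrier A1" for x
    by (rule bilinear_map_comp[OF F1[OF that] linear_map_ident ma])
  have F2': "linear_map K A1 A1 (\<lambda>x. F x y (a \<otimes>\<^bsub>A1\<^esub> c))" if "y \<in> carrier A1" "c \<in> carrier A1" for y c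
    using F2[OF that(1) A1.m_closed[OF a that(2)]] .
  note l3 = K.tensor_lift_left3[OF mA1 mA1 mA1 mA1 F1' F2'] and r3 = K.tensor_lift_right3[OF mA1 mA1 mA1 mA1 F1' F2']
  have J'_bil: "bilinear_map K A1 A1 A1 (\<lambda>b c. tensor_lift K A1 (\<lambda>x y. F x y (a \<otimes>\<^bsub>A1\<^esub> c)) (\<Delta> \<one>\<^bsub>P\<^esub> \<one>\<^bsub>P\<^esub> b))"
    by (rule bilinear_map_comp[OF l3 dl1 linear_map_ident])
  have tl: "linear_map K A11 A11 (\<lambda>Y. tens K A1 A1 \<one>\<^bsub>A1\<^esub> a \<otimes>\<^bsub>tensor_alg K A1 A1\<^esub> Y)"
    by (rule bilinear_map_right[OF Mb tc1[OF A1.one_closed a]])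
  \<comment> \<open>Multiplying by \<open>1 \<otimes> a\<close> changes only the third argument of
    \<open>F\<close>, from \<open>c\<close> to \<open>a c\<close>.\<close>
  have J': "J (tens K A1 A1 \<one>\<^bsub>A1\<^esub> a \<otimes>\<^bsub>tensor_alg K A1 A1\<^esub> Y)
      = tensor_lift K A1 (\<lambda>b c. tensor_lift K A1 (\<lambda>x y. F x y (a \<otimes>\<^bsub>A1\<^esub> c)) (\<Delta> \<one>\<^bsub>P\<^esub> \<one>\<^bsub>P\<^esub> b)) Y"
    if Y: "Y \<in> carrier A11" for Y
    by (rule K.tensor_linear_ext[OF mA1 mA1 linear_map_comp[OF K.tensor_lift_linear[OF mA1 mA1 mA1 J_bil] tl]
          K.tensor_lift_linear[OF mA1 mA1 mA1 J'_bil] Y])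
      (simp add: a K.tensor_alg_tens[OF alg1 alg1] K.tensor_lift_tens[OF mA1 mA1 mA1 J_bil]
        K.tensor_lift_tens[OF mA1 mA1 mA1 J'_bil])
  \<comment> \<open>For fixed \<open>x\<close> the inner lift is
    \<open>E((1 \<otimes> a) Z) x\<close>; at \<open>Z = \<Delta> y\<close> the argument of
    \<open>E\<close> is \<open>t(a \<otimes> y)\<close>.\<close>
  have in_eq: "tensor_lift K A1 (\<lambda>y c. F x y (a \<otimes>\<^bsub>A1\<^esub> c)) Z
      = counit_t_inv (tens K A1 A1 \<one>\<^bsub>A1\<^esub> a \<otimes>\<^bsub>tensor_alg K A1 A1\<^esub> Z) \<otimes>\<^bsub>A1\<^esub> x"
    if x: "x \<in> carrier A1" and Z: "Z \<in> carrier A11" for x Z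
    by (rule K.tensor_linear_ext[OF mA1 mA1 K.tensor_lift_linear[OF mA1 mA1 mA1 F1'[OF x]]
          linear_map_comp[OF linear_map_comp[OF bilinear_map_left[OF mb1 x] counit_t_inv_linear] tl] Z])
      (simp add: a K.tensor_alg_tens[OF alg1 alg1] K.tensor_lift_tens[OF mA1 mA1 mA1 F1'[OF x]])
  note db = linear_map_closed[OF dl1 b]
  have "J (t_map K P A \<Delta> \<one>\<^bsub>P\<^esub> (tens K A1 A1 a b))
      = tensor_lift K A1 (\<lambda>b c. tensor_lift K A1 (\<lambda>x y. F x y (a \<otimes>\<^bsub>A1\<^esub> c)) (\<Delta> \<one>\<^bsub>P\<^esub> \<one>\<^bsub>P\<^esub> b)) (\<Delta> \<one>\<^bsub>P\<^esub> \<one>\<^bsub>P\<^esub> b)"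
    using a b by (simp add: t_tens[OF P.one_closed] J'[OF db])
  also have "\<dots> = tensor_lift K A1 (\<lambda>x y. tensor_lift K A1 (\<lambda>y c. F x y (a \<otimes>\<^bsub>A1\<^esub> c)) (\<Delta> \<one>\<^bsub>P\<^esub> \<one>\<^bsub>P\<^esub> y)) (\<Delta> \<one>\<^bsub>P\<^esub> \<one>\<^bsub>P\<^esub> b)"
    using comult_coassoc_lift[OF P.one_closed P.one_closed P.one_closed mA1 F1' F2'] b by simp
  also have "\<dots> = tensor_lift K A1 (\<lambda>x y. a \<otimes>\<^bsub>A1\<^esub> (\<epsilon> y \<odot>\<^bsub>A1\<^esub> x)) (\<Delta> \<one>\<^bsub>P\<^esub> \<one>\<^bsub>P\<^esub> b)"
  proof (rule K.tensor_lift_cong[OF mA1 mA1 mA1 bilinear_map_comp[OF r3 linear_map_ident dl1]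
        linear_bilinear_map_comp[OF ma cb] _ db])
    fix x y assume x: "x \<in> carrier A1" and y: "y \<in> carrier A1"
    have "tensor_lift K A1 (\<lambda>y c. F x y (a \<otimes>\<^bsub>A1\<^esub> c)) (\<Delta> \<one>\<^bsub>P\<^esub> \<one>\<^bsub>P\<^esub> y)
        = counit_t_inv (t_map K P A \<Delta> \<one>\<^bsub>P\<^esub> (tens K A1 A1 a y)) \<otimes>\<^bsub>A1\<^esub> x"
      by (simp add: in_eq[OF x linear_map_closed[OF dl1 y]] t_tens[OF P.one_closed a y])
    also have "\<dots> = a \<otimes>\<^bsub>A1\<^esub> (\<epsilon> y \<odot>\<^bsub>A1\<^esub> x)"
      using a x y counit_closed[OF y]
      by (simp add: counit_t_inv_t linear_map_smult[OF bilinear_map_right[OF mb1 a]]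
          linear_map_smult[OF bilinear_map_left[OF mb1 x]])
    finally show "tensor_lift K A1 (\<lambda>y c. F x y (a \<otimes>\<^bsub>A1\<^esub> c)) (\<Delta> \<one>\<^bsub>P\<^esub> \<one>\<^bsub>P\<^esub> y)
        = a \<otimes>\<^bsub>A1\<^esub> (\<epsilon> y \<odot>\<^bsub>A1\<^esub> x)" .
  qed
  also have "\<dots> = a \<otimes>\<^bsub>A1\<^esub> tensor_lift K A1 (\<lambda>x y. \<epsilon> y \<odot>\<^bsub>A1\<^esub> x) (\<Delta> \<one>\<^bsub>P\<^esub> \<one>\<^bsub>P\<^esub> b)"
    by (rule K.linear_tensor_lift[OF mA1 mA1 mA1 mA1 cb ma db, symmetric])
  also have "\<dots> = tensor_mult K A1 (tens K A1 A1 a b)"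
    using a b by (simp add: counit_right[OF P.one_closed] K.tensor_mult_tens[OF alg1])
  finally show "J (t_map K P A \<Delta> \<one>\<^bsub>P\<^esub> (tens K A1 A1 a b)) = tensor_mult K A1 (tens K A1 A1 a b)" .
qed

lemma S_bar_bilinear: "bilinear_map K A1 A1 A1 (\<lambda>u v. S_bar v \<otimes>\<^bsub>A1\<^esub> u)"
  using bilinear_map_comp[OF mb1 S_bar_linear linear_map_ident]
  by (auto intro: bilinear_mapI dest: bilinear_map_left bilinear_map_right)

text \<open>Both \<open>J\<close> and \<open>\<epsilon> \<otimes> id\<close> become the
  multiplication when composed with \<open>t\<close>. As \<open>t\<close> is onto, they agree, and
  at \<open>x \<otimes> 1\<close> they are the two sides.\<close>

lemma S_bar_comult:
  assumes x: "x \<in> carrier A1"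
  shows "tensor_lift K A1 (\<lambda>u v. S_bar v \<otimes>\<^bsub>A1\<^esub> u) (\<Delta> \<one>\<^bsub>P\<^esub> \<one>\<^bsub>P\<^esub> x) = \<epsilon> x \<odot>\<^bsub>A1\<^esub> \<one>\<^bsub>A1\<^esub>"
proof -
  let ?X = "tens K A1 A1 x \<one>\<^bsub>A1\<^esub>"
  have X: "?X \<in> carrier A11" by (rule tc1[OF x A1.one_closed])
  note q = linear_map_closed[OF t_inv_linear[OF P.one_closed] X] and tq = t_t_inv[OF P.one_closed X]
  have "tensor_lift K A1 (\<lambda>u v. S_bar v \<otimes>\<^bsub>A1\<^esub> u) (\<Delta> \<one>\<^bsub>P\<^esub> \<one>\<^bsub>P\<^esub> x) = J ?X"
    using x by (simp add: K.tensor_lift_tens[OF mA1 mA1 mA1 J_bil] S_bar_def)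
  also have "\<dots> = counit_id \<one>\<^bsub>P\<^esub> ?X"
    using J_t[OF q] counit_id_t[OF P.one_closed q] by (simp add: tq)
  also have "\<dots> = \<epsilon> x \<odot>\<^bsub>A1\<^esub> \<one>\<^bsub>A1\<^esub>" by (rule counit_id_tens[OF P.one_closed x A1.one_closed])
  finally show ?thesis .
qed

text \<open>The map in question is \<open>y \<otimes> x \<mapsto> x1 y \<otimes> x2\<close>. A left
  inverse is \<open>y \<otimes> x \<mapsto> S_bar(x1) y \<otimes> x2\<close>: the composite is
  \<open>S_bar(x2) x1 y \<otimes> x3\<close>, which \<open>S_bar_comult\<close> and the counit
  reduce to \<open>y \<otimes> x\<close>.\<close>

lemma comult_act_injective:
  fixes G :: "('a, 'e, 'g, 'h) bimod_scheme"
  assumes \<alpha>: "\<alpha> \<in> carrier P" and G: "bimodule K A1 G"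
    and X: "X \<in> carrier (tensor K G (A \<alpha>))"
    and X0: "tensor_lift K (tensor K G (A \<alpha>))
      (\<lambda>y x. tensor_lact K G (A \<alpha>) (\<Delta> \<one>\<^bsub>P\<^esub> \<alpha> x) (tens K G (A \<alpha>) y \<one>\<^bsub>A \<alpha>\<^esub>)) X = \<zero>\<^bsub>tensor K G (A \<alpha>)\<^esub>"
  shows "X = \<zero>\<^bsub>tensor K G (A \<alpha>)\<^esub>"
proof -
  let ?T = "tensor K G (A \<alpha>)" and ?tn = "tens K G (A \<alpha>)"
  note ma = mod[OF \<alpha>] and mG = bimodule_module[OF G] and alga = algebra[OF \<alpha>]
  note mT = K.tensor_module[OF mG ma]
  note lb = lact_bilinear[OF G] and tb = K.tens_bilinear[OF mG ma]
  note dl = comult_1_linear[OF \<alpha>]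
  have Fbil: "bilinear_map K G (A \<alpha>) ?T (\<lambda>y x. tensor_lact K G (A \<alpha>) (\<Delta> \<one>\<^bsub>P\<^esub> \<alpha> x) (?tn y \<one>\<^bsub>A \<alpha>\<^esub>))"
    by (rule bilinear_map_comp[OF K.tensor_lact_one_bilinear[OF alg1 alga G] linear_map_ident dl])
  have E1: "bilinear_map K A1 (A \<alpha>) ?T (\<lambda>u v. ?tn (lact G (S_bar u) y) v)" if "y \<in> carrier G" for y
    by (rule bilinear_map_comp[OF K.lact_tens_bilinear[OF alg1 alga G that] S_bar_linear linear_map_ident])
  have E2: "linear_map K G ?T (\<lambda>y. ?tn (lact G (S_bar u) y) v)" if "u \<in> carrier A1" "v \<in> carrier (A \<alpha>)" for u v
    by (rule linear_map_comp[OF bilinear_map_left[OF tb that(2)]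
          bilinear_map_right[OF lb linear_map_closed[OF S_bar_linear that(1)]]])
  have r3: "bilinear_map K G (tensor K A1 (A \<alpha>)) ?T (\<lambda>y. tensor_lift K ?T (\<lambda>u v. ?tn (lact G (S_bar u) y) v))"
    by (rule K.tensor_lift_right3[OF mG mA1 ma mT E1 E2])
  let ?Ft = "tensor_lift K ?T (\<lambda>y x. tensor_lact K G (A \<alpha>) (\<Delta> \<one>\<^bsub>P\<^esub> \<alpha> x) (?tn y \<one>\<^bsub>A \<alpha>\<^esub>))"
  let ?Gt = "tensor_lift K ?T (\<lambda>y x. tensor_lift K ?T (\<lambda>u v. ?tn (lact G (S_bar u) y) v) (\<Delta> \<one>\<^bsub>P\<^esub> \<alpha> x))"
  note Gbil = bilinear_map_comp[OF r3 linear_map_ident dl]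
  note Fl = K.tensor_lift_linear[OF mG ma mT Fbil] and Gl = K.tensor_lift_linear[OF mG ma mT Gbil]
  have "?Gt (?Ft X) = X"
  proof (rule K.tensor_linear_ext[OF mG ma linear_map_comp[OF Gl Fl] linear_map_ident X])
    fix y x assume y: "y \<in> carrier G" and x: "x \<in> carrier (A \<alpha>)"
    note dx = linear_map_closed[OF dl x]
    note ly = bilinear_map_left[OF lb y]
    have H1: "bilinear_map K A1 (A \<alpha>) ?T (\<lambda>u w. ?tn (lact G (S_bar u) (lact G a y)) w)" if "a \<in> carrier A1" for a
      by (rule E1[OF linear_map_closed[OF ly that]])
    have H2: "linear_map K A1 ?T (\<lambda>a. ?tn (lact G (S_bar u) (lact G a y)) w)"
      if "u \<in> carrier A1" "w \<in> carrier (A \<alpha>)" for u w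
      by (rule linear_map_comp[OF E2[OF that] ly])
    have hw: "linear_map K A1 ?T (\<lambda>c. ?tn (lact G c y) w)" if "w \<in> carrier (A \<alpha>)" for w
      by (rule linear_map_comp[OF bilinear_map_left[OF tb that] ly])
    have ty: "linear_map K (A \<alpha>) ?T (?tn y)" by (rule bilinear_map_right[OF tb y])
    note cba = counit_smult_bilinear(2)[OF ma linear_map_ident]
    have "?Gt (?Ft (?tn y x)) = ?Gt (tensor_lift K ?T (\<lambda>a b. ?tn (lact G a y) b) (\<Delta> \<one>\<^bsub>P\<^esub> \<alpha> x))"
      by (simp add: K.tensor_lift_tens[OF mG ma mT Fbil y x] K.tensor_lact_one_eq[OF alg1 alga G y dx])
    also have "\<dots> = tensor_lift K ?T (\<lambda>a b. ?Gt (?tn (lact G a y) b)) (\<Delta> \<one>\<^bsub>P\<^esub> \<alpha> x)"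
      by (rule K.linear_tensor_lift[OF mA1 ma mT mT K.lact_tens_bilinear[OF alg1 alga G y] Gl dx])
    also have "\<dots> = tensor_lift K ?T (\<lambda>a b. tensor_lift K ?T (\<lambda>u v. ?tn (lact G (S_bar u) (lact G a y)) v) (\<Delta> \<one>\<^bsub>P\<^esub> \<alpha> b)) (\<Delta> \<one>\<^bsub>P\<^esub> \<alpha> x)"
      by (rule K.tensor_lift_cong[OF mA1 ma mT linear_bilinear_map_comp[OF Gl K.lact_tens_bilinear[OF alg1 alga G y]]
            bilinear_map_comp[OF r3 ly dl] _ dx])
        (rule K.tensor_lift_tens[OF mG ma mT Gbil linear_map_closed[OF ly]])
    \<comment> \<open>Coassociativity groups the first two legs, on which \<open>S_bar\<close> can
      cancel.\<close>
    also have "\<dots> = tensor_lift K ?T (\<lambda>z w. tensor_lift K ?T (\<lambda>a u. ?tn (lact G (S_bar u) (lact G a y)) w) (\<Delta> \<one>\<^bsub>P\<^esub> \<one>\<^bsub>P\<^esub> z)) (\<Delta> \<one>\<^bsub>P\<^esub> \<alpha> x)"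
      using comult_coassoc_lift[OF P.one_closed P.one_closed \<alpha> mT H1 H2] x \<alpha> by simp
    also have "\<dots> = tensor_lift K ?T (\<lambda>z w. ?tn y (\<epsilon> z \<odot>\<^bsub>A \<alpha>\<^esub> w)) (\<Delta> \<one>\<^bsub>P\<^esub> \<alpha> x)"
    proof (rule K.tensor_lift_cong[OF mA1 ma mT
          bilinear_map_comp[OF K.tensor_lift_left3[OF mA1 mA1 ma mT H1 H2] dl1 linear_map_ident]
          linear_bilinear_map_comp[OF ty cba] _ dx])
      fix z w assume z: "z \<in> carrier A1" and w: "w \<in> carrier (A \<alpha>)"
      note dz = linear_map_closed[OF dl1 z]
      have b: "bilinear_map K A1 A1 ?T (\<lambda>a u. ?tn (lact G (S_bar u) (lact G a y)) w)"
        using w by (intro bilinear_mapI bilinear_map_left[OF H1] H2)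
      \<comment> \<open>The two successive actions merge into that of \<open>S_bar(z2) z1\<close>,
        which is the scalar \<open>\<epsilon>(z)\<close>.\<close>
      have "tensor_lift K ?T (\<lambda>a u. ?tn (lact G (S_bar u) (lact G a y)) w) (\<Delta> \<one>\<^bsub>P\<^esub> \<one>\<^bsub>P\<^esub> z)
          = tensor_lift K ?T (\<lambda>a u. ?tn (lact G (S_bar u \<otimes>\<^bsub>A1\<^esub> a) y) w) (\<Delta> \<one>\<^bsub>P\<^esub> \<one>\<^bsub>P\<^esub> z)"
        by (rule K.tensor_lift_cong[OF mA1 mA1 mT b linear_bilinear_map_comp[OF hw[OF w] S_bar_bilinear] _ dz])
          (simp add: lact_lact[OF G] linear_map_closed[OF S_bar_linear] y)
      also have "\<dots> = ?tn (lact G (tensor_lift K A1 (\<lambda>a u. S_bar u \<otimes>\<^bsub>A1\<^esub> a) (\<Delta> \<one>\<^bsub>P\<^esub> \<one>\<^bsub>P\<^esub> z)) y) w"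
        by (rule K.linear_tensor_lift[OF mA1 mA1 mA1 mT S_bar_bilinear hw[OF w] dz, symmetric])
      also have "\<dots> = \<epsilon> z \<odot>\<^bsub>?T\<^esub> ?tn y w"
        using linear_map_smult[OF hw[OF w] counit_closed[OF z] A1.one_closed]
        by (simp add: S_bar_comult[OF z] lact_one[OF G y])
      also have "\<dots> = ?tn y (\<epsilon> z \<odot>\<^bsub>A \<alpha>\<^esub> w)"
        by (rule linear_map_smult[OF ty counit_closed[OF z] w, symmetric])
      finally show "tensor_lift K ?T (\<lambda>a u. ?tn (lact G (S_bar u) (lact G a y)) w) (\<Delta> \<one>\<^bsub>P\<^esub> \<one>\<^bsub>P\<^esub> z)
          = ?tn y (\<epsilon> z \<odot>\<^bsub>A \<alpha>\<^esub> w)" .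
    qed
    also have "\<dots> = ?tn y (tensor_lift K (A \<alpha>) (\<lambda>z w. \<epsilon> z \<odot>\<^bsub>A \<alpha>\<^esub> w) (\<Delta> \<one>\<^bsub>P\<^esub> \<alpha> x))"
      by (rule K.linear_tensor_lift[OF mA1 ma ma mT cba ty dx, symmetric])
    also have "\<dots> = ?tn y x" by (simp add: counit_left[OF \<alpha> x])
    finally show "?Gt (?Ft (?tn y x)) = ?tn y x" .
  qed
  then show ?thesis using X0 linear_map_zero[OF mT mT Gl] by simp
qed

end

end

section \<open>Right covariant calculi\<close>

context galois_hopf_group_coalgebra begin

text \<open>These are the right invariant forms: \<open>cov_defect\<close> sends
  \<open>r \<otimes> 1\<close> to \<open>\<eta>(r) \<otimes> 1\<close>, so for a covariant calculus
  the coaction takes the form of \<open>r\<close> in degree \<alpha>\<beta> to the one in degree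
  \<alpha> tensored with 1.\<close>

definition "inv_form \<Gamma> d \<alpha> r
  = calc_map K (\<Gamma> \<alpha>) (d \<alpha>) (t_inv \<alpha> (tens K A1 (A \<alpha>) r \<one>\<^bsub>A \<alpha>\<^esub>))"

text \<open>Composed with \<open>t\<close>, this is \<open>a \<otimes> b \<mapsto> \<Delta>(a) (d \<otimes> id) \<Delta>(b)\<close>.\<close>

definition "cov_defect \<Gamma> d \<alpha> \<beta>
  = tensor_lift K (tensor K (\<Gamma> \<alpha>) (A \<beta>)) (\<lambda>r x.
      tensor_lact K (\<Gamma> \<alpha>) (A \<beta>) (\<Delta> \<alpha> \<beta> x) (tens K (\<Gamma> \<alpha>) (A \<beta>) (inv_form \<Gamma> d \<alpha> r) \<one>\<^bsub>A \<beta>\<^esub>))"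

context
  fixes \<Gamma> :: "_ \<Rightarrow> ('a, 'e, 'g, 'h) bimod_scheme" and d
  assumes fodc: "fodc K P A \<Gamma> d"
begin

private abbreviation (input) "\<omega> \<alpha> \<equiv> calc_map K (\<Gamma> \<alpha>) (d \<alpha>)"
private abbreviation (input) "\<eta> \<equiv> inv_form \<Gamma> d"

lemma fodc_degree: "\<alpha> \<in> carrier P \<Longrightarrow> first_order_calculus K (A \<alpha>) (\<Gamma> \<alpha>) (d \<alpha>)"
  using fodc by (simp add: fodc_iff)

lemma fodc_bimodule: "\<alpha> \<in> carrier P \<Longrightarrow> bimodule K (A \<alpha>) (\<Gamma> \<alpha>)"
  using fodc_degree by (simp add: first_order_calculus_def)

lemma fodc_linear: "\<alpha> \<in> carrier P \<Longrightarrow> linear_map K (A \<alpha>) (\<Gamma> \<alpha>) (d \<alpha>)"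
  using fodc_degree by (simp add: first_order_calculus_def)

lemma fodc_module: "\<alpha> \<in> carrier P \<Longrightarrow> module K (\<Gamma> \<alpha>)"
  by (rule bimodule_module[OF fodc_bimodule])

lemma omega_linear:
  "\<alpha> \<in> carrier P \<Longrightarrow> linear_map K (tensor K (A \<alpha>) (A \<alpha>)) (\<Gamma> \<alpha>) (\<omega> \<alpha>)"
  by (rule K.calc_map_linear[OF algebra fodc_degree])

lemma inv_form_linear:
  assumes \<alpha>: "\<alpha> \<in> carrier P"
  shows "linear_map K A1 (\<Gamma> \<alpha>) (\<eta> \<alpha>)"
  unfolding inv_form_def
  by (rule linear_map_comp[OF linear_map_comp[OF omega_linear[OF \<alpha>] t_inv_linear[OF \<alpha>]]
        bilinear_map_left[OF K.tens_bilinear[OF mod[OF P.one_closed] mod[OF \<alpha>]] one_closed[OF \<alpha>]]])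

text \<open>\<open>t(1 \<otimes> 1) = 1 \<otimes> 1\<close> and \<open>d 1 = 0\<close>.\<close>

lemma inv_form_one:
  assumes \<alpha>: "\<alpha> \<in> carrier P"
  shows "\<eta> \<alpha> \<one>\<^bsub>A1\<^esub> = \<zero>\<^bsub>\<Gamma> \<alpha>\<^esub>"
proof -
  have "t_inv \<alpha> (t_map K P A \<Delta> \<alpha> (tens K (A \<alpha>) (A \<alpha>) \<one>\<^bsub>A \<alpha>\<^esub> \<one>\<^bsub>A \<alpha>\<^esub>)) = tens K (A \<alpha>) (A \<alpha>) \<one>\<^bsub>A \<alpha>\<^esub> \<one>\<^bsub>A \<alpha>\<^esub>"
    by (rule t_inv_t[OF \<alpha> K.tens_closed[OF mod[OF \<alpha>] mod[OF \<alpha>] one_closed[OF \<alpha>] one_closed[OF \<alpha>]]])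
  then show ?thesis
    unfolding inv_form_def
    by (simp add: t_tens_one_right[OF \<alpha> one_closed[OF \<alpha>]] K.calc_map_tens_one[OF algebra[OF \<alpha>] fodc_degree[OF \<alpha>] one_closed[OF \<alpha>]])
qed

lemma inv_form_bilinear:
  assumes \<alpha>: "\<alpha> \<in> carrier P"
  shows "bilinear_map K A1 (A \<alpha>) (\<Gamma> \<alpha>) (\<lambda>r x. lact (\<Gamma> \<alpha>) x (\<eta> \<alpha> r))"
proof (rule bilinear_mapI)
  note lb = lact_bilinear[OF fodc_bimodule[OF \<alpha>]] and il = inv_form_linear[OF \<alpha>]
  show "linear_map K (A \<alpha>) (\<Gamma> \<alpha>) (\<lambda>x. lact (\<Gamma> \<alpha>) x (\<eta> \<alpha> r))" if "r \<in> carrier A1" for r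
    by (rule bilinear_map_left[OF lb linear_map_closed[OF il that]])
  show "linear_map K A1 (\<Gamma> \<alpha>) (\<lambda>r. lact (\<Gamma> \<alpha>) x (\<eta> \<alpha> r))" if "x \<in> carrier (A \<alpha>)" for x
    by (rule linear_map_comp[OF bilinear_map_right[OF lb that] il])
qed

text \<open>From \<open>r \<otimes> x = (1 \<otimes> x)(r \<otimes> 1)\<close> and left linearity of
  both maps. In particular the invariant forms generate the calculus as a left module.\<close>

lemma omega_t_inv_tens:
  assumes \<alpha>: "\<alpha> \<in> carrier P" and r: "r \<in> carrier A1" and x: "x \<in> carrier (A \<alpha>)"
  shows "\<omega> \<alpha> (t_inv \<alpha> (tens K A1 (A \<alpha>) r x)) = lact (\<Gamma> \<alpha>) x (\<eta> \<alpha> r)"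
proof -
  interpret A\<alpha>: ring "A \<alpha>" by (rule rng[OF \<alpha>])
  interpret A1: ring A1 by (rule rng[OF P.one_closed])
  note t1 = K.tens_closed[OF mod[OF P.one_closed] mod[OF \<alpha>] r A\<alpha>.one_closed]
  have "tens K A1 (A \<alpha>) r x
      = tens K A1 (A \<alpha>) \<one>\<^bsub>A1\<^esub> x \<otimes>\<^bsub>tensor_alg K A1 (A \<alpha>)\<^esub> tens K A1 (A \<alpha>) r \<one>\<^bsub>A \<alpha>\<^esub>"
    using r x by (simp add: K.tensor_alg_tens[OF algebra[OF P.one_closed] algebra[OF \<alpha>]])
  then show ?thesis
    using K.calc_map_lact[OF algebra[OF \<alpha>] fodc_degree[OF \<alpha>] x linear_map_closed[OF t_inv_linear[OF \<alpha>] t1]]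
    by (simp add: t_inv_mult[OF \<alpha> x t1] inv_form_def)
qed

lemma omega_t_inv:
  assumes \<alpha>: "\<alpha> \<in> carrier P" and X: "X \<in> carrier (tensor K A1 (A \<alpha>))"
  shows "\<omega> \<alpha> (t_inv \<alpha> X) = tensor_lift K (\<Gamma> \<alpha>) (\<lambda>r x. lact (\<Gamma> \<alpha>) x (\<eta> \<alpha> r)) X"
proof -
  note m = mod[OF P.one_closed] mod[OF \<alpha>]
  note ib = inv_form_bilinear[OF \<alpha>]
  show ?thesis
    by (rule K.tensor_linear_ext[OF m linear_map_comp[OF omega_linear[OF \<alpha>] t_inv_linear[OF \<alpha>]]
          K.tensor_lift_linear[OF m fodc_module[OF \<alpha>] ib] X])
      (simp add: omega_t_inv_tens[OF \<alpha>] K.tensor_lift_tens[OF m fodc_module[OF \<alpha>] ib])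
qed

text \<open>Since \<open>t(1 \<otimes> y) = \<Delta> y\<close>, the differential is recovered from
  the invariant forms as \<open>d y = y2 \<eta>(y1)\<close>.\<close>

lemma d_eq_comult:
  assumes \<alpha>: "\<alpha> \<in> carrier P" and y: "y \<in> carrier (A \<alpha>)"
  shows "tensor_lift K (\<Gamma> \<alpha>) (\<lambda>r x. lact (\<Gamma> \<alpha>) x (\<eta> \<alpha> r)) (\<Delta> \<one>\<^bsub>P\<^esub> \<alpha> y) = d \<alpha> y"
proof -
  note ty = K.tens_closed[OF mod[OF \<alpha>] mod[OF \<alpha>] one_closed[OF \<alpha>] y]
  have "t_inv \<alpha> (\<Delta> \<one>\<^bsub>P\<^esub> \<alpha> y) = tens K (A \<alpha>) (A \<alpha>) \<one>\<^bsub>A \<alpha>\<^esub> y"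
    using t_inv_t[OF \<alpha> ty] by (simp add: t_tens_one_left[OF \<alpha> y])
  then show ?thesis
    using omega_t_inv[OF \<alpha> linear_map_closed[OF comult_1_linear[OF \<alpha>] y]]
    by (simp add: K.calc_map_tens[OF algebra[OF \<alpha>] fodc_degree[OF \<alpha>] one_closed[OF \<alpha>] y]
        lact_one[OF fodc_bimodule[OF \<alpha>]] linear_map_closed[OF fodc_linear[OF \<alpha>] y])
qed

section \<open>Right covariance for a pair of degrees\<close>

context
  fixes \<alpha> \<beta> assumes \<alpha>: "\<alpha> \<in> carrier P" and \<beta>: "\<beta> \<in> carrier P"
begin

private lemma \<alpha>\<beta>: "\<alpha> \<otimes>\<^bsub>P\<^esub> \<beta> \<in> carrier P" using \<alpha> \<beta> by simp

private abbreviation (input) "TG \<equiv> tensor K (\<Gamma> \<alpha>) (A \<beta>)"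
private abbreviation (input) "tG \<equiv> tens K (\<Gamma> \<alpha>) (A \<beta>)"
private abbreviation (input) "la \<equiv> tensor_lact K (\<Gamma> \<alpha>) (A \<beta>)"
private abbreviation (input) "\<alpha>b \<equiv> \<alpha> \<otimes>\<^bsub>P\<^esub> \<beta>"
private abbreviation (input) "\<Psi> \<equiv> cov_defect \<Gamma> d \<alpha> \<beta>"

private lemmas m1 = mod[OF P.one_closed]
private lemmas ma = mod[OF \<alpha>]
private lemmas mb = mod[OF \<beta>]
private lemmas mab = mod[OF \<alpha>\<beta>]
private lemmas mG = fodc_module[OF \<alpha>]
private lemmas mTG = K.tensor_module[OF fodc_module[OF \<alpha>] mod[OF \<beta>]]
private lemmas bG = fodc_bimodule[OF \<alpha>]
private lemmas alga = algebra[OF \<alpha>]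
private lemmas algb = algebra[OF \<beta>]
private lemmas lab = K.tensor_lact_bilinear[OF algebra[OF \<alpha>] algebra[OF \<beta>] fodc_bimodule[OF \<alpha>]]
private lemmas cl = comult_linear[OF \<alpha> \<beta>]

private lemma one_bil:
  "bilinear_map K A1 (A \<alpha>b) TG (\<lambda>r x. la (\<Delta> \<alpha> \<beta> x) (tG (\<eta> \<alpha> r) \<one>\<^bsub>A \<beta>\<^esub>))"
  by (rule bilinear_map_comp[OF K.tensor_lact_one_bilinear[OF alga algb bG] inv_form_linear[OF \<alpha>] cl])

lemma cov_defect_linear: "linear_map K (tensor K A1 (A \<alpha>b)) TG \<Psi>"
  unfolding cov_defect_def by (rule K.tensor_lift_linear[OF m1 mab mTG one_bil])

lemma cov_defect_tens:
  "\<lbrakk>r \<in> carrier A1; x \<in> carrier (A \<alpha>b)\<rbrakk>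
    \<Longrightarrow> \<Psi> (tens K A1 (A \<alpha>b) r x) = la (\<Delta> \<alpha> \<beta> x) (tG (\<eta> \<alpha> r) \<one>\<^bsub>A \<beta>\<^esub>)"
  unfolding cov_defect_def by (rule K.tensor_lift_tens[OF m1 mab mTG one_bil])

text \<open>In legs of degrees 1, \<alpha>, \<beta>, both sides are
  \<open>b2 \<eta>(b1) \<otimes> b3\<close>: on the left by \<open>d_eq_comult\<close> in the first
  factor, on the right by splitting the second leg.\<close>

lemma tensor_map_d_comult:
  assumes b: "b \<in> carrier (A \<alpha>b)"
  shows "tensor_map K (\<Gamma> \<alpha>) (A \<beta>) (d \<alpha>) (\<lambda>y. y) (\<Delta> \<alpha> \<beta> b) = \<Psi> (\<Delta> \<one>\<^bsub>P\<^esub> \<alpha>b b)"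
proof -
  note db = linear_map_closed[OF cl b] and d1b = linear_map_closed[OF comult_1_linear[OF \<alpha>\<beta>] b]
  note il = inv_form_linear[OF \<alpha>] and icl = linear_map_closed[OF inv_form_linear[OF \<alpha>]]
  note tb = K.tens_bilinear[OF mG mb] and lb = lact_bilinear[OF bG]
  have F1: "bilinear_map K (A \<alpha>) (A \<beta>) TG (\<lambda>x v. tG (lact (\<Gamma> \<alpha>) x (\<eta> \<alpha> r)) v)" if "r \<in> carrier A1" for r
    by (rule K.lact_tens_bilinear[OF alga algb bG icl[OF that]])
  have F2: "linear_map K A1 TG (\<lambda>r. tG (lact (\<Gamma> \<alpha>) x (\<eta> \<alpha> r)) v)" if "x \<in> carrier (A \<alpha>)" "v \<in> carrier (A \<beta>)" for x v
    by (rule linear_map_comp[OF bilinear_map_left[OF tb that(2)] linear_map_comp[OF bilinear_map_right[OF lb that(1)] il]])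
  have r3: "bilinear_map K A1 (tensor K (A \<alpha>) (A \<beta>)) TG (\<lambda>r. tensor_lift K TG (\<lambda>x v. tG (lact (\<Gamma> \<alpha>) x (\<eta> \<alpha> r)) v))"
    by (rule K.tensor_lift_right3[OF m1 ma mb mTG F1 F2])
  have l3: "bilinear_map K (tensor K A1 (A \<alpha>)) (A \<beta>) TG (\<lambda>X v. tensor_lift K TG (\<lambda>r x. tG (lact (\<Gamma> \<alpha>) x (\<eta> \<alpha> r)) v) X)"
    by (rule K.tensor_lift_left3[OF m1 ma mb mTG F1 F2])
  have "tensor_map K (\<Gamma> \<alpha>) (A \<beta>) (d \<alpha>) (\<lambda>y. y) (\<Delta> \<alpha> \<beta> b)
      = tensor_lift K TG (\<lambda>y v. tG (d \<alpha> y) v) (\<Delta> \<alpha> \<beta> b)"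
    by (simp add: tensor_map_def)
  also have "\<dots> = tensor_lift K TG (\<lambda>y v. tensor_lift K TG (\<lambda>r x. tG (lact (\<Gamma> \<alpha>) x (\<eta> \<alpha> r)) v) (\<Delta> \<one>\<^bsub>P\<^esub> \<alpha> y)) (\<Delta> \<alpha> \<beta> b)"
  proof (rule K.tensor_lift_cong[OF ma mb mTG bilinear_map_comp[OF tb fodc_linear[OF \<alpha>] linear_map_ident]
        bilinear_map_comp[OF l3 comult_1_linear[OF \<alpha>] linear_map_ident] _ db])
    fix y v assume y: "y \<in> carrier (A \<alpha>)" and v: "v \<in> carrier (A \<beta>)"
    show "tG (d \<alpha> y) v = tensor_lift K TG (\<lambda>r x. tG (lact (\<Gamma> \<alpha>) x (\<eta> \<alpha> r)) v) (\<Delta> \<one>\<^bsub>P\<^esub> \<alpha> y)"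
      using K.linear_tensor_lift[OF m1 ma mG mTG inv_form_bilinear[OF \<alpha>] bilinear_map_left[OF tb v]
          linear_map_closed[OF comult_1_linear[OF \<alpha>] y]]
      by (simp add: d_eq_comult[OF \<alpha> y])
  qed
  \<comment> \<open>Coassociativity moves the split from the leg carrying \<open>d\<close> to the
    leg of degree \<alpha>\<beta>.\<close>
  also have "\<dots> = tensor_lift K TG (\<lambda>r y. tensor_lift K TG (\<lambda>x v. tG (lact (\<Gamma> \<alpha>) x (\<eta> \<alpha> r)) v) (\<Delta> \<alpha> \<beta> y)) (\<Delta> \<one>\<^bsub>P\<^esub> \<alpha>b b)"
    using comult_coassoc_lift[OF P.one_closed \<alpha> \<beta> mTG F1 F2] b \<alpha> by simp
  also have "\<dots> = \<Psi> (\<Delta> \<one>\<^bsub>P\<^esub> \<alpha>b b)"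
    unfolding cov_defect_def
    by (rule K.tensor_lift_cong[OF m1 mab mTG bilinear_map_comp[OF r3 linear_map_ident cl] one_bil _ d1b])
      (rule K.tensor_lact_one_eq[OF alga algb bG icl linear_map_closed[OF cl], symmetric])
  finally show ?thesis .
qed

text \<open>Multiplicativity of \<open>\<Delta>\<close>: on \<open>r \<otimes> x\<close> the left
  side is \<open>\<Delta>(a x)\<close> acting on \<open>\<eta>(r) \<otimes> 1\<close>.\<close>

lemma cov_defect_mult:
  assumes a: "a \<in> carrier (A \<alpha>b)" and X: "X \<in> carrier (tensor K A1 (A \<alpha>b))"
  shows "\<Psi> (tens K A1 (A \<alpha>b) \<one>\<^bsub>A1\<^esub> a \<otimes>\<^bsub>tensor_alg K A1 (A \<alpha>b)\<^esub> X) = la (\<Delta> \<alpha> \<beta> a) (\<Psi> X)"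
proof -
  interpret A1: ring A1 by (rule rng[OF P.one_closed])
  interpret Ab: ring "A \<beta>" by (rule rng[OF \<beta>])
  interpret Aab: ring "A \<alpha>b" by (rule rng[OF \<alpha>\<beta>])
  note algs = algebra[OF P.one_closed] algebra[OF \<alpha>\<beta>]
  note ta = K.tens_closed[OF m1 mab A1.one_closed a]
  show ?thesis
  proof (rule K.tensor_linear_ext[OF m1 mab
        linear_map_comp[OF cov_defect_linear bilinear_map_right[OF K.tensor_alg_bilinear[OF algs] ta]]
        linear_map_comp[OF bilinear_map_right[OF lab linear_map_closed[OF cl a]] cov_defect_linear] X])
    fix r x assume r: "r \<in> carrier A1" and x: "x \<in> carrier (A \<alpha>b)"
    note g = K.tens_closed[OF mG mb linear_map_closed[OF inv_form_linear[OF \<alpha>] r] Ab.one_closed]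
    show "\<Psi> (tens K A1 (A \<alpha>b) \<one>\<^bsub>A1\<^esub> a \<otimes>\<^bsub>tensor_alg K A1 (A \<alpha>b)\<^esub> tens K A1 (A \<alpha>b) r x)
        = la (\<Delta> \<alpha> \<beta> a) (\<Psi> (tens K A1 (A \<alpha>b) r x))"
      using a r x by (simp add: K.tensor_alg_tens[OF algs] cov_defect_tens comult_mult[OF \<alpha> \<beta>]
          K.tensor_lact_mult[OF alga algb bG linear_map_closed[OF cl a] linear_map_closed[OF cl x] g])
  qed
qed

lemma cov_defect_t_tens:
  assumes a: "a \<in> carrier (A \<alpha>b)" and b: "b \<in> carrier (A \<alpha>b)"
  shows "\<Psi> (t_map K P A \<Delta> \<alpha>b (tens K (A \<alpha>b) (A \<alpha>b) a b))
    = la (\<Delta> \<alpha> \<beta> a) (tensor_map K (\<Gamma> \<alpha>) (A \<beta>) (d \<alpha>) (\<lambda>y. y) (\<Delta> \<alpha> \<beta> b))"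
  by (simp add: t_tens[OF \<alpha>\<beta> a b] cov_defect_mult[OF a linear_map_closed[OF comult_1_linear[OF \<alpha>\<beta>] b]]
      tensor_map_d_comult[OF b])

text \<open>Because \<open>\<Delta> 1 = 1 \<otimes> 1\<close> and \<open>d 1 = 0\<close>. It lets a
  kernel element be replaced by its retraction into the universal bimodule.\<close>

lemma cov_defect_t_one:
  assumes a: "a \<in> carrier (A \<alpha>b)"
  shows "\<Psi> (t_map K P A \<Delta> \<alpha>b (tens K (A \<alpha>b) (A \<alpha>b) a \<one>\<^bsub>A \<alpha>b\<^esub>)) = \<zero>\<^bsub>TG\<^esub>"
proof -
  note o = one_closed[OF \<alpha>] one_closed[OF \<beta>]
  have "tensor_map K (\<Gamma> \<alpha>) (A \<beta>) (d \<alpha>) (\<lambda>y. y) (\<Delta> \<alpha> \<beta> \<one>\<^bsub>A \<alpha>b\<^esub>) = \<zero>\<^bsub>TG\<^esub>"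
    using o by (simp add: comult_one[OF \<alpha> \<beta>] K.tensor_map_tens[OF ma mb mG mb fodc_linear[OF \<alpha>] linear_map_ident]
        K.calculus_d_one[OF alga fodc_degree[OF \<alpha>]] K.tens_zero_left[OF mG mb])
  then show ?thesis
    using linear_map_zero[OF mTG mTG bilinear_map_right[OF lab linear_map_closed[OF cl a]]]
    by (simp add: cov_defect_t_tens[OF a one_closed[OF \<alpha>\<beta>]])
qed

text \<open>Packing a family into one tensor \<open>q\<close> makes the two sums in the covariance
  condition values of linear maps at \<open>q\<close>.\<close>

private lemma sums:
  fixes n :: nat
  assumes a: "a \<in> {..<n} \<rightarrow> carrier (A \<alpha>b)" and b: "b \<in> {..<n} \<rightarrow> carrier (A \<alpha>b)"
  defines "q \<equiv> \<Oplus>\<^bsub>tensor K (A \<alpha>b) (A \<alpha>b)\<^esub> k\<in>{..<n}. tens K (A \<alpha>b) (A \<alpha>b) (a k) (b k)"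
  shows "q \<in> carrier (tensor K (A \<alpha>b) (A \<alpha>b))"
    and "\<omega> \<alpha>b q = (\<Oplus>\<^bsub>\<Gamma> \<alpha>b\<^esub> k\<in>{..<n}. lact (\<Gamma> \<alpha>b) (a k) (d \<alpha>b (b k)))"
    and "\<Psi> (t_map K P A \<Delta> \<alpha>b q) = (\<Oplus>\<^bsub>TG\<^esub> k\<in>{..<n}.
      la (\<Delta> \<alpha> \<beta> (a k)) (tensor_map K (\<Gamma> \<alpha>) (A \<beta>) (d \<alpha>) (\<lambda>y. y) (\<Delta> \<alpha> \<beta> (b k))))"
proof -
  let ?T = "tensor K (A \<alpha>b) (A \<alpha>b)" and ?tt = "tens K (A \<alpha>b) (A \<alpha>b)"
  note mT = tens_mod[OF \<alpha>\<beta> \<alpha>\<beta>]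
  interpret T: module K ?T by (rule mT)
  interpret G: module K "\<Gamma> \<alpha>b" by (rule fodc_module[OF \<alpha>\<beta>])
  interpret TG: module K TG by (rule mTG)
  have ab: "a k \<in> carrier (A \<alpha>b)" "b k \<in> carrier (A \<alpha>b)" if "k < n" for k using a b that by (auto simp: Pi_def)
  have t: "(\<lambda>k. ?tt (a k) (b k)) \<in> {..<n} \<rightarrow> carrier ?T"
    using ab by (auto intro!: K.tens_closed[OF mab mab])
  show "q \<in> carrier ?T" unfolding q_def by (rule T.M.finsum_closed[OF t])
  note ol = omega_linear[OF \<alpha>\<beta>]
  note pl = linear_map_comp[OF cov_defect_linear t_linear[OF \<alpha>\<beta>]]
  have "\<omega> \<alpha>b q = (\<Oplus>\<^bsub>\<Gamma> \<alpha>b\<^esub> k\<in>{..<n}. \<omega> \<alpha>b (?tt (a k) (b k)))"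
    unfolding q_def by (rule linear_map_finsum[OF mT fodc_module[OF \<alpha>\<beta>] ol _ t]) simp
  also have "\<dots> = (\<Oplus>\<^bsub>\<Gamma> \<alpha>b\<^esub> k\<in>{..<n}. lact (\<Gamma> \<alpha>b) (a k) (d \<alpha>b (b k)))"
    using ab linear_map_closed[OF ol] K.tens_closed[OF mab mab]
      bilinear_map_closed[OF lact_bilinear[OF fodc_bimodule[OF \<alpha>\<beta>]]] linear_map_closed[OF fodc_linear[OF \<alpha>\<beta>]]
    by (intro G.M.finsum_cong') (auto simp: K.calc_map_tens[OF algebra[OF \<alpha>\<beta>] fodc_degree[OF \<alpha>\<beta>]])
  finally show "\<omega> \<alpha>b q = (\<Oplus>\<^bsub>\<Gamma> \<alpha>b\<^esub> k\<in>{..<n}. lact (\<Gamma> \<alpha>b) (a k) (d \<alpha>b (b k)))" .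
  have "\<Psi> (t_map K P A \<Delta> \<alpha>b q) = (\<Oplus>\<^bsub>TG\<^esub> k\<in>{..<n}. \<Psi> (t_map K P A \<Delta> \<alpha>b (?tt (a k) (b k))))"
    unfolding q_def by (rule linear_map_finsum[OF mT mTG pl _ t]) simp
  also have "\<dots> = (\<Oplus>\<^bsub>TG\<^esub> k\<in>{..<n}.
      la (\<Delta> \<alpha> \<beta> (a k)) (tensor_map K (\<Gamma> \<alpha>) (A \<beta>) (d \<alpha>) (\<lambda>y. y) (\<Delta> \<alpha> \<beta> (b k))))"
  proof (rule TG.M.finsum_cong'[OF refl])
    show "(\<lambda>k. la (\<Delta> \<alpha> \<beta> (a k)) (tensor_map K (\<Gamma> \<alpha>) (A \<beta>) (d \<alpha>) (\<lambda>y. y) (\<Delta> \<alpha> \<beta> (b k)))) \<in> {..<n} \<rightarrow> carrier TG"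
      using ab linear_map_closed[OF pl] K.tens_closed[OF mab mab]
      by (auto simp: cov_defect_t_tens[symmetric])
  qed (use ab cov_defect_t_tens in auto)
  finally show "\<Psi> (t_map K P A \<Delta> \<alpha>b q) = (\<Oplus>\<^bsub>TG\<^esub> k\<in>{..<n}.
      la (\<Delta> \<alpha> \<beta> (a k)) (tensor_map K (\<Gamma> \<alpha>) (A \<beta>) (d \<alpha>) (\<lambda>y. y) (\<Delta> \<alpha> \<beta> (b k))))" .
qed

text \<open>The covariance condition speaks of families, but both of its sums depend only on the
  tensor that the family represents, and every tensor is represented by some family.\<close>

lemma right_covariant_degree_iff:
  "(\<forall>(n::nat) a b. a \<in> {..<n} \<rightarrow> carrier (A \<alpha>b) \<longrightarrow> b \<in> {..<n} \<rightarrow> carrier (A \<alpha>b) \<longrightarrow>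
      (\<Oplus>\<^bsub>\<Gamma> \<alpha>b\<^esub> k \<in> {..<n}. lact (\<Gamma> \<alpha>b) (a k) (d \<alpha>b (b k))) = \<zero>\<^bsub>\<Gamma> \<alpha>b\<^esub> \<longrightarrow>
      (\<Oplus>\<^bsub>TG\<^esub> k \<in> {..<n}. la (\<Delta> \<alpha> \<beta> (a k)) (tensor_map K (\<Gamma> \<alpha>) (A \<beta>) (d \<alpha>) (\<lambda>y. y) (\<Delta> \<alpha> \<beta> (b k)))) = \<zero>\<^bsub>TG\<^esub>)
    \<longleftrightarrow> (\<forall>q\<in>carrier (tensor K (A \<alpha>b) (A \<alpha>b)). \<omega> \<alpha>b q = \<zero>\<^bsub>\<Gamma> \<alpha>b\<^esub> \<longrightarrow> \<Psi> (t_map K P A \<Delta> \<alpha>b q) = \<zero>\<^bsub>TG\<^esub>)"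
  (is "?L \<longleftrightarrow> ?R")
proof
  assume L: ?L
  show ?R
  proof (intro ballI impI)
    fix q assume q: "q \<in> carrier (tensor K (A \<alpha>b) (A \<alpha>b))" "\<omega> \<alpha>b q = \<zero>\<^bsub>\<Gamma> \<alpha>b\<^esub>"
    obtain n :: nat and a b where ab: "a \<in> {..<n} \<rightarrow> carrier (A \<alpha>b)" "b \<in> {..<n} \<rightarrow> carrier (A \<alpha>b)"
      "q = (\<Oplus>\<^bsub>tensor K (A \<alpha>b) (A \<alpha>b)\<^esub> k\<in>{..<n}. tens K (A \<alpha>b) (A \<alpha>b) (a k) (b k))"
      by (rule K.tensor_sum_of_tens[OF mab mab q(1)])
    note s = sums(2,3)[OF ab(1,2), folded ab(3)]
    show "\<Psi> (t_map K P A \<Delta> \<alpha>b q) = \<zero>\<^bsub>TG\<^esub>"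
      using L[rule_format, OF ab(1,2)] q(2) unfolding s by blast
  qed
next
  assume R: ?R
  show ?L
  proof (intro allI impI)
    fix n :: nat and a b
    assume ab: "a \<in> {..<n} \<rightarrow> carrier (A \<alpha>b)" "b \<in> {..<n} \<rightarrow> carrier (A \<alpha>b)"
      and z: "(\<Oplus>\<^bsub>\<Gamma> \<alpha>b\<^esub> k \<in> {..<n}. lact (\<Gamma> \<alpha>b) (a k) (d \<alpha>b (b k))) = \<zero>\<^bsub>\<Gamma> \<alpha>b\<^esub>"
    note s = sums[OF ab]
    show "(\<Oplus>\<^bsub>TG\<^esub> k \<in> {..<n}. la (\<Delta> \<alpha> \<beta> (a k)) (tensor_map K (\<Gamma> \<alpha>) (A \<beta>) (d \<alpha>) (\<lambda>y. y) (\<Delta> \<alpha> \<beta> (b k)))) = \<zero>\<^bsub>TG\<^esub>"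
      unfolding s(3)[symmetric] by (rule R[rule_format, OF s(1)]) (simp only: s(2) z)
  qed
qed

end

lemma right_covariant_iff:
  "right_covariant K P A \<Delta> \<Gamma> d \<longleftrightarrow>
    (\<forall>\<alpha>\<in>carrier P. \<forall>\<beta>\<in>carrier P. \<forall>q\<in>carrier (tensor K (A (\<alpha> \<otimes>\<^bsub>P\<^esub> \<beta>)) (A (\<alpha> \<otimes>\<^bsub>P\<^esub> \<beta>))).
      \<omega> (\<alpha> \<otimes>\<^bsub>P\<^esub> \<beta>) q = \<zero>\<^bsub>\<Gamma> (\<alpha> \<otimes>\<^bsub>P\<^esub> \<beta>)\<^esub>
        \<longrightarrow> cov_defect \<Gamma> d \<alpha> \<beta> (t_map K P A \<Delta> (\<alpha> \<otimes>\<^bsub>P\<^esub> \<beta>) q) = \<zero>\<^bsub>tensor K (\<Gamma> \<alpha>) (A \<beta>)\<^esub>)"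
  unfolding right_covariant_def using right_covariant_degree_iff by (intro ball_cong refl) auto

end

end

section \<open>From an ideal to a right covariant calculus\<close>

context galois_hopf_group_coalgebra begin

lemma ideal_fodc:
  assumes "right_ideal J A1" "J \<subseteq> a_kernel A1 K \<epsilon>"
  shows "fodc K P A (ideal_calculus K P A \<Delta> J) (ideal_d K P A \<Delta> J)"
  unfolding fodc_iff
proof
  fix \<alpha> assume "\<alpha> \<in> carrier P"
  then show "first_order_calculus K (A \<alpha>) (ideal_calculus K P A \<Delta> J \<alpha>) (ideal_d K P A \<Delta> J \<alpha>)"
    using K.quot_first_order_calculus[OF algebra N_sub_sub_bimodule[OF _ assms]]
    by (simp add: ideal_calculus_def ideal_d_def[abs_def])
qed

text \<open>An element \<open>q\<close> of the kernel splits as \<open>p + m(q) \<otimes> 1\<close>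
  with \<open>p\<close> in \<open>N_sub\<close>. The defect at \<open>t p\<close> vanishes since
  \<open>t p\<close> lies in \<open>J \<otimes> A\<close>, and the second summand is killed by
  \<open>cov_defect_t_one\<close>.\<close>

lemma ideal_right_covariant:
  assumes J: "right_ideal J A1" and Jk: "J \<subseteq> a_kernel A1 K \<epsilon>"
  shows "right_covariant K P A \<Delta> (ideal_calculus K P A \<Delta> J) (ideal_d K P A \<Delta> J)"
proof -
  let ?\<Gamma> = "ideal_calculus K P A \<Delta> J" and ?d = "ideal_d K P A \<Delta> J"
  note fodc = ideal_fodc[OF J Jk]
  have Jc: "J \<subseteq> carrier A1" using Jk by (auto simp: a_kernel_def')
  note m1 = mod[OF P.one_closed]
  have calc: "calc_map K (?\<Gamma> \<alpha>) (?d \<alpha>) q = N_sub K P A \<Delta> J \<alpha> +>\<^bsub>univ_bimod K (A \<alpha>)\<^esub>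
      (q \<ominus>\<^bsub>tensor K (A \<alpha>) (A \<alpha>)\<^esub> tens K (A \<alpha>) (A \<alpha>) (tensor_mult K (A \<alpha>) q) \<one>\<^bsub>A \<alpha>\<^esub>)"
    if "\<alpha> \<in> carrier P" "q \<in> carrier (tensor K (A \<alpha>) (A \<alpha>))" for \<alpha> q
    using K.quot_calc_map[OF algebra[OF that(1)] N_sub_sub_bimodule[OF that(1) J Jk] that(2)]
    by (simp add: ideal_calculus_def ideal_d_def[abs_def])
  have zero_iff: "N_sub K P A \<Delta> J \<alpha> +>\<^bsub>univ_bimod K (A \<alpha>)\<^esub> p = \<zero>\<^bsub>?\<Gamma> \<alpha>\<^esub> \<longleftrightarrow> p \<in> N_sub K P A \<Delta> J \<alpha>"
    if "\<alpha> \<in> carrier P" "p \<in> carrier (univ_bimod K (A \<alpha>))" for \<alpha> p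
    unfolding ideal_calculus_def
    by (rule K.quot_bimod_eq_zero_iff[OF algebra[OF that(1)] K.univ_bimod_bimodule[OF algebra[OF that(1)]]
          N_sub_sub_bimodule[OF that(1) J Jk] that(2)])
  \<comment> \<open>The inverse image of \<open>r \<otimes> 1\<close> under \<open>t\<close> lies in
    \<open>N_sub\<close>, so its class is zero; the retraction does not change it.\<close>
  have eta: "inv_form ?\<Gamma> ?d \<alpha> r = \<zero>\<^bsub>?\<Gamma> \<alpha>\<^esub>" if \<alpha>: "\<alpha> \<in> carrier P" and r: "r \<in> J" for \<alpha> r
  proof -
    interpret U: module K "univ_bimod K (A \<alpha>)" by (rule K.univ_bimod_module[OF algebra[OF \<alpha>]])
    interpret T: module K "tensor K (A \<alpha>) (A \<alpha>)" by (rule tens_mod[OF \<alpha> \<alpha>])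
    note sb = N_sub_sub_bimodule[OF \<alpha> J Jk]
    note o = one_closed[OF \<alpha>]
    have rc: "r \<in> carrier A1" using r Jc by auto
    let ?X = "tens K A1 (A \<alpha>) r \<one>\<^bsub>A \<alpha>\<^esub>" let ?q = "t_inv \<alpha> ?X"
    have X: "?X \<in> carrier (tensor K A1 (A \<alpha>))" by (rule K.tens_closed[OF m1 mod[OF \<alpha>] rc o])
    have q: "?q \<in> carrier (tensor K (A \<alpha>) (A \<alpha>))" by (rule linear_map_closed[OF t_inv_linear[OF \<alpha>] X])
    have qN: "?q \<in> N_sub K P A \<Delta> J \<alpha>"
      using q K.tensor_sub_submodule(2)[OF m1 mod[OF \<alpha>] Jc r o] by (simp add: N_sub_iff[OF \<alpha> Jc] t_t_inv[OF \<alpha> X])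
    then have qU: "?q \<in> carrier (univ_bimod K (A \<alpha>))"
      using sb U.submoduleE(1) by (auto simp: sub_bimodule_def)
    then have "?q \<ominus>\<^bsub>tensor K (A \<alpha>) (A \<alpha>)\<^esub> tens K (A \<alpha>) (A \<alpha>) (tensor_mult K (A \<alpha>) ?q) \<one>\<^bsub>A \<alpha>\<^esub> = ?q"
      by (simp add: K.univ_bimod_simps[OF algebra[OF \<alpha>]] K.tens_zero_left[OF mod[OF \<alpha>] mod[OF \<alpha>] o] a_minus_def)
    then show ?thesis
      unfolding inv_form_def calc[OF \<alpha> q] using zero_iff[OF \<alpha> qU] qN by simp
  qed
  show ?thesis
    unfolding right_covariant_iff[OF fodc]
  proof (intro ballI impI)
    fix \<alpha> \<beta> q
    let ?ab = "\<alpha> \<otimes>\<^bsub>P\<^esub> \<beta>" let ?A = "A ?ab"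
    let ?T = "tensor K ?A ?A" and ?\<Psi> = "cov_defect ?\<Gamma> ?d \<alpha> \<beta>" and ?TG = "tensor K (?\<Gamma> \<alpha>) (A \<beta>)"
    assume \<alpha>: "\<alpha> \<in> carrier P" and \<beta>: "\<beta> \<in> carrier P" and q: "q \<in> carrier ?T"
      and z: "calc_map K (?\<Gamma> ?ab) (?d ?ab) q = \<zero>\<^bsub>?\<Gamma> ?ab\<^esub>"
    have \<alpha>\<beta>: "?ab \<in> carrier P" using \<alpha> \<beta> by simp
    interpret T: module K ?T by (rule tens_mod[OF \<alpha>\<beta> \<alpha>\<beta>])
    note mG = fodc_module[OF fodc \<alpha>]
    note mTG = K.tensor_module[OF mG mod[OF \<beta>]]
    interpret TG: module K ?TG by (rule mTG)
    let ?c = "tensor_mult K ?A q" let ?c1 = "tens K ?A ?A ?c \<one>\<^bsub>?A\<^esub>" let ?p = "q \<ominus>\<^bsub>?T\<^esub> ?c1"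
    have c: "?c \<in> carrier ?A" by (rule linear_map_closed[OF K.tensor_mult_linear[OF algebra[OF \<alpha>\<beta>]] q])
    have c1: "?c1 \<in> carrier ?T" by (rule K.tens_closed[OF mod[OF \<alpha>\<beta>] mod[OF \<alpha>\<beta>] c one_closed[OF \<alpha>\<beta>]])
    have pU: "?p \<in> carrier (univ_bimod K ?A)" by (rule K.tensor_retract_closed[OF algebra[OF \<alpha>\<beta>] q])
    have "?p \<in> N_sub K P A \<Delta> J ?ab" using z zero_iff[OF \<alpha>\<beta> pU] by (simp add: calc[OF \<alpha>\<beta> q])
    then have tp: "t_map K P A \<Delta> ?ab ?p \<in> tensor_sub K A1 ?A J" by (simp add: N_sub_iff[OF \<alpha>\<beta> Jc])
    note cl = cov_defect_linear[OF fodc \<alpha> \<beta>]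
    note la = K.tensor_lact_bilinear[OF algebra[OF \<alpha>] algebra[OF \<beta>] fodc_bimodule[OF fodc \<alpha>]]
    have "?\<Psi> (t_map K P A \<Delta> ?ab ?p) \<in> {\<zero>\<^bsub>?TG\<^esub>}"
    proof (rule K.linear_map_tensor_sub[OF m1 mod[OF \<alpha>\<beta>] mTG Jc cl K.zero_submodule[OF mTG] _ tp])
      fix r x assume r: "r \<in> J" and x: "x \<in> carrier ?A"
      have rc: "r \<in> carrier A1" using r Jc by auto
      show "?\<Psi> (tens K A1 ?A r x) \<in> {\<zero>\<^bsub>?TG\<^esub>}"
        using linear_map_zero[OF mTG mTG bilinear_map_right[OF la linear_map_closed[OF comult_linear[OF \<alpha> \<beta>] x]]]
        by (simp add: cov_defect_tens[OF fodc \<alpha> \<beta> rc x] eta[OF \<alpha> r] K.tens_zero_left[OF mG mod[OF \<beta>] one_closed[OF \<beta>]])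
    qed
    moreover have "q = ?p \<oplus>\<^bsub>?T\<^esub> ?c1" using q c1 by (simp add: a_minus_def T.M.a_assoc T.M.l_neg)
    then have "?\<Psi> (t_map K P A \<Delta> ?ab q) = ?\<Psi> (t_map K P A \<Delta> ?ab ?p) \<oplus>\<^bsub>?TG\<^esub> ?\<Psi> (t_map K P A \<Delta> ?ab ?c1)"
      using linear_map_add[OF linear_map_comp[OF cl t_linear[OF \<alpha>\<beta>]] T.M.minus_closed[OF q c1] c1] by simp
    ultimately show "?\<Psi> (t_map K P A \<Delta> ?ab q) = \<zero>\<^bsub>?TG\<^esub>"
      by (simp add: cov_defect_t_one[OF fodc \<alpha> \<beta> c])
  qed
qed

section \<open>From a right covariant calculus to its ideal\<close>

definition "calculus_ideal \<Gamma> d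
  = {r \<in> carrier A1. \<epsilon> r = \<zero>\<^bsub>K\<^esub> \<and> inv_form \<Gamma> d \<one>\<^bsub>P\<^esub> r = \<zero>\<^bsub>\<Gamma> \<one>\<^bsub>P\<^esub>\<^esub>}"

lemma calculus_ideal_kernel: "calculus_ideal \<Gamma> d \<subseteq> a_kernel A1 K \<epsilon>"
  by (auto simp: calculus_ideal_def a_kernel_def')

context
  fixes \<Gamma> :: "_ \<Rightarrow> ('a, 'e, 'g, 'h) bimod_scheme" and d
  assumes fodc: "fodc K P A \<Gamma> d"
begin

private abbreviation (input) "om \<alpha> \<equiv> calc_map K (\<Gamma> \<alpha>) (d \<alpha>)"
private abbreviation (input) "et \<equiv> inv_form \<Gamma> d"
private abbreviation (input) "Jd \<equiv> calculus_ideal \<Gamma> d"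

text \<open>Let \<open>q\<close> be the inverse image of \<open>r \<otimes> 1\<close> under
  \<open>t\<close>; it lies in the sub-bimodule \<open>ker \<omega>\<close> of the universal
  bimodule. Then \<open>(r \<otimes> 1) t(x \<otimes> y) = t(x q y)\<close>, so the inverse image of
  \<open>(r \<otimes> 1) X\<close> is killed by \<open>\<omega>\<close> for every \<open>X\<close>.
  Taking \<open>X = a \<otimes> 1\<close> gives \<open>\<eta>(r a) = 0\<close>.\<close>

lemma calculus_ideal_right_ideal: "right_ideal Jd A1"
proof -
  interpret A1: ring A1 by (rule rng[OF P.one_closed])
  interpret A1m: module K A1 by (rule mod[OF P.one_closed])
  note m1 = mod[OF P.one_closed] and alg1 = algebra[OF P.one_closed]
  note mG = fodc_module[OF fodc P.one_closed]
  interpret G: module K "\<Gamma> \<one>\<^bsub>P\<^esub>" by (rule mG)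
  note il = inv_form_linear[OF fodc P.one_closed]
  have "submodule {r \<in> carrier A1. et \<one>\<^bsub>P\<^esub> r = \<zero>\<^bsub>\<Gamma> \<one>\<^bsub>P\<^esub>\<^esub>} K A1" by (rule linear_map_kernel[OF m1 mG il])
  have eps_inv: "\<epsilon> (\<ominus>\<^bsub>A1\<^esub> r) = \<zero>\<^bsub>K\<^esub>" if "r \<in> carrier A1" "\<epsilon> r = \<zero>\<^bsub>K\<^esub>" for r
    using counit_smult[of "\<ominus>\<^bsub>K\<^esub> \<one>\<^bsub>K\<^esub>" r] that by (simp add: A1m.smult_l_minus)
  have eps_0: "\<epsilon> \<zero>\<^bsub>A1\<^esub> = \<zero>\<^bsub>K\<^esub>"
    using counit_smult[of "\<zero>\<^bsub>K\<^esub>" "\<zero>\<^bsub>A1\<^esub>"] counit_closed[of "\<zero>\<^bsub>A1\<^esub>"] by simp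
  have "submodule Jd K A1"
    unfolding calculus_ideal_def
    using linear_map_zero[OF m1 mG il] linear_map_uminus[OF m1 mG il]
    by (intro A1m.submoduleI)
      (auto simp: eps_0 eps_inv counit_add counit_smult linear_map_add[OF il] linear_map_smult[OF il])
  then have "additive_subgroup Jd A1"
    by (intro additive_subgroupI submodule.axioms(1))
  moreover have "r \<otimes>\<^bsub>A1\<^esub> a \<in> Jd" if r: "r \<in> Jd" and a: "a \<in> carrier A1" for r a
  proof -
    have rc: "r \<in> carrier A1" and re: "\<epsilon> r = \<zero>\<^bsub>K\<^esub>" and r0: "et \<one>\<^bsub>P\<^esub> r = \<zero>\<^bsub>\<Gamma> \<one>\<^bsub>P\<^esub>\<^esub>"
      using r by (auto simp: calculus_ideal_def)
    let ?U = "univ_bimod K A1" and ?tn = "tens K A1 A1" and ?t = "t_map K P A \<Delta> \<one>\<^bsub>P\<^esub>" and ?ti = "t_inv \<one>\<^bsub>P\<^esub>"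
    let ?mul = "\<lambda>X Y. X \<otimes>\<^bsub>tensor_alg K A1 A1\<^esub> Y"
    let ?q = "?ti (?tn r \<one>\<^bsub>A1\<^esub>)"
    note tcl = K.tens_closed[OF m1 m1]
    note r1 = tcl[OF rc A1.one_closed]
    have q: "?q \<in> carrier A11" by (rule linear_map_closed[OF t_inv_linear[OF P.one_closed] r1])
    have tq: "?t ?q = ?tn r \<one>\<^bsub>A1\<^esub>" by (rule t_t_inv[OF P.one_closed r1])
    \<comment> \<open>\<open>\<epsilon>(r) = 0\<close> is what places \<open>q\<close> in the
      universal bimodule, where the kernel of \<open>\<omega>\<close> is stable on both
      sides.\<close>
    have "tensor_mult K A1 ?q = \<zero>\<^bsub>A1\<^esub>"
      using counit_id_t[OF P.one_closed q] counit_id_tens[OF P.one_closed rc A1.one_closed] re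
      by (simp add: tq)
    moreover have "om \<one>\<^bsub>P\<^esub> ?q = \<zero>\<^bsub>\<Gamma> \<one>\<^bsub>P\<^esub>\<^esub>" using r0 by (simp add: inv_form_def)
    ultimately have qN: "?q \<in> {q \<in> carrier ?U. om \<one>\<^bsub>P\<^esub> q = \<zero>\<^bsub>\<Gamma> \<one>\<^bsub>P\<^esub>\<^esub>}"
      using q by (simp add: K.univ_bimod_simps[OF alg1])
    note sb = K.calc_map_kernel_sub_bimodule[OF alg1 fodc_degree[OF fodc P.one_closed]]
    note mb = K.tensor_alg_bilinear[OF alg1 alg1]
    note dl = comult_1_linear[OF P.one_closed]
    have lin: "linear_map K A11 (\<Gamma> \<one>\<^bsub>P\<^esub>) (\<lambda>p. om \<one>\<^bsub>P\<^esub> (?ti (?mul (?tn r \<one>\<^bsub>A1\<^esub>) (?t p))))"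
      by (rule linear_map_comp[OF linear_map_comp[OF omega_linear[OF fodc P.one_closed] t_inv_linear[OF P.one_closed]]
            linear_map_comp[OF bilinear_map_right[OF mb r1] t_linear[OF P.one_closed]]])
    have z: "om \<one>\<^bsub>P\<^esub> (?ti (?mul (?tn r \<one>\<^bsub>A1\<^esub>) (?t p))) = \<zero>\<^bsub>\<Gamma> \<one>\<^bsub>P\<^esub>\<^esub>" if p: "p \<in> carrier A11" for p
    proof (rule K.tensor_linear_ext[OF m1 m1 lin linear_map_const_zero[OF mG] p])
      fix x y assume x: "x \<in> carrier A1" and y: "y \<in> carrier A1"
      note dy = linear_map_closed[OF dl y] and t1x = tcl[OF A1.one_closed x]
      note lq = bilinear_map_closed[OF K.univ_lact_bilinear[OF alg1] x q]
      note rq = bilinear_map_closed[OF K.univ_ract_bilinear[OF alg1] lq y]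
      have "?mul (?tn r \<one>\<^bsub>A1\<^esub>) (?t (?tn x y)) = ?mul (?mul (?tn r \<one>\<^bsub>A1\<^esub>) (?tn \<one>\<^bsub>A1\<^esub> x)) (\<Delta> \<one>\<^bsub>P\<^esub> \<one>\<^bsub>P\<^esub> y)"
        by (simp add: t_tens[OF P.one_closed x y] K.tensor_alg_assoc[OF alg1 alg1 r1 t1x dy])
      \<comment> \<open>Elements in different tensor factors commute, so
        \<open>1 \<otimes> x\<close> can be moved to the left and absorbed as a left action.\<close>
      also have "?mul (?tn r \<one>\<^bsub>A1\<^esub>) (?tn \<one>\<^bsub>A1\<^esub> x) = ?mul (?tn \<one>\<^bsub>A1\<^esub> x) (?tn r \<one>\<^bsub>A1\<^esub>)"
        using rc x by (simp add: K.tensor_alg_tens[OF alg1 alg1])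
      also have "\<dots> = ?t (lact ?U x ?q)" by (simp add: t_lact[OF P.one_closed x q] tq)
      also have "?mul \<dots> (\<Delta> \<one>\<^bsub>P\<^esub> \<one>\<^bsub>P\<^esub> y) = ?t (ract ?U (lact ?U x ?q) y)"
        by (simp add: t_ract[OF P.one_closed y lq])
      finally have "?ti (?mul (?tn r \<one>\<^bsub>A1\<^esub>) (?t (?tn x y))) = ract ?U (lact ?U x ?q) y"
        by (simp add: t_inv_t[OF P.one_closed rq])
      moreover have "ract ?U (lact ?U x ?q) y \<in> {q \<in> carrier ?U. om \<one>\<^bsub>P\<^esub> q = \<zero>\<^bsub>\<Gamma> \<one>\<^bsub>P\<^esub>\<^esub>}"
        using sb qN x y unfolding sub_bimodule_def by blast
      ultimately show "om \<one>\<^bsub>P\<^esub> (?ti (?mul (?tn r \<one>\<^bsub>A1\<^esub>) (?t (?tn x y)))) = \<zero>\<^bsub>\<Gamma> \<one>\<^bsub>P\<^esub>\<^esub>" by simp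
    qed
    note a1 = tcl[OF a A1.one_closed]
    have "om \<one>\<^bsub>P\<^esub> (?ti (?mul (?tn r \<one>\<^bsub>A1\<^esub>) (?tn a \<one>\<^bsub>A1\<^esub>))) = \<zero>\<^bsub>\<Gamma> \<one>\<^bsub>P\<^esub>\<^esub>"
      using z[OF linear_map_closed[OF t_inv_linear[OF P.one_closed] a1]] by (simp add: t_t_inv[OF P.one_closed a1])
    then have "et \<one>\<^bsub>P\<^esub> (r \<otimes>\<^bsub>A1\<^esub> a) = \<zero>\<^bsub>\<Gamma> \<one>\<^bsub>P\<^esub>\<^esub>"
      using rc a by (simp add: inv_form_def K.tensor_alg_tens[OF alg1 alg1])
    moreover have "\<epsilon> (r \<otimes>\<^bsub>A1\<^esub> a) = \<zero>\<^bsub>K\<^esub>" using rc a re by (simp add: counit_mult counit_closed)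
    ultimately show ?thesis using rc a by (simp add: calculus_ideal_def)
  qed
  ultimately show ?thesis by (simp add: right_ideal_def)
qed

text \<open>Membership in the ideal is a condition in degree 1 only. As \<open>\<alpha>\<close>
  times its inverse is 1, covariance for this pair transports it to
  \<open>\<eta>(r) \<otimes> 1 = 0\<close> in the tensor product of \<open>\<Gamma> \<alpha>\<close>
  with the algebra of inverse degree, and the unit is then cancelled.\<close>

lemma inv_form_calculus_ideal:
  assumes cov: "right_covariant K P A \<Delta> \<Gamma> d" and \<alpha>: "\<alpha> \<in> carrier P" and r: "r \<in> Jd"
  shows "et \<alpha> r = \<zero>\<^bsub>\<Gamma> \<alpha>\<^esub>"
proof -
  let ?i = "inv\<^bsub>P\<^esub> \<alpha>"
  have i: "?i \<in> carrier P" using \<alpha> by simp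
  interpret A1: ring A1 by (rule rng[OF P.one_closed])
  interpret Aa: ring "A \<alpha>" by (rule rng[OF \<alpha>])
  interpret Aam: module K "A \<alpha>" by (rule mod[OF \<alpha>])
  have rc: "r \<in> carrier A1" and r0: "et \<one>\<^bsub>P\<^esub> r = \<zero>\<^bsub>\<Gamma> \<one>\<^bsub>P\<^esub>\<^esub>" using r by (auto simp: calculus_ideal_def)
  note mG = fodc_module[OF fodc \<alpha>] and bG = fodc_bimodule[OF fodc \<alpha>]
  note ec = linear_map_closed[OF inv_form_linear[OF fodc \<alpha>] rc]
  let ?X = "tens K A1 A1 r \<one>\<^bsub>A1\<^esub>"
  have X: "?X \<in> carrier A11" by (rule K.tens_closed[OF mod[OF P.one_closed] mod[OF P.one_closed] rc A1.one_closed])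
  \<comment> \<open>The inverse image of \<open>r \<otimes> 1\<close> lies in the kernel of
    \<open>\<omega>\<close> in degree 1 because \<open>\<eta>(r) = 0\<close> there.\<close>
  have "cov_defect \<Gamma> d \<alpha> ?i (t_map K P A \<Delta> \<one>\<^bsub>P\<^esub> (t_inv \<one>\<^bsub>P\<^esub> ?X)) = \<zero>\<^bsub>tensor K (\<Gamma> \<alpha>) (A ?i)\<^esub>"
    using cov[unfolded right_covariant_iff[OF fodc], rule_format, OF \<alpha> i, of "t_inv \<one>\<^bsub>P\<^esub> ?X"] \<alpha>
      linear_map_closed[OF t_inv_linear[OF P.one_closed] X] r0 by (simp add: inv_form_def)
  then have "cov_defect \<Gamma> d \<alpha> ?i ?X = \<zero>\<^bsub>tensor K (\<Gamma> \<alpha>) (A ?i)\<^esub>" by (simp add: t_t_inv[OF P.one_closed X])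
  moreover have "cov_defect \<Gamma> d \<alpha> ?i ?X = tens K (\<Gamma> \<alpha>) (A ?i) (et \<alpha> r) \<one>\<^bsub>A ?i\<^esub>"
  proof -
    interpret Ai: ring "A ?i" by (rule rng[OF i])
    have "cov_defect \<Gamma> d \<alpha> ?i ?X
        = tensor_lact K (\<Gamma> \<alpha>) (A ?i) (\<Delta> \<alpha> ?i \<one>\<^bsub>A1\<^esub>) (tens K (\<Gamma> \<alpha>) (A ?i) (et \<alpha> r) \<one>\<^bsub>A ?i\<^esub>)"
      using cov_defect_tens[OF fodc \<alpha> i rc, of "\<one>\<^bsub>A1\<^esub>"] \<alpha> by simp
    also have "\<Delta> \<alpha> ?i \<one>\<^bsub>A1\<^esub> = tens K (A \<alpha>) (A ?i) \<one>\<^bsub>A \<alpha>\<^esub> \<one>\<^bsub>A ?i\<^esub>" using comult_one[OF \<alpha> i] \<alpha> by simp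
    finally show ?thesis
      by (simp add: K.tensor_lact_tens[OF algebra[OF \<alpha>] algebra[OF i] bG] ec lact_one[OF bG])
  qed
  ultimately have t0: "tens K (\<Gamma> \<alpha>) (A ?i) (et \<alpha> r) \<one>\<^bsub>A ?i\<^esub> = \<zero>\<^bsub>tensor K (\<Gamma> \<alpha>) (A ?i)\<^esub>" by simp
  show ?thesis
  proof (cases "\<one>\<^bsub>A ?i\<^esub> = \<zero>\<^bsub>A ?i\<^esub>")
    case False
    then show ?thesis using K.tens_eq_zero[OF mG mod[OF i] ec one_closed[OF i] _ t0] by blast
  next
    case True
    \<comment> \<open>The antipode axiom transports the degeneracy of \<open>A ?i\<close> to \<open>A \<alpha>\<close>.\<close>
    have S: "linear_map K (A ?i) (A \<alpha>) (S ?i)" using antipode_linear[OF i] \<alpha> by simp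
    have b: "bilinear_map K (A ?i) (A \<alpha>) (A \<alpha>) (\<lambda>a b. S ?i a \<otimes>\<^bsub>A \<alpha>\<^esub> b)"
      by (rule bilinear_map_comp[OF mult_bilinear[OF \<alpha>] S linear_map_ident])
    have "\<one>\<^bsub>A \<alpha>\<^esub> = tensor_lift K (A \<alpha>) (\<lambda>a b. S ?i a \<otimes>\<^bsub>A \<alpha>\<^esub> b) (\<Delta> ?i \<alpha> \<one>\<^bsub>A1\<^esub>)"
      using antipode_left[OF \<alpha> A1.one_closed] by (simp add: counit_one)
    also have "\<Delta> ?i \<alpha> \<one>\<^bsub>A1\<^esub> = tens K (A ?i) (A \<alpha>) \<one>\<^bsub>A ?i\<^esub> \<one>\<^bsub>A \<alpha>\<^esub>" using comult_one[OF i \<alpha>] \<alpha> by simp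
    also have "tensor_lift K (A \<alpha>) (\<lambda>a b. S ?i a \<otimes>\<^bsub>A \<alpha>\<^esub> b) \<dots> = S ?i \<zero>\<^bsub>A ?i\<^esub> \<otimes>\<^bsub>A \<alpha>\<^esub> \<one>\<^bsub>A \<alpha>\<^esub>"
      using K.tensor_lift_tens[OF mod[OF i] mod[OF \<alpha>] mod[OF \<alpha>] b one_closed[OF i] one_closed[OF \<alpha>]] True by simp
    also have "\<dots> = \<zero>\<^bsub>A \<alpha>\<^esub>" by (simp add: linear_map_zero[OF mod[OF i] mod[OF \<alpha>] S])
    finally have "\<one>\<^bsub>A \<alpha>\<^esub> = \<zero>\<^bsub>A \<alpha>\<^esub>" .
    then show ?thesis
      using lact_one[OF bG ec] linear_map_zero[OF mod[OF \<alpha>] mG bilinear_map_left[OF lact_bilinear[OF bG] ec]] by simp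
  qed
qed

text \<open>The defect for the degrees 1 and \<alpha> factors as \<open>\<eta> \<otimes> id\<close>
  followed by the injective map of \<open>comult_act_injective\<close>. So
  \<open>\<eta> \<otimes> id\<close> kills \<open>t q\<close>, which by exactness over the field
  lies in \<open>ker \<eta> \<otimes> A \<alpha>\<close>; it remains to pass from
  \<open>ker \<eta>\<close> to the ideal.\<close>

lemma calculus_kernel_tensor_sub:
  assumes cov: "right_covariant K P A \<Delta> \<Gamma> d" and \<alpha>: "\<alpha> \<in> carrier P"
    and q: "q \<in> carrier (univ_bimod K (A \<alpha>))" and q0: "om \<alpha> q = \<zero>\<^bsub>\<Gamma> \<alpha>\<^esub>"
  shows "t_map K P A \<Delta> \<alpha> q \<in> tensor_sub K A1 (A \<alpha>) Jd"
proof -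
  interpret A1: ring A1 by (rule rng[OF P.one_closed])
  interpret A1m: module K A1 by (rule mod[OF P.one_closed])
  note m1 = mod[OF P.one_closed] and ma = mod[OF \<alpha>]
  note mG = fodc_module[OF fodc P.one_closed] and bG = fodc_bimodule[OF fodc P.one_closed]
  interpret G: module K "\<Gamma> \<one>\<^bsub>P\<^esub>" by (rule mG)
  note mT = tens_mod[OF P.one_closed \<alpha>]
  interpret T: module K "tensor K A1 (A \<alpha>)" by (rule mT)
  note il = inv_form_linear[OF fodc P.one_closed]
  let ?X = "t_map K P A \<Delta> \<alpha> q" and ?TG = "tensor K (\<Gamma> \<one>\<^bsub>P\<^esub>) (A \<alpha>)" and ?tn = "tens K A1 (A \<alpha>)"
  note mTG = K.tensor_module[OF mG ma]
  have qT: "q \<in> carrier (tensor K (A \<alpha>) (A \<alpha>))" and qm: "tensor_mult K (A \<alpha>) q = \<zero>\<^bsub>A \<alpha>\<^esub>"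
    using q by (simp_all add: K.univ_bimod_simps[OF algebra[OF \<alpha>]])
  have X: "?X \<in> carrier (tensor K A1 (A \<alpha>))" by (rule linear_map_closed[OF t_linear[OF \<alpha>] qT])
  have X0: "cov_defect \<Gamma> d \<one>\<^bsub>P\<^esub> \<alpha> ?X = \<zero>\<^bsub>?TG\<^esub>"
    using cov[unfolded right_covariant_iff[OF fodc], rule_format, OF P.one_closed \<alpha>, of q] \<alpha> qT q0 by simp
  let ?Y = "tensor_map K (\<Gamma> \<one>\<^bsub>P\<^esub>) (A \<alpha>) (et \<one>\<^bsub>P\<^esub>) (\<lambda>y. y) ?X"
  have Y: "?Y \<in> carrier ?TG" by (rule linear_map_closed[OF K.tensor_map_linear[OF m1 ma mG ma il linear_map_ident] X])
  have Fbil: "bilinear_map K (\<Gamma> \<one>\<^bsub>P\<^esub>) (A \<alpha>) ?TG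
      (\<lambda>y x. tensor_lact K (\<Gamma> \<one>\<^bsub>P\<^esub>) (A \<alpha>) (\<Delta> \<one>\<^bsub>P\<^esub> \<alpha> x) (tens K (\<Gamma> \<one>\<^bsub>P\<^esub>) (A \<alpha>) y \<one>\<^bsub>A \<alpha>\<^esub>))"
    by (rule bilinear_map_comp[OF K.tensor_lact_one_bilinear[OF algebra[OF P.one_closed] algebra[OF \<alpha>] bG]
          linear_map_ident comult_1_linear[OF \<alpha>]])
  \<comment> \<open>The defect of \<open>?X\<close>, rewritten as a lift evaluated at
    \<open>(\<eta> \<otimes> id)(?X)\<close>.\<close>
  have "tensor_lift K ?TG
      (\<lambda>y x. tensor_lact K (\<Gamma> \<one>\<^bsub>P\<^esub>) (A \<alpha>) (\<Delta> \<one>\<^bsub>P\<^esub> \<alpha> x) (tens K (\<Gamma> \<one>\<^bsub>P\<^esub>) (A \<alpha>) y \<one>\<^bsub>A \<alpha>\<^esub>)) ?Y = \<zero>\<^bsub>?TG\<^esub>"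
    using K.tensor_lift_tensor_map[OF m1 ma mG ma il linear_map_ident mTG Fbil X] X0 \<alpha>
    by (simp add: cov_defect_def)
  then have Y0: "?Y = \<zero>\<^bsub>?TG\<^esub>" by (rule comult_act_injective[OF \<alpha> bG Y])
  note Xk = K.tensor_map_kernel[OF m1 ma mG il X Y0]
  \<comment> \<open>The kernel of \<open>inv_form\<close> in degree 1 is \<open>Jd \<oplus> K 1\<close>; the second summand is removed by
    the projection \<open>v \<mapsto> v - \<epsilon>(v) 1\<close>, which fixes \<open>?X\<close> since \<open>(\<epsilon> \<otimes> id)(t q) = m(q) = 0\<close>.\<close>
  let ?p = "\<lambda>v. v \<ominus>\<^bsub>A1\<^esub> \<epsilon> v \<odot>\<^bsub>A1\<^esub> \<one>\<^bsub>A1\<^esub>"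
  have el: "linear_map K A1 A1 (\<lambda>v. \<epsilon> v \<odot>\<^bsub>A1\<^esub> \<one>\<^bsub>A1\<^esub>)"
    by (rule bilinear_map_left[OF counit_smult_bilinear(2)[OF m1 linear_map_ident] A1.one_closed])
  have p: "linear_map K A1 A1 ?p" by (rule linear_map_minus[OF m1 linear_map_ident el])
  have eps_diff: "\<epsilon> (?p v) = \<zero>\<^bsub>K\<^esub>" if v: "v \<in> carrier A1" for v
  proof -
    have e: "\<epsilon> v \<in> carrier K" by (rule counit_closed[OF v])
    have "?p v = v \<oplus>\<^bsub>A1\<^esub> (\<ominus>\<^bsub>K\<^esub> \<epsilon> v) \<odot>\<^bsub>A1\<^esub> \<one>\<^bsub>A1\<^esub>" using e by (simp add: a_minus_def A1m.smult_l_minus)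
    then have "\<epsilon> (?p v) = \<epsilon> v \<oplus>\<^bsub>K\<^esub> (\<ominus>\<^bsub>K\<^esub> \<epsilon> v) \<otimes>\<^bsub>K\<^esub> \<one>\<^bsub>K\<^esub>" using v e by (simp add: counit_add counit_smult counit_one)
    then show ?thesis using e by (simp add: K.r_neg)
  qed
  have X_eq: "?X = tensor_map K A1 (A \<alpha>) ?p (\<lambda>y. y) ?X \<oplus>\<^bsub>tensor K A1 (A \<alpha>)\<^esub> ?tn \<one>\<^bsub>A1\<^esub> (counit_id \<alpha> ?X)"
  proof (rule K.tensor_linear_ext[OF m1 ma linear_map_ident _ X])
    show "linear_map K (tensor K A1 (A \<alpha>)) (tensor K A1 (A \<alpha>))
        (\<lambda>X. tensor_map K A1 (A \<alpha>) ?p (\<lambda>y. y) X \<oplus>\<^bsub>tensor K A1 (A \<alpha>)\<^esub> ?tn \<one>\<^bsub>A1\<^esub> (counit_id \<alpha> X))"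
      by (rule linear_map_plus[OF mT K.tensor_map_linear[OF m1 ma m1 ma p linear_map_ident]
            linear_map_comp[OF bilinear_map_right[OF K.tens_bilinear[OF m1 ma] A1.one_closed] counit_id_linear[OF \<alpha>]]])
    fix v w assume v: "v \<in> carrier A1" and w: "w \<in> carrier (A \<alpha>)"
    have e: "\<epsilon> v \<in> carrier K" by (rule counit_closed[OF v])
    have sm: "?tn \<one>\<^bsub>A1\<^esub> (\<epsilon> v \<odot>\<^bsub>A \<alpha>\<^esub> w) = ?tn (\<epsilon> v \<odot>\<^bsub>A1\<^esub> \<one>\<^bsub>A1\<^esub>) w"
      using e w by (simp add: K.tens_smult_left[OF m1 ma] K.tens_smult_right[OF m1 ma])
    have pv: "?p v \<oplus>\<^bsub>A1\<^esub> \<epsilon> v \<odot>\<^bsub>A1\<^esub> \<one>\<^bsub>A1\<^esub> = v"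
      using v e by (simp add: a_minus_def A1.a_assoc A1.l_neg)
    have "?tn (?p v) w \<oplus>\<^bsub>tensor K A1 (A \<alpha>)\<^esub> ?tn (\<epsilon> v \<odot>\<^bsub>A1\<^esub> \<one>\<^bsub>A1\<^esub>) w = ?tn v w"
      using K.tens_add_left[OF m1 ma w linear_map_closed[OF p v] linear_map_closed[OF el v]] unfolding pv by (rule sym)
    then show "?tn v w = tensor_map K A1 (A \<alpha>) ?p (\<lambda>y. y) (?tn v w)
        \<oplus>\<^bsub>tensor K A1 (A \<alpha>)\<^esub> ?tn \<one>\<^bsub>A1\<^esub> (counit_id \<alpha> (?tn v w))"
      using v w by (simp add: K.tensor_map_tens[OF m1 ma m1 ma p linear_map_ident] counit_id_tens[OF \<alpha>] sm)
  qed
  have c0: "?tn \<one>\<^bsub>A1\<^esub> (counit_id \<alpha> ?X) = \<zero>\<^bsub>tensor K A1 (A \<alpha>)\<^esub>"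
    unfolding counit_id_t[OF \<alpha> qT] qm by (rule K.tens_zero_right[OF m1 ma A1.one_closed])
  have "?X = tensor_map K A1 (A \<alpha>) ?p (\<lambda>y. y) ?X"
    using X_eq unfolding c0
      T.M.r_zero[OF linear_map_closed[OF K.tensor_map_linear[OF m1 ma m1 ma p linear_map_ident] X]] .
  also have "\<dots> \<in> tensor_sub K A1 (A \<alpha>) Jd"
  proof (rule K.tensor_map_in_tensor_sub[OF m1 ma m1 p _ _ _ Xk])
    fix v assume "v \<in> {v \<in> carrier A1. et \<one>\<^bsub>P\<^esub> v = \<zero>\<^bsub>\<Gamma> \<one>\<^bsub>P\<^esub>\<^esub>}"
    then have v: "v \<in> carrier A1" "et \<one>\<^bsub>P\<^esub> v = \<zero>\<^bsub>\<Gamma> \<one>\<^bsub>P\<^esub>\<^esub>" by auto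
    have "et \<one>\<^bsub>P\<^esub> (?p v) = \<zero>\<^bsub>\<Gamma> \<one>\<^bsub>P\<^esub>\<^esub>"
      using linear_map_diff[OF m1 mG il v(1) linear_map_closed[OF el v(1)]] v counit_closed[OF v(1)]
      by (simp add: linear_map_smult[OF il] inv_form_one[OF fodc P.one_closed] a_minus_def)
    then show "?p v \<in> Jd" using linear_map_closed[OF p v(1)] eps_diff[OF v(1)] by (simp add: calculus_ideal_def)
  qed (auto simp: calculus_ideal_def)
  finally show ?thesis .
qed

text \<open>For one inclusion, an element of \<open>N_sub\<close> has \<open>t q\<close> in
  \<open>Jd \<otimes> A \<alpha>\<close>, and there \<open>\<omega>\<close> after the inverse of
  \<open>t\<close> is \<open>x \<eta>(r) = 0\<close>. The other is
  \<open>calculus_kernel_tensor_sub\<close>.\<close>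

lemma N_sub_calculus_ideal:
  assumes cov: "right_covariant K P A \<Delta> \<Gamma> d" and \<alpha>: "\<alpha> \<in> carrier P"
  shows "N_sub K P A \<Delta> Jd \<alpha> = {q \<in> carrier (univ_bimod K (A \<alpha>)). om \<alpha> q = \<zero>\<^bsub>\<Gamma> \<alpha>\<^esub>}"
proof
  interpret U: module K "univ_bimod K (A \<alpha>)" by (rule K.univ_bimod_module[OF algebra[OF \<alpha>]])
  have Jc: "Jd \<subseteq> carrier A1" by (auto simp: calculus_ideal_def)
  note m1 = mod[OF P.one_closed] and ma = mod[OF \<alpha>] and mG = fodc_module[OF fodc \<alpha>]
  show "{q \<in> carrier (univ_bimod K (A \<alpha>)). om \<alpha> q = \<zero>\<^bsub>\<Gamma> \<alpha>\<^esub>} \<subseteq> N_sub K P A \<Delta> Jd \<alpha>"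
    using calculus_kernel_tensor_sub[OF cov \<alpha>]
    by (auto simp: N_sub_iff[OF \<alpha> Jc] K.univ_bimod_simps[OF algebra[OF \<alpha>]])
  show "N_sub K P A \<Delta> Jd \<alpha> \<subseteq> {q \<in> carrier (univ_bimod K (A \<alpha>)). om \<alpha> q = \<zero>\<^bsub>\<Gamma> \<alpha>\<^esub>}"
  proof
    fix q assume q: "q \<in> N_sub K P A \<Delta> Jd \<alpha>"
    have "N_sub K P A \<Delta> Jd \<alpha> \<subseteq> carrier (univ_bimod K (A \<alpha>))"
      using N_sub_sub_bimodule[OF \<alpha> calculus_ideal_right_ideal calculus_ideal_kernel] U.submoduleE(1)
      by (auto simp: sub_bimodule_def)
    then have qU: "q \<in> carrier (univ_bimod K (A \<alpha>))" using q by auto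
    have qT: "q \<in> carrier (tensor K (A \<alpha>) (A \<alpha>))" and tq: "t_map K P A \<Delta> \<alpha> q \<in> tensor_sub K A1 (A \<alpha>) Jd"
      using q by (simp_all add: N_sub_iff[OF \<alpha> Jc])
    have "om \<alpha> (t_inv \<alpha> (t_map K P A \<Delta> \<alpha> q)) \<in> {\<zero>\<^bsub>\<Gamma> \<alpha>\<^esub>}"
    proof (rule K.linear_map_tensor_sub[OF m1 ma mG Jc
          linear_map_comp[OF omega_linear[OF fodc \<alpha>] t_inv_linear[OF \<alpha>]] K.zero_submodule[OF mG] _ tq])
      fix r x assume r: "r \<in> Jd" and x: "x \<in> carrier (A \<alpha>)"
      have rc: "r \<in> carrier A1" using r Jc by auto
      show "om \<alpha> (t_inv \<alpha> (tens K A1 (A \<alpha>) r x)) \<in> {\<zero>\<^bsub>\<Gamma> \<alpha>\<^esub>}"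
        using linear_map_zero[OF mG mG bilinear_map_right[OF lact_bilinear[OF fodc_bimodule[OF fodc \<alpha>]] x]]
        by (simp add: omega_t_inv_tens[OF fodc \<alpha> rc x] inv_form_calculus_ideal[OF cov \<alpha> r])
    qed
    then show "q \<in> {q \<in> carrier (univ_bimod K (A \<alpha>)). om \<alpha> q = \<zero>\<^bsub>\<Gamma> \<alpha>\<^esub>}"
      using qU by (simp add: t_inv_t[OF \<alpha> qT])
  qed
qed

text \<open>The relations imposed by the ideal are exactly the kernel of \<open>\<omega>\<close> on
  the universal bimodule, so the isomorphism theorem applies in each degree; the degreewise maps are
  collected by choice.\<close>

lemma ideal_calculus_iso:
  assumes cov: "right_covariant K P A \<Delta> \<Gamma> d"
  shows "fodc_iso K P A (ideal_calculus K P A \<Delta> Jd) (ideal_d K P A \<Delta> Jd) \<Gamma> d"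
proof -
  let ?G = "ideal_calculus K P A \<Delta> Jd" and ?d = "ideal_d K P A \<Delta> Jd"
  have "\<exists>i. bij_betw i (carrier (?G \<alpha>)) (carrier (\<Gamma> \<alpha>)) \<and> linear_map K (?G \<alpha>) (\<Gamma> \<alpha>) i \<and>
      (\<forall>a\<in>carrier (A \<alpha>). \<forall>x\<in>carrier (?G \<alpha>).
        i (lact (?G \<alpha>) a x) = lact (\<Gamma> \<alpha>) a (i x) \<and> i (ract (?G \<alpha>) x a) = ract (\<Gamma> \<alpha>) (i x) a) \<and>
      (\<forall>a\<in>carrier (A \<alpha>). i (?d \<alpha> a) = d \<alpha> a)" if \<alpha>: "\<alpha> \<in> carrier P" for \<alpha>
    unfolding ideal_calculus_def ideal_d_def N_sub_calculus_ideal[OF cov \<alpha>]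
    by (rule K.calculus_iso_quotient[OF algebra[OF \<alpha>] fodc_degree[OF fodc \<alpha>]]) blast
  then show ?thesis unfolding fodc_iso_def by (intro bchoice) blast
qed

end

end

theorem theorem4p4:
  fixes K :: "('k, 'n) ring_scheme"
    and P :: "('p, 'q) monoid_scheme"
    and A :: "'p \<Rightarrow> ('k, 'a, 'm) module_scheme"
    and \<Delta> :: "'p \<Rightarrow> 'p \<Rightarrow> 'a \<Rightarrow> ('a \<times> 'a \<Rightarrow> 'k) set"
    and \<epsilon> :: "'a \<Rightarrow> 'k"
    and S :: "'p \<Rightarrow> 'a \<Rightarrow> 'a"
  assumes "hopf_group_coalgebra K P A \<Delta> \<epsilon> S"
    and t_bij: "\<And>\<alpha>. \<alpha> \<in> carrier P \<Longrightarrow>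
      bij_betw (t_map K P A \<Delta> \<alpha>)
        (carrier (tensor K (A \<alpha>) (A \<alpha>))) (carrier (tensor K (A \<one>\<^bsub>P\<^esub>) (A \<alpha>)))"
  shows "(\<forall>R. right_ideal R (A \<one>\<^bsub>P\<^esub>) \<and> R \<subseteq> a_kernel (A \<one>\<^bsub>P\<^esub>) K \<epsilon> \<longrightarrow>
      (\<forall>\<alpha>\<in>carrier P. sub_bimodule K (A \<alpha>) (univ_bimod K (A \<alpha>)) (N_sub K P A \<Delta> R \<alpha>)) \<and>
      fodc K P A (ideal_calculus K P A \<Delta> R) (ideal_d K P A \<Delta> R) \<and>
      right_covariant K P A \<Delta> (ideal_calculus K P A \<Delta> R) (ideal_d K P A \<Delta> R))
    \<and>
    (\<forall>(\<Gamma> :: 'p \<Rightarrow> ('k, 'a, 'g, 'r) bimod_scheme) d.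
      fodc K P A \<Gamma> d \<and> right_covariant K P A \<Delta> \<Gamma> d \<longrightarrow>
      (\<exists>R. right_ideal R (A \<one>\<^bsub>P\<^esub>) \<and> R \<subseteq> a_kernel (A \<one>\<^bsub>P\<^esub>) K \<epsilon> \<and>
        fodc_iso K P A (ideal_calculus K P A \<Delta> R) (ideal_d K P A \<Delta> R) \<Gamma> d))"
proof -
  interpret H: galois_hopf_group_coalgebra K P A \<Delta> \<epsilon> S
    using assms by (intro galois_hopf_group_coalgebra.intro galois_hopf_group_coalgebra_axioms.intro)
  show ?thesis
  proof (intro conjI allI impI ballI)
    fix R assume "right_ideal R (A \<one>\<^bsub>P\<^esub>) \<and> R \<subseteq> a_kernel (A \<one>\<^bsub>P\<^esub>) K \<epsilon>"
    then have R: "right_ideal R (A \<one>\<^bsub>P\<^esub>)" "R \<subseteq> a_kernel (A \<one>\<^bsub>P\<^esub>) K \<epsilon>" by auto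
    show "sub_bimodule K (A \<alpha>) (univ_bimod K (A \<alpha>)) (N_sub K P A \<Delta> R \<alpha>)" if "\<alpha> \<in> carrier P" for \<alpha>
      by (rule H.N_sub_sub_bimodule[OF that R])
    show "fodc K P A (ideal_calculus K P A \<Delta> R) (ideal_d K P A \<Delta> R)"
      by (rule H.ideal_fodc[OF R])
    show "right_covariant K P A \<Delta> (ideal_calculus K P A \<Delta> R) (ideal_d K P A \<Delta> R)"
      by (rule H.ideal_right_covariant[OF R])
  next
    fix \<Gamma> :: "'p \<Rightarrow> ('k, 'a, 'g, 'r) bimod_scheme" and d
    assume "fodc K P A \<Gamma> d \<and> right_covariant K P A \<Delta> \<Gamma> d"
    then have G: "fodc K P A \<Gamma> d" "right_covariant K P A \<Delta> \<Gamma> d" by auto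
    show "\<exists>R. right_ideal R (A \<one>\<^bsub>P\<^esub>) \<and> R \<subseteq> a_kernel (A \<one>\<^bsub>P\<^esub>) K \<epsilon> \<and>
        fodc_iso K P A (ideal_calculus K P A \<Delta> R) (ideal_d K P A \<Delta> R) \<Gamma> d"
      by (intro exI[of _ "H.calculus_ideal \<Gamma> d"] conjI H.calculus_ideal_kernel
          H.calculus_ideal_right_ideal[OF G(1)] H.ideal_calculus_iso[OF G])
  qed
qed

end
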